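(* Let $0\le\beta<1$. Let $\mathbf{L}_\beta$ be the Leray transform of the hypersurface $\mathcal{S}_\beta=\{(\zeta_1,\zeta_2)\in\mathbb{C}^2:\operatorname{Im}(\zeta_2)=|\zeta_1|^2+\beta\operatorname{Re}(\zeta_1^2)\}$, and let $\sigma=dx_1\wedge dy_1\wedge dx_2$. Then $\mathbf{L}_\beta: L^2(\mathcal{S}_\beta,\sigma)\to L^2(\mathcal{S}_\beta,\sigma)$ is a bounded operator, and its operator norm is $$\|\mathbf{L}_\beta\|=\frac{1}{\sqrt[4]{1-\beta^2}}.$$
   Context: Write $\zeta_j=x_j+iy_j$, and use $(x_1,y_1,x_2)\in\mathbb{R}^3$ as global coordinates on $\mathcal{S}_\beta$ (so $y_2=|\zeta_1|^2+\beta\operatorname{Re}(\zeta_1^2)$); $\sigma$ is then Lebesgue measure on $\mathbb{R}^3$. For a hypersurface in $\mathbb{C}^2$ with defining function $\rho$, the Leray transform is $\mathbf{L}f(z)=\frac{1}{(2\pi i)^2}\int f(\zeta)\,\frac{\partial\rho(\zeta)\wedge\bar\partial\partial\rho(\zeta)}{\langle\partial\rho(\zeta),\zeta-z\rangle^2}$, where $\langle\cdot,\cdot\rangle$ is the bilinear pairing of $(1,0)$-forms with vectors. For $\mathcal{S}_\beta$ (with $\rho=|\zeta_1|^2+\beta\operatorname{Re}\zeta_1^2-\operatorname{Im}\zeta_2$) this is $$\mathbf{L}_\beta f(z)=\frac{1}{4\pi^2}\int_{\mathcal{S}_\beta}\frac{f(\zeta)}{\big[(\bar\zeta_1+\beta\zeta_1)(\zeta_1-z_1)+\tfrac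 i2(\zeta_2-z_2)\big]^2}\,d\sigma(\zeta).$$ For $z\in\mathcal{S}_\beta$ this is a singular integral. It is interpreted, for $f\in C_c^\infty(\mathcal{S}_\beta)\cong C_c^\infty(\mathbb{R}^3)$, as the iterated integral in which one integrates first in $x_2$ (with $\zeta_1\neq z_1$ fixed) and then in $(x_1,y_1)$. The operator $\mathbf{L}_\beta$ on $L^2(\mathcal{S}_\beta,\sigma)$ is the continuous extension from this dense subspace; its existence is part of the boundedness assertion. *)

theory Defs
  imports "HOL-Analysis.Analysis"
begin

definition square_integrable :: "('a::euclidean_space \<Rightarrow> complex) \<Rightarrow> bool" where
  "square_integrable f \<longleftrightarrow>
     f \<in> borel_measurable lborel \<and> integrable lborel (\<lambda>x. (cmod (f x))\<^sup>2)"

lemma square_integrable_mult_left: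
  "square_integrable f \<Longrightarrow> square_integrable (\<lambda>x. c * f x)"
  by (auto simp: square_integrable_def norm_mult power_mult_distrib)

lemma square_integrable_add:
  assumes "square_integrable f" "square_integrable g"
  shows "square_integrable (\<lambda>x. f x + g x)"
proof -
  have "integrable lborel (\<lambda>x. (cmod (f x + g x))\<^sup>2)"
  proof (rule Bochner_Integration.integrable_bound)
    show "integrable lborel (\<lambda>x. 2 * (cmod (f x))\<^sup>2 + 2 * (cmod (g x))\<^sup>2)"
      using assms by (simp add: square_integrable_def)
    show "(\<lambda>x. (cmod (f x + g x))\<^sup>2) \<in> borel_measurable lborel"
      using assms by (auto simp: square_integrable_def)
    have "(cmod (a + b))\<^sup>2 \<le> 2 * (cmod a)\<^sup>2 + 2 * (cmod b)\<^sup>2" for a b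
    proof -
      have "(cmod (a + b))\<^sup>2 \<le> (cmod a + cmod b)\<^sup>2"
        by (simp add: norm_triangle_ineq power_mono)
      also have "\<dots> \<le> 2 * (cmod a)\<^sup>2 + 2 * (cmod b)\<^sup>2"
        using sum_squares_bound[of "cmod a" "cmod b"] by (simp add: power2_sum)
      finally show ?thesis .
    qed
    then show "AE x in lborel. norm ((cmod (f x + g x))\<^sup>2)
        \<le> norm (2 * (cmod (f x))\<^sup>2 + 2 * (cmod (g x))\<^sup>2)"
      by simp
  qed
  with assms show ?thesis by (auto simp: square_integrable_def)
qed

lemma square_integrable_inner:
  assumes "square_integrable f" "square_integrable g"
  shows "integrable lborel (\<lambda>x. f x \<bullet> g x)"
proof (rule Bochner_Integration.integrable_bound)
  show "integrable lborel (\<lambda>x. (cmod (f x))\<^sup>2 + (cmod (g x))\<^sup>2)"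
    using assms by (simp add: square_integrable_def)
  show "(\<lambda>x. f x \<bullet> g x) \<in> borel_measurable lborel"
    using assms by (auto simp: square_integrable_def)
  have "\<bar>a \<bullet> b\<bar> \<le> (cmod a)\<^sup>2 + (cmod b)\<^sup>2" for a b :: complex
  proof -
    have "2 * \<bar>a \<bullet> b\<bar> \<le> 2 * cmod a * cmod b"
      using Cauchy_Schwarz_ineq2[of a b] by simp
    also have "\<dots> \<le> (cmod a)\<^sup>2 + (cmod b)\<^sup>2"
      by (rule sum_squares_bound)
    finally show ?thesis
      using zero_le_power2[of "cmod a"] zero_le_power2[of "cmod b"] by linarith
  qed
  then show "AE x in lborel. norm (f x \<bullet> g x) \<le> norm ((cmod (f x))\<^sup>2 + (cmod (g x))\<^sup>2)"
    by simp
qed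

quotient_type (overloaded) 'a L2 = "'a::euclidean_space \<Rightarrow> complex" / partial:
  "\<lambda>f g. square_integrable f \<and> square_integrable g \<and> (AE x in lborel. f x = g x)"
  morphisms rep_L2 L2_of
proof (rule part_equivpI)
  show "\<exists>f::'a \<Rightarrow> complex. square_integrable f \<and> square_integrable f \<and> (AE x in lborel. f x = f x)"
    by (rule exI[of _ "\<lambda>_. 0"]) (simp add: square_integrable_def)
  show "symp (\<lambda>f g::'a \<Rightarrow> complex. square_integrable f \<and> square_integrable g \<and> (AE x in lborel. f x = g x))"
    by (auto simp: symp_def eq_commute)
  show "transp (\<lambda>f g::'a \<Rightarrow> complex. square_integrable f \<and> square_integrable g \<and> (AE x in lborel. f x = g x))"
    by (auto simp: transp_def elim!: eventually_elim2)
qed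

lift_definition scaleC_L2 :: "complex \<Rightarrow> 'a::euclidean_space L2 \<Rightarrow> 'a L2"
  is "\<lambda>c f x. c * f x"
  by (auto simp: square_integrable_mult_left)

instantiation L2 :: (euclidean_space) real_inner
begin

lift_definition zero_L2 :: "'a L2" is "\<lambda>_. 0"
  by (simp add: square_integrable_def)

lift_definition plus_L2 :: "'a L2 \<Rightarrow> 'a L2 \<Rightarrow> 'a L2" is "\<lambda>f g x. f x + g x"
  by (auto simp: square_integrable_add elim!: eventually_elim2)

definition uminus_L2 :: "'a L2 \<Rightarrow> 'a L2" where
  "uminus_L2 f = scaleC_L2 (- 1) f"

definition minus_L2 :: "'a L2 \<Rightarrow> 'a L2 \<Rightarrow> 'a L2" where
  "minus_L2 f g = f + - g"

definition scaleR_L2 :: "real \<Rightarrow> 'a L2 \<Rightarrow> 'a L2" where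
  "scaleR_L2 r f = scaleC_L2 (complex_of_real r) f"

text \<open>On \<^typ>\<open>complex\<close> the inner product \<open>z \<bullet> w\<close> is \<open>Re (z * cnj w)\<close>, so this is the real
  part of the Hermitian inner product and induces the usual norm.\<close>

lift_definition inner_L2 :: "'a L2 \<Rightarrow> 'a L2 \<Rightarrow> real" is
  "\<lambda>f g. LINT x|lborel. f x \<bullet> g x"
proof -
  fix f f' g g' :: "'a \<Rightarrow> complex"
  assume f: "square_integrable f \<and> square_integrable f' \<and> (AE x in lborel. f x = f' x)"
    and g: "square_integrable g \<and> square_integrable g' \<and> (AE x in lborel. g x = g' x)"
  show "(LINT x|lborel. f x \<bullet> g x) = (LINT x|lborel. f' x \<bullet> g' x)"
  proof (rule integral_cong_AE)
    show "AE x in lborel. f x \<bullet> g x = f' x \<bullet> g' x"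
      using f g by (auto elim!: eventually_elim2)
  qed (use f g in \<open>auto simp: square_integrable_def\<close>)
qed

lift_definition norm_L2 :: "'a L2 \<Rightarrow> real" is
  "\<lambda>f. sqrt (LINT x|lborel. (cmod (f x))\<^sup>2)"
proof -
  fix f g :: "'a \<Rightarrow> complex"
  assume f: "square_integrable f \<and> square_integrable g \<and> (AE x in lborel. f x = g x)"
  have "(LINT x|lborel. (cmod (f x))\<^sup>2) = (LINT x|lborel. (cmod (g x))\<^sup>2)"
    by (rule integral_cong_AE) (use f in \<open>auto simp: square_integrable_def\<close>)
  then show "sqrt (LINT x|lborel. (cmod (f x))\<^sup>2) = sqrt (LINT x|lborel. (cmod (g x))\<^sup>2)"
    by simp
qed

definition dist_L2 :: "'a L2 \<Rightarrow> 'a L2 \<Rightarrow> real" where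
  "dist_L2 f g = norm (f - g)"

definition sgn_L2 :: "'a L2 \<Rightarrow> 'a L2" where
  "sgn_L2 f = inverse (norm f) *\<^sub>R f"

definition uniformity_L2 :: "('a L2 \<times> 'a L2) filter" where
  "uniformity_L2 = (INF e\<in>{0<..}. principal {(f, g). dist f g < e})"

definition open_L2 :: "'a L2 set \<Rightarrow> bool" where
  "open_L2 U \<longleftrightarrow> (\<forall>f\<in>U. eventually (\<lambda>(f', g). f' = f \<longrightarrow> g \<in> U) uniformity)"

instance
proof
  fix a b c :: "'a L2" and r s :: real
  show "a + b + c = a + (b + c)"
    by transfer (auto simp: square_integrable_add add.assoc)
  show "a + b = b + a"
    by transfer (auto simp: square_integrable_add add.commute)
  show "0 + a = a"
    by transfer auto
  show "- a + a = 0"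
    unfolding uminus_L2_def
    by transfer
      (auto simp: square_integrable_def)
  show "a - b = a + - b"
    by (rule minus_L2_def)
  show "r *\<^sub>R (a + b) = r *\<^sub>R a + r *\<^sub>R b"
    unfolding scaleR_L2_def
    by transfer (auto intro!: square_integrable_add square_integrable_mult_left simp: distrib_left)
  show "(r + s) *\<^sub>R a = r *\<^sub>R a + s *\<^sub>R a"
    unfolding scaleR_L2_def
    by transfer (auto intro!: square_integrable_add square_integrable_mult_left simp: distrib_right)
  show "r *\<^sub>R s *\<^sub>R a = (r * s) *\<^sub>R a"
    unfolding scaleR_L2_def
    by transfer (auto intro!: square_integrable_mult_left simp: mult.assoc)
  show "1 *\<^sub>R a = a"
    unfolding scaleR_L2_def by transfer auto
  show "dist a b = norm (a - b)"
    by (rule dist_L2_def)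
  show "sgn a = inverse (norm a) *\<^sub>R a"
    by (rule sgn_L2_def)
  show "uniformity = (INF e\<in>{0<..}. principal {(f, g :: 'a L2). dist f g < e})"
    by (rule uniformity_L2_def)
  show "open U \<longleftrightarrow> (\<forall>f\<in>U. eventually (\<lambda>(f', g). f' = f \<longrightarrow> g \<in> U) uniformity)"
    for U :: "'a L2 set"
    by (rule open_L2_def)
  show "a \<bullet> b = b \<bullet> a"
    by transfer (simp add: inner_commute)
  show "(a + b) \<bullet> c = a \<bullet> c + b \<bullet> c"
    by transfer (simp add: inner_add_left square_integrable_inner)
  show "(r *\<^sub>R a) \<bullet> b = r * (a \<bullet> b)"
    unfolding scaleR_L2_def
    by transfer (simp flip: scaleR_conv_of_real)
  show "0 \<le> a \<bullet> a"
    by transfer simp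
  show "a \<bullet> a = 0 \<longleftrightarrow> a = 0"
  proof transfer
    fix f :: "'a \<Rightarrow> complex"
    assume "square_integrable f \<and> square_integrable f \<and> (AE x in lborel. f x = f x)"
    then have f: "square_integrable f" by simp
    have "(LINT x|lborel. f x \<bullet> f x) = 0 \<longleftrightarrow> (AE x in lborel. f x \<bullet> f x = 0)"
      by (rule integral_nonneg_eq_0_iff_AE) (use f in \<open>auto intro: square_integrable_inner\<close>)
    then show "(LINT x|lborel. f x \<bullet> f x) = 0 \<longleftrightarrow>
        square_integrable f \<and> square_integrable (\<lambda>_::'a. 0) \<and> (AE x in lborel. f x = 0)"
      using f by (simp add: square_integrable_def)
  qed
  show "norm a = sqrt (a \<bullet> a)"
    by transfer (simp add: dot_square_norm)
qed

end

primrec higher_differentiable ::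
    "nat \<Rightarrow> ('a::real_normed_vector \<Rightarrow> 'b::real_normed_vector) \<Rightarrow> bool" where
  "higher_differentiable 0 f \<longleftrightarrow> continuous_on UNIV f"
| "higher_differentiable (Suc n) f \<longleftrightarrow>
     (\<forall>x. f differentiable (at x)) \<and>
     (\<forall>v. higher_differentiable n (\<lambda>x. frechet_derivative f (at x) v))"

definition test_function :: "('a::real_normed_vector \<Rightarrow> complex) \<Rightarrow> bool" where
  "test_function f \<longleftrightarrow>
     (\<forall>n. higher_differentiable n f) \<and> compact (closure {x. f x \<noteq> 0})"

definition hypersurface :: "real \<Rightarrow> (complex \<times> complex) set" where
  "hypersurface \<beta> = {(\<zeta>1, \<zeta>2). Im \<zeta>2 = (cmod \<zeta>1)\<^sup>2 + \<beta> * Re (\<zeta>1\<^sup>2)}"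

definition hypersurface_point :: "real \<Rightarrow> real \<times> real \<times> real \<Rightarrow> complex \<times> complex" where
  "hypersurface_point \<beta> = (\<lambda>(x1, y1, x2).
     (Complex x1 y1,
      Complex x2 ((cmod (Complex x1 y1))\<^sup>2 + \<beta> * Re ((Complex x1 y1)\<^sup>2))))"

lemma bij_betw_hypersurface_point: "bij_betw (hypersurface_point \<beta>) UNIV (hypersurface \<beta>)"
  by (rule bij_betw_byWitness[where f' = "\<lambda>(\<zeta>1, \<zeta>2). (Re \<zeta>1, Im \<zeta>1, Re \<zeta>2)"])
    (auto simp: hypersurface_def hypersurface_point_def complex_eq_iff split: prod.splits)

text \<open>With \<open>\<rho>(\<zeta>) = |\<zeta>\<^sub>1|\<^sup>2 + \<beta> Re (\<zeta>\<^sub>1\<^sup>2) - Im \<zeta>\<^sub>2\<close> one has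
  \<open>\<partial>\<rho> = (cnj \<zeta>\<^sub>1 + \<beta> \<zeta>\<^sub>1) d\<zeta>\<^sub>1 + (\<i>/2) d\<zeta>\<^sub>2\<close>; the Leray denominator is the square of its
  pairing with \<open>\<zeta> - z\<close>, and the Leray form in the numerator together with \<open>1/(2 \<pi> \<i>)\<^sup>2\<close> gives
  \<open>\<sigma> / (4 \<pi>\<^sup>2)\<close>.\<close>

definition leray_denominator :: "real \<Rightarrow> complex \<times> complex \<Rightarrow> complex \<times> complex \<Rightarrow> complex" where
  "leray_denominator \<beta> = (\<lambda>(\<zeta>1, \<zeta>2) (z1, z2).
     ((cnj \<zeta>1 + of_real \<beta> * \<zeta>1) * (\<zeta>1 - z1) + \<i> / 2 * (\<zeta>2 - z2))\<^sup>2)"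

text \<open>For \<open>z\<close> on the hypersurface the integral is singular and is read as an iterated integral,
  first in \<open>x\<^sub>2\<close> and then in \<open>(x\<^sub>1, y\<^sub>1)\<close>. The singular fibre \<open>\<zeta>\<^sub>1 = z\<^sub>1\<close> is a single
  point of the outer integral.\<close>

definition leray_transform ::
    "real \<Rightarrow> (complex \<times> complex \<Rightarrow> complex) \<Rightarrow> complex \<times> complex \<Rightarrow> complex" where
  "leray_transform \<beta> f z = 1 / (4 * of_real pi ^ 2) *
     (LINT (x1, y1)|lborel. (LINT x2|lborel.
        f (hypersurface_point \<beta> (x1, y1, x2)) /
        leray_denominator \<beta> (hypersurface_point \<beta> (x1, y1, x2)) z))"

text \<open>In the global coordinates \<open>(x\<^sub>1, y\<^sub>1, x\<^sub>2)\<close> the measure \<open>\<sigma>\<close> is Lebesgue measure, so \<open>L\<^sup>2\<close> of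
  the hypersurface is \<^typ>\<open>(real \<times> real \<times> real) L2\<close>: a function \<open>f\<close> on the hypersurface
  represents the class of \<open>f \<circ> hypersurface_point \<beta>\<close>. Note that \<open>L2_of\<close> is only meaningful on
  square-integrable functions, so membership of the transform in \<open>L\<^sup>2\<close> is a separate conjunct.\<close>

definition extends_leray_transform ::
    "real \<Rightarrow> ((real \<times> real \<times> real) L2 \<Rightarrow> (real \<times> real \<times> real) L2) \<Rightarrow> bool" where
  "extends_leray_transform \<beta> T \<longleftrightarrow>
     (\<forall>f. test_function (f \<circ> hypersurface_point \<beta>) \<longrightarrow>
        square_integrable (leray_transform \<beta> f \<circ> hypersurface_point \<beta>) \<and>
        T (L2_of (f \<circ> hypersurface_point \<beta>)) =
          L2_of (leray_transform \<beta> f \<circ> hypersurface_point \<beta>))"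

definition leray_operator :: "real \<Rightarrow> (real \<times> real \<times> real) L2 \<Rightarrow> (real \<times> real \<times> real) L2" where
  "leray_operator \<beta> = (THE T. continuous_on UNIV T \<and> extends_leray_transform \<beta> T)"

end

theory Submission
  imports Defs "HOL-Probability.Characteristic_Functions" "HOL-Probability.Sinc_Integral"
begin

text \<open>The Fourier transform in \<open>x\<^sub>2\<close> decomposes the Leray transform into integral operators \<open>T\<^sub>\<xi>\<close>,
  \<open>\<xi> > 0\<close>, on \<open>L\<^sup>2\<close> of the plane with Gaussian kernels; negative frequencies are annihilated. An explicit
  Gaussian integral gives \<open>T\<^sub>\<xi> T\<^sub>\<xi>\<^sup>* = c P\<^sub>\<xi>\<close> with \<open>c = (1 - \<beta>\<^sup>2) powr (- 1/2)\<close>, where \<open>P\<^sub>\<xi>\<close> is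
  self-adjoint and idempotent. Hence \<open>\<parallel>T\<^sub>\<xi>\<^sup>* g\<parallel>\<^sup>2 = c \<parallel>P\<^sub>\<xi> g\<parallel>\<^sup>2 \<le> c \<parallel>g\<parallel>\<^sup>2\<close>, with equality on the range
  of \<open>P\<^sub>\<xi>\<close>, and Plancherel's theorem gives \<open>\<parallel>L\<parallel> = c powr (1/2)\<close>. Since test functions are dense in the
  complete space \<open>L\<^sup>2\<close>, the bound on them yields the continuous extension and its uniqueness.\<close>

subsection \<open>Completeness of \<open>L\<^sup>2\<close>\<close>

text \<open>The kernel is singular on the fibre over \<open>z\<close>, and the order of integration
  is what tames it. Off that fibre the base of the denominator has positive real part, so its
  inverse square is a Laplace integral over \<xi> > 0. Integrating in \<open>x2\<close> first turns
  the smooth datum into Fourier transforms of slices that decay like 1 / (1 + \<xi>^2), while the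
  Gaussian kernels have total mass independent of \<xi>. The remaining double integral in frequency
  and base point converges absolutely, and no principal value occurs. The constant comes from
  comparing normalisations: two one-dimensional Gaussians with weights 1 + \<beta> and 1 - \<beta>
  integrate to the isotropic value divided by the square root of (1 + \<beta>)(1 - \<beta>). This
  factor does not depend on \<xi>, so all frequencies contribute the same norm and a function
  supported in any frequency band can be extremal. The Fourier transform is used only as an
  absolutely convergent integral. Hence the lower bound does not apply an adjoint to arbitrary
  elements of the space; it exhibits one explicit pair of functions playing the roles of a vector
  and its adjoint image.\<close>

lemma square_integrableD:
  assumes "square_integrable f"
  shows "f \<in> borel_measurable borel" "integrable lborel (\<lambda>x. (cmod (f x))\<^sup>2)"
  using assms by (simp_all add: square_integrable_def)

lemma L2_cases:
  obtains f where "square_integrable f" "x = L2_of f"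
  using Quotient_abs_rep[OF Quotient_L2, of x] Quotient_rep_reflp[OF Quotient_L2, of x]
  by metis

lemma norm_L2_of: "square_integrable f \<Longrightarrow> norm (L2_of f) = sqrt (LINT x|lborel. (cmod (f x))\<^sup>2)"
  by (simp add: norm_L2.abs_eq)

lemma inner_L2_of:
  "square_integrable f \<Longrightarrow> square_integrable g \<Longrightarrow> L2_of f \<bullet> L2_of g = (LINT x|lborel. f x \<bullet> g x)"
  by (simp add: inner_L2.abs_eq)

lemma add_L2_of:
  "square_integrable f \<Longrightarrow> square_integrable g \<Longrightarrow> L2_of f + L2_of g = L2_of (\<lambda>x. f x + g x)"
  by (simp add: plus_L2.abs_eq)

lemma scaleC_L2_of: "square_integrable f \<Longrightarrow> scaleC_L2 c (L2_of f) = L2_of (\<lambda>x. c * f x)"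
  by (simp add: scaleC_L2.abs_eq)

lemma scaleR_L2_of: "square_integrable f \<Longrightarrow> r *\<^sub>R L2_of f = L2_of (\<lambda>x. r *\<^sub>R f x)"
  by (simp add: scaleR_L2_def scaleC_L2_of scaleR_conv_of_real)

lemma square_integrable_diff:
  "square_integrable f \<Longrightarrow> square_integrable g \<Longrightarrow> square_integrable (\<lambda>x. f x - g x)"
  using square_integrable_add[of f "\<lambda>x. - 1 * g x"] square_integrable_mult_left[of g "- 1"] by simp

lemma diff_L2_of:
  assumes "square_integrable f" "square_integrable g"
  shows "L2_of f - L2_of g = L2_of (\<lambda>x. f x - g x)"
  using add_L2_of[OF assms(1) square_integrable_mult_left[OF assms(2), of "- 1"]]
  by (simp add: minus_L2_def uminus_L2_def scaleC_L2_of assms)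

lemma zero_L2_of: "0 = L2_of (\<lambda>_. 0)"
  by (simp add: zero_L2_def)

lemma sum_L2_of:
  assumes "\<And>i. i \<in> I \<Longrightarrow> square_integrable (f i)"
  shows "square_integrable (\<lambda>x. \<Sum>i\<in>I. f i x) \<and> (\<Sum>i\<in>I. L2_of (f i)) = L2_of (\<lambda>x. \<Sum>i\<in>I. f i x)"
  using assms
proof (induction I rule: infinite_finite_induct)
  case (insert i I)
  then show ?case
    by (simp add: square_integrable_add add_L2_of)
qed (simp_all add: zero_L2_of square_integrable_def)

lemma square_integrable_bound:
  assumes "f \<in> borel_measurable borel" "integrable lborel (\<lambda>x. (w x)\<^sup>2)"
    and "AE x in lborel. cmod (f x) \<le> w x"
  shows "square_integrable f"
proof -
  have "integrable lborel (\<lambda>x. (cmod (f x))\<^sup>2)"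
  proof (rule Bochner_Integration.integrable_bound[OF assms(2)])
    show "AE x in lborel. norm ((cmod (f x))\<^sup>2) \<le> norm ((w x)\<^sup>2)"
      using assms(3) by eventually_elim (simp add: power_mono)
  qed (use assms in simp)
  then show ?thesis
    using assms(1) by (simp add: square_integrable_def)
qed

text \<open>The squared distance is dominated by 4 times the square of \<open>w\<close>.
  Completeness and every limit in the density proof are reduced to this criterion: a pointwise limit
  together with a square-integrable majorant.\<close>

lemma L2_dominated_convergence:
  fixes f :: "'a::euclidean_space \<Rightarrow> complex" and w :: "'a \<Rightarrow> real"
  assumes [measurable]: "\<And>n. s n \<in> borel_measurable borel" "f \<in> borel_measurable borel"
    and w: "integrable lborel (\<lambda>x. (w x)\<^sup>2)"
    and bound: "\<And>n. AE x in lborel. cmod (s n x) \<le> w x"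
    and lim: "AE x in lborel. (\<lambda>n. s n x) \<longlonglongrightarrow> f x"
  shows "square_integrable f" "(\<lambda>n. L2_of (s n)) \<longlonglongrightarrow> L2_of f"
proof -
  have all: "AE x in lborel. \<forall>n. cmod (s n x) \<le> w x"
    using bound by (simp add: AE_all_countable)
  have fw: "AE x in lborel. cmod (f x) \<le> w x"
    using all lim
  proof eventually_elim
    case (elim x)
    show ?case
      by (rule Lim_bounded[OF tendsto_norm[OF elim(2)], of 0]) (use elim in auto)
  qed
  show f: "square_integrable f"
    by (rule square_integrable_bound[OF _ w fw]) simp
  have s: "square_integrable (s n)" for n
    by (rule square_integrable_bound[OF _ w bound]) simp
  have "(\<lambda>n. LINT x|lborel. (cmod (s n x - f x))\<^sup>2) \<longlonglongrightarrow> (LINT x::'a|lborel. (0::real))"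
  proof (rule integral_dominated_convergence)
    show "integrable lborel (\<lambda>x. 4 * (w x)\<^sup>2)"
      using w by simp
    show "AE x in lborel. (\<lambda>n. (cmod (s n x - f x))\<^sup>2) \<longlonglongrightarrow> 0"
      using lim
    proof eventually_elim
      case (elim x)
      then have "(\<lambda>n. (cmod (s n x - f x))\<^sup>2) \<longlonglongrightarrow> (cmod (f x - f x))\<^sup>2"
        by (intro tendsto_intros)
      then show ?case by simp
    qed
    show "AE x in lborel. norm ((cmod (s n x - f x))\<^sup>2) \<le> 4 * (w x)\<^sup>2" for n
      using all fw
    proof eventually_elim
      case (elim x)
      then have "cmod (s n x) \<le> w x" by simp
      then have "cmod (s n x - f x) \<le> 2 * w x"
        using norm_triangle_ineq4[of "s n x" "f x"] elim by linarith
      then have "(cmod (s n x - f x))\<^sup>2 \<le> (2 * w x)\<^sup>2"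
        by (rule power_mono) simp
      then show ?case by (simp add: power_mult_distrib)
    qed
  qed simp_all
  then have "(\<lambda>n. sqrt (LINT x|lborel. (cmod (s n x - f x))\<^sup>2)) \<longlonglongrightarrow> sqrt 0"
    by (intro tendsto_real_sqrt) simp
  then have "(\<lambda>n. norm (L2_of (s n) - L2_of f)) \<longlonglongrightarrow> 0"
    by (simp add: diff_L2_of norm_L2_of s f square_integrable_diff)
  then show "(\<lambda>n. L2_of (s n)) \<longlonglongrightarrow> L2_of f"
    using tendsto_norm_zero_iff Lim_null by blast
qed

lemma integrable_power2_add:
  fixes f g :: "'a \<Rightarrow> real"
  assumes [measurable]: "f \<in> borel_measurable M" "g \<in> borel_measurable M"
    and "integrable M (\<lambda>x. (f x)\<^sup>2)" "integrable M (\<lambda>x. (g x)\<^sup>2)"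
  shows "integrable M (\<lambda>x. (f x + g x)\<^sup>2)"
proof (rule Bochner_Integration.integrable_bound)
  show "integrable M (\<lambda>x. 2 * (f x)\<^sup>2 + 2 * (g x)\<^sup>2)"
    using assms by simp
  have "(a + b)\<^sup>2 \<le> 2 * a\<^sup>2 + 2 * b\<^sup>2" for a b :: real
    using sum_squares_bound[of a b] by (simp add: power2_sum)
  then show "AE x in M. norm ((f x + g x)\<^sup>2) \<le> norm (2 * (f x)\<^sup>2 + 2 * (g x)\<^sup>2)"
    by simp
qed simp

text \<open>The partial sums of \<open>|g\<^sub>k\<^sub>+\<^sub>1 - g\<^sub>k|\<close> along a fast Cauchy subsequence
  have bounded norms; their limit dominates the sequence.\<close>

instance L2 :: (euclidean_space) complete_space
proof
  fix X :: "nat \<Rightarrow> 'a L2"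
  assume X: "Cauchy X"
  have "\<exists>N. \<forall>m\<ge>N. \<forall>n\<ge>N. dist (X m) (X n) < (1/2)^k" for k :: nat
    using X by (simp add: Cauchy_def)
  then obtain M where M: "\<And>k m n. m \<ge> M k \<Longrightarrow> n \<ge> M k \<Longrightarrow> dist (X m) (X n) < (1/2)^k"
    by metis
  \<comment> \<open>The sum puts \<open>r n\<close> and \<open>r (Suc n)\<close> beyond
    \<open>M n\<close>, so consecutive terms differ by less than (1/2)^n; the summand
    \<open>n\<close> makes \<open>r\<close> strictly increasing even where \<open>M\<close>
    vanishes.\<close>
  define r where "r n = n + (\<Sum>i\<le>n. M i)" for n
  have r: "strict_mono r"
    by (auto simp: r_def strict_mono_Suc_iff)
  have rM: "r n \<ge> M n" "r (Suc n) \<ge> M n" for n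
    using member_le_sum[of n "{..n}" M] member_le_sum[of n "{..Suc n}" M] by (auto simp: r_def)
  define g where "g n = rep_L2 (X (r n))" for n
  have g: "square_integrable (g n)" "L2_of (g n) = X (r n)" for n
    using Quotient_rep_reflp[OF Quotient_L2, of "X (r n)"] Quotient_abs_rep[OF Quotient_L2, of "X (r n)"]
    by (auto simp: g_def)
  have [measurable]: "g n \<in> borel_measurable borel" for n
    by (rule square_integrableD(1)[OF g(1)])
  define d where "d n x = cmod (g (Suc n) x - g n x)" for n x
  define W where "W n x = (\<Sum>k<n. d k x)" for n x
  have d0: "d n x \<ge> 0" for n x by (simp add: d_def)
  have W0: "W n x \<ge> 0" for n x by (simp add: W_def d0 sum_nonneg)
  have [measurable]: "d n \<in> borel_measurable borel" for n
    unfolding d_def by measurable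
  have [measurable]: "W n \<in> borel_measurable borel" for n
    unfolding W_def by measurable
  \<comment> \<open>The real increments are viewed as complex functions so that the triangle
    inequality of the norm on \<open>L2\<close> bounds their partial sums by the geometric series,
    that is by 2.\<close>
  have dsq: "square_integrable (\<lambda>x. complex_of_real (d k x))" for k
    using square_integrable_diff[OF g(1) g(1), of "Suc k" k]
    by (auto simp: square_integrable_def d_def)
  have dn: "norm (L2_of (\<lambda>x. complex_of_real (d k x))) \<le> (1/2)^k" for k
  proof -
    have "norm (L2_of (\<lambda>x. complex_of_real (d k x))) = norm (X (r (Suc k)) - X (r k))"
      unfolding g(2)[symmetric]
      unfolding norm_L2_of[OF dsq] diff_L2_of[OF g(1) g(1)]
        norm_L2_of[OF square_integrable_diff[OF g(1) g(1)]]
      by (simp add: d_def)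
    also have "\<dots> \<le> (1/2)^k"
      using M[OF rM(2) rM(1), of k] by (simp add: dist_norm)
    finally show ?thesis .
  qed
  have Wsq: "square_integrable (\<lambda>x. complex_of_real (W n x))"
    and Wn: "norm (L2_of (\<lambda>x. complex_of_real (W n x))) \<le> 2" for n
  proof -
    have *: "square_integrable (\<lambda>x. \<Sum>k<n. complex_of_real (d k x))"
      "(\<Sum>k<n. L2_of (\<lambda>x. complex_of_real (d k x))) = L2_of (\<lambda>x. \<Sum>k<n. complex_of_real (d k x))"
      using sum_L2_of[of "{..<n}" "\<lambda>k x. complex_of_real (d k x)"] dsq by auto
    then show "square_integrable (\<lambda>x. complex_of_real (W n x))"
      by (simp add: W_def)
    have "norm (L2_of (\<lambda>x. complex_of_real (W n x))) = norm (\<Sum>k<n. L2_of (\<lambda>x. complex_of_real (d k x)))"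
      by (simp add: W_def *)
    also have "\<dots> \<le> (\<Sum>k<n. (1/2)^k)"
      by (rule order_trans[OF norm_sum]) (intro sum_mono dn)
    also have "\<dots> \<le> (\<Sum>k. (1/2::real)^k)"
      by (intro sum_le_suminf) auto
    also have "\<dots> = 2"
      by (subst suminf_geometric) auto
    finally show "norm (L2_of (\<lambda>x. complex_of_real (W n x))) \<le> 2" .
  qed
  have Wi: "integrable lborel (\<lambda>x. (W n x)\<^sup>2)" for n
    using square_integrableD(2)[OF Wsq[of n]] by simp
  have W4: "(LINT x|lborel. (W n x)\<^sup>2) \<le> 4" for n
  proof -
    have "sqrt (LINT x|lborel. (W n x)\<^sup>2) \<le> 2"
      using Wn[of n] by (simp add: norm_L2_of Wsq)
    from real_sqrt_le_iff[of _ 4] this show ?thesis by simp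
  qed
  have mono: "incseq (\<lambda>n. W n x)" for x
    by (auto simp: incseq_Suc_iff W_def d0)
  have "(\<integral>\<^sup>+x. (SUP n. ennreal ((W n x)\<^sup>2)) \<partial>lborel) = (SUP n. \<integral>\<^sup>+x. ennreal ((W n x)\<^sup>2) \<partial>lborel)"
    using mono W0
    by (intro nn_integral_monotone_convergence_SUP)
      (auto simp: incseq_def le_fun_def intro!: ennreal_leI power_mono)
  also have "\<dots> \<le> 4"
  proof (rule SUP_least)
    fix n
    have "(\<integral>\<^sup>+x. ennreal ((W n x)\<^sup>2) \<partial>lborel) = ennreal (LINT x|lborel. (W n x)\<^sup>2)"
      by (rule nn_integral_eq_integral[OF Wi]) simp
    also have "\<dots> \<le> ennreal 4"
      by (rule ennreal_leI[OF W4])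
    finally show "(\<integral>\<^sup>+x. ennreal ((W n x)\<^sup>2) \<partial>lborel) \<le> 4" by simp
  qed
  finally have S4: "(\<integral>\<^sup>+x. (SUP n. ennreal ((W n x)\<^sup>2)) \<partial>lborel) \<le> 4" .
  then have "(\<integral>\<^sup>+x. (SUP n. ennreal ((W n x)\<^sup>2)) \<partial>lborel) \<noteq> \<infinity>"
    by (auto simp: top_unique)
  then have fin: "AE x in lborel. (SUP n. ennreal ((W n x)\<^sup>2)) \<noteq> \<infinity>"
    by (intro nn_integral_noteq_infinite) auto
  \<comment> \<open>Monotone convergence makes the supremum of the squared partial sums integrable,
    hence finite almost everywhere. At such a point all partial sums lie below one number, so the
    nonnegative series converges.\<close>
  have summable: "AE x in lborel. summable (\<lambda>k. d k x)"
    using fin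
  proof eventually_elim
    case (elim x)
    then obtain b where b: "(SUP n. ennreal ((W n x)\<^sup>2)) = ennreal b" "b \<ge> 0"
      by (cases "SUP n. ennreal ((W n x)\<^sup>2)" rule: ennreal_cases) auto
    have Wb: "W n x \<le> sqrt b" for n
    proof (rule real_le_rsqrt)
      have "ennreal ((W n x)\<^sup>2) \<le> ennreal b"
        unfolding b(1)[symmetric] by (rule SUP_upper) simp
      then show "(W n x)\<^sup>2 \<le> b" using b by simp
    qed
    have "(\<Sum>k\<le>n. d k x) \<le> sqrt b" for n
      using Wb[of "Suc n"] by (simp add: W_def lessThan_Suc_atMost)
    then show ?case
      by (intro bounded_imp_summable[where B = "sqrt b"] d0)
  qed
  \<comment> \<open>Outside the set of summability this has a default value; it serves as a majorant
    only almost everywhere.\<close>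
  define w where "w x = (\<Sum>k. d k x)" for x
  have [measurable]: "w \<in> borel_measurable borel"
    unfolding w_def by measurable
  have Wlim: "AE x in lborel. (\<lambda>n. W n x) \<longlonglongrightarrow> w x"
    using summable by eventually_elim (simp add: W_def w_def summable_LIMSEQ)
  have "(\<integral>\<^sup>+x. ennreal ((w x)\<^sup>2) \<partial>lborel) \<le> 4"
  proof -
    have "(\<integral>\<^sup>+x. ennreal ((w x)\<^sup>2) \<partial>lborel) \<le> (\<integral>\<^sup>+x. (SUP n. ennreal ((W n x)\<^sup>2)) \<partial>lborel)"
    proof (rule nn_integral_mono_AE)
      show "AE x in lborel. ennreal ((w x)\<^sup>2) \<le> (SUP n. ennreal ((W n x)\<^sup>2))"
        using Wlim
      proof eventually_elim
        case (elim x)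
        have "(\<lambda>n. ennreal ((W n x)\<^sup>2)) \<longlonglongrightarrow> ennreal ((w x)\<^sup>2)"
          by (intro tendsto_ennrealI tendsto_intros elim)
        then show ?case
          by (rule Lim_bounded[where M = 0]) (auto intro: SUP_upper)
      qed
    qed
    with S4 show ?thesis by order
  qed
  then have w: "integrable lborel (\<lambda>x. (w x)\<^sup>2)"
    by (intro integrableI_bounded) (auto intro: le_less_trans simp: less_top top_unique)
  \<comment> \<open>Defining the limit by \<open>lim\<close> at every point keeps \<open>f\<close>
    measurable; it is the actual limit wherever the telescoping series of increments converges,
    which is almost everywhere.\<close>
  define f where "f x = lim (\<lambda>n. g n x)" for x
  have tel: "g n x = g 0 x + (\<Sum>k<n. g (Suc k) x - g k x)" for n x
    unfolding sum_lessThan_telescope[of "\<lambda>k. g k x" n] by simp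
  have lim: "AE x in lborel. (\<lambda>n. g n x) \<longlonglongrightarrow> f x"
    using summable
  proof eventually_elim
    case (elim x)
    then have "summable (\<lambda>k. g (Suc k) x - g k x)"
      unfolding d_def by (rule summable_norm_cancel)
    then have "convergent (\<lambda>n. \<Sum>k<n. g (Suc k) x - g k x)"
      unfolding summable_iff_convergent .
    then have "convergent (\<lambda>n. g 0 x + (\<Sum>k<n. g (Suc k) x - g k x))"
      by (rule convergent_add[OF convergent_const])
    moreover have "(\<lambda>n. g 0 x + (\<Sum>k<n. g (Suc k) x - g k x)) = (\<lambda>n. g n x)"
      by (rule ext) (rule tel[symmetric])
    ultimately have "convergent (\<lambda>n. g n x)"
      by (rule back_subst[of convergent])
    then show ?case
      unfolding f_def convergent_LIMSEQ_iff .
  qed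
  have "(\<lambda>n. L2_of (g n)) \<longlonglongrightarrow> L2_of f"
  proof (rule L2_dominated_convergence(2)[OF _ _ _ _ lim])
    show "f \<in> borel_measurable borel"
      unfolding f_def by measurable
    show "integrable lborel (\<lambda>x. (cmod (g 0 x) + w x)\<^sup>2)"
      using g(1) w by (intro integrable_power2_add) (auto simp: square_integrable_def)
    show "AE x in lborel. cmod (g n x) \<le> cmod (g 0 x) + w x" for n
      using summable
    proof eventually_elim
      case (elim x)
      have "cmod (g n x) \<le> cmod (g 0 x) + cmod (\<Sum>k<n. g (Suc k) x - g k x)"
        unfolding tel[of n] by (rule norm_triangle_ineq)
      also have "cmod (\<Sum>k<n. g (Suc k) x - g k x) \<le> (\<Sum>k<n. d k x)"
        unfolding d_def by (rule norm_sum)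
      also have "\<dots> \<le> w x"
        unfolding w_def by (rule sum_le_suminf[OF elim]) (auto simp: d0)
      finally show ?case by simp
    qed
  qed simp
  then have "(X \<circ> r) \<longlonglongrightarrow> L2_of f"
    by (simp add: g o_def)
  with X r have "X \<longlonglongrightarrow> L2_of f"
    by (rule Cauchy_converges_subseq)
  then show "convergent X"
    by (auto simp: convergent_def)
qed

subsection \<open>Density of test functions\<close>

text \<open>\<open>higher_differentiable\<close> refers to the derivative chosen by
  \<open>frechet_derivative\<close>. Uniqueness of derivatives allows any explicit derivative
  \<open>D\<close> to be supplied instead.\<close>

lemma higher_differentiable_SucI:
  assumes "\<And>x. (f has_derivative D x) (at x)" "\<And>v. higher_differentiable n (\<lambda>x. D x v)"
  shows "higher_differentiable (Suc n) f"
proof -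
  have "frechet_derivative f (at x) = D x" for x
    using frechet_derivative_at[OF assms(1)] by simp
  with assms show ?thesis
    by (auto simp: differentiable_def)
qed

lemma higher_differentiable_SucD:
  assumes "higher_differentiable (Suc n) f"
  shows "(f has_derivative frechet_derivative f (at x)) (at x)"
    and "higher_differentiable n (\<lambda>x. frechet_derivative f (at x) v)"
  using assms by (auto simp: frechet_derivative_works)

text \<open>Needed for the product rule: one factor stays undifferentiated and must be used at the
  lower order.\<close>

lemma higher_differentiable_Suc_imp: "higher_differentiable (Suc n) f \<Longrightarrow> higher_differentiable n f"
proof (induction n arbitrary: f)
  case 0
  then show ?case
    by (auto intro!: continuous_at_imp_continuous_on differentiable_imp_continuous_within)
next
  case (Suc n)
  from higher_differentiable_SucD[OF Suc.prems] Suc.IH show ?case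
    by (intro higher_differentiable_SucI) auto
qed

lemma higher_differentiable_const: "higher_differentiable n (\<lambda>_. c)"
proof (induction n arbitrary: c)
  case (Suc n)
  show ?case
    by (rule higher_differentiable_SucI[where D = "\<lambda>_ _. 0"]) (auto simp: Suc.IH)
qed simp

lemma higher_differentiable_add:
  "higher_differentiable n f \<Longrightarrow> higher_differentiable n g \<Longrightarrow> higher_differentiable n (\<lambda>x. f x + g x)"
proof (induction n arbitrary: f g)
  case (Suc n)
  note f = higher_differentiable_SucD[OF Suc.prems(1)] and g = higher_differentiable_SucD[OF Suc.prems(2)]
  show ?case
    by (rule higher_differentiable_SucI[OF has_derivative_add[OF f(1) g(1)]]) (rule Suc.IH[OF f(2) g(2)])
qed (auto intro: continuous_on_add)

lemma higher_differentiable_mult: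
  fixes f g :: "'a::real_normed_vector \<Rightarrow> 'b::real_normed_algebra"
  shows "higher_differentiable n f \<Longrightarrow> higher_differentiable n g \<Longrightarrow> higher_differentiable n (\<lambda>x. f x * g x)"
proof (induction n arbitrary: f g)
  case (Suc n)
  note f = higher_differentiable_SucD[OF Suc.prems(1)] and g = higher_differentiable_SucD[OF Suc.prems(2)]
  note IH = Suc.IH[OF higher_differentiable_Suc_imp[OF Suc.prems(1)] g(2)]
    Suc.IH[OF f(2) higher_differentiable_Suc_imp[OF Suc.prems(2)]]
  show ?case
    by (rule higher_differentiable_SucI[OF has_derivative_mult[OF f(1) g(1)]])
      (rule higher_differentiable_add[OF IH])
qed (auto intro: continuous_on_mult)

lemma higher_differentiable_prod:
  fixes f :: "'i \<Rightarrow> 'a::real_normed_vector \<Rightarrow> 'b::{real_normed_algebra, comm_ring_1}"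
  assumes "\<And>i. i \<in> I \<Longrightarrow> higher_differentiable n (f i)"
  shows "higher_differentiable n (\<lambda>x. \<Prod>i\<in>I. f i x)"
  using assms
  by (induction I rule: infinite_finite_induct)
    (auto intro: higher_differentiable_const higher_differentiable_mult)

text \<open>\<open>flat 0\<close> is the classical smooth function that is flat at the origin. The
  powers of t in the denominator are included because differentiation leads from one member of the
  family to a combination of two others, so smoothness of all members follows by one
  induction.\<close>

definition flat :: "nat \<Rightarrow> real \<Rightarrow> real" where
  "flat k t = (if t > 0 then exp (- 1 / t) / t ^ k else 0)"

lemma flat_tendsto_0: "(flat k \<longlongrightarrow> 0) (at 0)"
proof -
  have "((\<lambda>t::real. inverse t ^ k / exp (inverse t)) \<longlongrightarrow> 0) (at_right 0)"
    by (rule filterlim_compose[OF tendsto_power_div_exp_0 filterlim_inverse_at_top_right])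
  moreover have "\<forall>\<^sub>F t in at_right 0. inverse t ^ k / exp (inverse t) = flat k t"
    by (auto simp: eventually_at_filter flat_def exp_minus field_simps)
  ultimately have "(flat k \<longlongrightarrow> 0) (at_right 0)"
    by (rule Lim_transform_eventually)
  moreover have "(flat k \<longlongrightarrow> 0) (at_left 0)"
    by (rule tendsto_eventually) (auto simp: eventually_at_filter flat_def)
  ultimately show ?thesis
    by (simp add: filterlim_split_at)
qed

lemma DERIV_flat: "(flat k has_real_derivative flat (k + 2) t - k * flat (k + 1) t) (at t)"
proof -
  consider "t < 0" | "t = 0" | "t > 0" by linarith
  then show ?thesis
  proof cases
    case 1
    have "((\<lambda>_. 0) has_real_derivative 0) (at t)" by simp
    then have "(flat k has_real_derivative 0) (at t)"
      by (rule has_field_derivative_transform_within_open[of _ _ _ "{..<0}"])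
        (use 1 in \<open>auto simp: flat_def\<close>)
    with 1 show ?thesis by (simp add: flat_def)
  next
    case 2
    \<comment> \<open>The difference quotient of \<open>flat k\<close> at 0 is
      \<open>flat (Suc k)\<close>, on both sides of 0, and this tends to 0.\<close>
    have "((\<lambda>h. (flat k (0 + h) - flat k 0) / h) \<longlongrightarrow> 0) (at 0)"
      by (rule Lim_transform_eventually[OF flat_tendsto_0[of "Suc k"]])
        (auto simp: flat_def eventually_at_filter)
    with 2 show ?thesis
      by (simp add: DERIV_def flat_def)
  next
    case 3
    have "((\<lambda>t. exp (- 1 / t) / t ^ k) has_real_derivative
        (exp (- 1 / t) * (1 / t\<^sup>2) * t ^ k - exp (- 1 / t) * (real k * t ^ (k - 1))) / (t ^ k * t ^ k)) (at t)"
      using 3 by (auto intro!: derivative_eq_intros simp: power2_eq_square)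
    also have "(exp (- 1 / t) * (1 / t\<^sup>2) * t ^ k - exp (- 1 / t) * (real k * t ^ (k - 1))) / (t ^ k * t ^ k)
      = flat (k + 2) t - k * flat (k + 1) t"
      using 3 by (cases k) (auto simp: flat_def field_simps power2_eq_square)
    finally have "((\<lambda>t. exp (- 1 / t) / t ^ k) has_real_derivative flat (k + 2) t - k * flat (k + 1) t) (at t)" .
    then show ?thesis
      by (rule has_field_derivative_transform_within_open[of _ _ _ "{0<..}"])
        (use 3 in \<open>auto simp: flat_def\<close>)
  qed
qed

text \<open>An affine argument is general enough for both faces of a box: \<open>u\<close> becomes a
  positive or a negative multiple of a basis vector. The induction is over all k at once, as the
  derivative raises the index.\<close>

lemma higher_differentiable_flat:
  fixes u :: "'a::real_inner"
  shows "higher_differentiable n (\<lambda>x. complex_of_real (flat k (r + x \<bullet> u)))"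
proof (induction n arbitrary: k)
  case 0
  have "continuous_on UNIV (flat k)"
    using DERIV_flat by (auto intro!: continuous_at_imp_continuous_on DERIV_isCont)
  then have "continuous_on UNIV (\<lambda>x. flat k (r + x \<bullet> u))"
    by (rule continuous_on_compose2) (auto intro!: continuous_intros)
  then show ?case
    by (auto intro: continuous_intros)
next
  case (Suc n)
  show ?case
  proof (rule higher_differentiable_SucI)
    fix x :: 'a
    have *: "((\<lambda>x. r + x \<bullet> u) has_derivative (\<lambda>v. v \<bullet> u)) (at x)"
      by (auto intro!: derivative_eq_intros)
    have "((\<lambda>x. flat k (r + x \<bullet> u)) has_derivative
        (\<lambda>v. (flat (k + 2) (r + x \<bullet> u) - k * flat (k + 1) (r + x \<bullet> u)) * (v \<bullet> u))) (at x)"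
      using has_derivative_compose[OF * DERIV_flat[unfolded has_field_derivative_def]] .
    then show "((\<lambda>x. complex_of_real (flat k (r + x \<bullet> u))) has_derivative
        (\<lambda>v. complex_of_real ((flat (k + 2) (r + x \<bullet> u) - k * flat (k + 1) (r + x \<bullet> u)) * (v \<bullet> u)))) (at x)"
      by (rule has_derivative_of_real)
  next
    fix v
    have "higher_differentiable n (\<lambda>x. complex_of_real (v \<bullet> u) * of_real (flat (k + 2) (r + x \<bullet> u))
        + (- complex_of_real (k * (v \<bullet> u))) * of_real (flat (k + 1) (r + x \<bullet> u)))"
      by (intro higher_differentiable_add higher_differentiable_mult Suc.IH higher_differentiable_const)
    then show "higher_differentiable n
        (\<lambda>x. complex_of_real ((flat (k + 2) (r + x \<bullet> u) - k * flat (k + 1) (r + x \<bullet> u)) * (v \<bullet> u)))"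
      by (simp add: algebra_simps)
  qed
qed

lemma compact_closed_subset: "compact S \<Longrightarrow> closed T \<Longrightarrow> T \<subseteq> S \<Longrightarrow> compact T"
  by (metis compact_Int_closed inf.absorb2)

section \<open>Test functions, their integrability, and smooth bumps on boxes\<close>

lemma test_function_add:
  assumes "test_function f" "test_function g"
  shows "test_function (\<lambda>x. f x + g x)"
proof -
  have "closure {x. f x + g x \<noteq> 0} \<subseteq> closure ({x. f x \<noteq> 0} \<union> {x. g x \<noteq> 0})"
    by (rule closure_mono) auto
  moreover have "compact (closure ({x. f x \<noteq> 0} \<union> {x. g x \<noteq> 0}))"
    unfolding closure_Un using assms by (simp add: test_function_def compact_Un)
  ultimately have "compact (closure {x. f x + g x \<noteq> 0})"
    using compact_closed_subset closed_closure by blast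
  with assms show ?thesis
    by (auto simp: test_function_def intro: higher_differentiable_add)
qed

lemma test_function_mult_left:
  assumes "test_function f"
  shows "test_function (\<lambda>x. c * f x)"
proof -
  have "closure {x. c * f x \<noteq> 0} \<subseteq> closure {x. f x \<noteq> 0}"
    by (rule closure_mono) auto
  then have "compact (closure {x. c * f x \<noteq> 0})"
    using assms compact_closed_subset closed_closure unfolding test_function_def by blast
  with assms show ?thesis
    by (auto simp: test_function_def intro: higher_differentiable_mult higher_differentiable_const)
qed

lemma test_function_zero: "test_function (\<lambda>_. 0)"
  by (simp add: test_function_def higher_differentiable_const)

lemma test_function_continuous: "test_function f \<Longrightarrow> continuous_on UNIV f"
  using higher_differentiable.simps(1) test_function_def by blast

lemma compact_support_bounded:
  fixes f :: "'a::metric_space \<Rightarrow> 'b::real_normed_vector"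
  assumes "continuous_on UNIV f" "compact (closure {x. f x \<noteq> 0})"
  obtains B where "B \<ge> 0" "\<And>x. norm (f x) \<le> B * indicator (closure {x. f x \<noteq> 0}) x"
proof -
  have "bounded (f ` closure {x. f x \<noteq> 0})"
    using assms by (intro compact_imp_bounded compact_continuous_image) (auto intro: continuous_on_subset)
  then obtain B where B: "B > 0" "\<And>x. x \<in> closure {x. f x \<noteq> 0} \<Longrightarrow> norm (f x) \<le> B"
    by (auto simp: bounded_pos)
  show ?thesis
  proof (rule that[of B])
    show "norm (f x) \<le> B * indicator (closure {x. f x \<noteq> 0}) x" for x
      using B closure_subset[of "{x. f x \<noteq> 0}"] by (cases "f x = 0") (auto simp: indicator_def)
  qed (use B in simp)
qed

lemma compact_support_integrable:
  fixes f :: "'a::euclidean_space \<Rightarrow> 'b::euclidean_space"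
  assumes "continuous_on UNIV f" "compact (closure {x. f x \<noteq> 0})"
  shows "integrable lborel f"
proof -
  obtain B where B: "B \<ge> 0" "\<And>x. norm (f x) \<le> B * indicator (closure {x. f x \<noteq> 0}) x"
    using compact_support_bounded[OF assms] by blast
  show ?thesis
  proof (rule Bochner_Integration.integrable_bound)
    have "emeasure lborel (closure {x. f x \<noteq> 0}) < \<infinity>"
      using assms(2) by (intro emeasure_bounded_finite compact_imp_bounded)
    then show "integrable lborel (\<lambda>x. B * indicator (closure {x. f x \<noteq> 0}) x)"
      by (intro integrable_mult_right) (simp add: integrable_indicator_iff)
    show "f \<in> borel_measurable lborel"
      using assms(1) by (simp add: borel_measurable_continuous_onI)
    show "AE x in lborel. norm (f x) \<le> norm (B * indicator (closure {x. f x \<noteq> 0}) x)"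
      using B order_trans[OF B(2) abs_ge_self] by (auto simp flip: real_norm_def)
  qed
qed

lemma test_function_square_integrable:
  fixes f :: "'a::euclidean_space \<Rightarrow> complex"
  assumes "test_function f"
  shows "square_integrable f"
proof -
  have "integrable lborel (\<lambda>x. (cmod (f x))\<^sup>2)"
    using test_function_continuous[OF assms] assms
    by (intro compact_support_integrable) (auto simp: test_function_def intro!: continuous_intros)
  then show ?thesis
    using test_function_continuous[OF assms]
    by (simp add: square_integrable_def borel_measurable_continuous_onI)
qed

text \<open>One factor per face of the box from \<open>l\<close> to \<open>u\<close>. As
  \<open>m\<close> grows, exp (- 1 / (m t)) tends to 1 for every t > 0, so the bumps converge to the
  indicator of the open box while staying below it.\<close>

definition bump :: "real \<Rightarrow> 'a::euclidean_space \<Rightarrow> 'a \<Rightarrow> 'a \<Rightarrow> real" where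
  "bump m l u x = (\<Prod>i\<in>Basis. flat 0 (m * (x \<bullet> i - l \<bullet> i)) * flat 0 (m * (u \<bullet> i - x \<bullet> i)))"

lemma flat_0_bounds: "0 \<le> flat 0 t" "flat 0 t \<le> 1"
  by (auto simp: flat_def)

lemma bump_le_indicator:
  assumes "m > 0"
  shows "0 \<le> bump m l u x" "bump m l u x \<le> indicator (box l u) x"
proof -
  show "0 \<le> bump m l u x"
    by (auto simp: bump_def flat_0_bounds intro!: prod_nonneg)
  show "bump m l u x \<le> indicator (box l u) x"
  proof (cases "x \<in> box l u")
    case True
    then show ?thesis
      by (auto simp: bump_def flat_0_bounds intro!: prod_le_1 mult_le_one)
  next
    case False
    then obtain i where i: "i \<in> Basis" "x \<bullet> i \<le> l \<bullet> i \<or> x \<bullet> i \<ge> u \<bullet> i"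
      by (force simp: mem_box)
    with assms have "flat 0 (m * (x \<bullet> i - l \<bullet> i)) * flat 0 (m * (u \<bullet> i - x \<bullet> i)) = 0"
      by (auto simp: flat_def zero_less_mult_iff)
    with i(1) have "bump m l u x = 0"
      unfolding bump_def by (subst prod_zero_iff) auto
    then show ?thesis by simp
  qed
qed

lemma bump_tendsto: "(\<lambda>n. bump (Suc n) l u x) \<longlonglongrightarrow> indicator (box l u) x"
proof (cases "x \<in> box l u")
  case True
  have *: "(\<lambda>n. flat 0 (Suc n * t)) \<longlonglongrightarrow> 1" if "t > 0" for t :: real
  proof -
    have "(\<lambda>n. exp (- (1 / t) * (1 / real (Suc n)))) \<longlonglongrightarrow> exp (- (1 / t) * 0)"
      by (intro tendsto_intros LIMSEQ_inverse_real_of_nat[unfolded inverse_eq_divide])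
    with that show ?thesis
      by (simp add: flat_def mult.commute)
  qed
  have "(\<lambda>n. bump (Suc n) l u x) \<longlonglongrightarrow> (\<Prod>i\<in>(Basis::'a set). 1 * 1)"
    unfolding bump_def
    by (intro tendsto_prod tendsto_mult *) (use True in \<open>auto simp: mem_box\<close>)
  with True show ?thesis by simp
next
  case False
  have "bump (Suc n) l u x = 0" for n
    using bump_le_indicator[of "Suc n" l u x] False by simp
  with False show ?thesis by simp
qed

lemma test_function_bump:
  assumes "m > 0"
  shows "test_function (\<lambda>x. complex_of_real (bump m l u x))"
proof -
  have "higher_differentiable n (\<lambda>x. \<Prod>i\<in>Basis. complex_of_real (flat 0 (- m * (l \<bullet> i) + x \<bullet> (m *\<^sub>R i)))
      * complex_of_real (flat 0 (m * (u \<bullet> i) + x \<bullet> (- m *\<^sub>R i))))" for n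
    by (intro higher_differentiable_prod higher_differentiable_mult higher_differentiable_flat)
  then have "higher_differentiable n (\<lambda>x. complex_of_real (bump m l u x))" for n
    by (simp add: bump_def algebra_simps)
  moreover have "closure {x. complex_of_real (bump m l u x) \<noteq> 0} \<subseteq> cbox l u"
  proof (rule closure_minimal)
    show "{x. complex_of_real (bump m l u x) \<noteq> 0} \<subseteq> cbox l u"
    proof (rule subsetI)
      fix x assume "x \<in> {x. complex_of_real (bump m l u x) \<noteq> 0}"
      then have "x \<in> box l u"
        using bump_le_indicator[OF assms, of l u x] by (cases "x \<in> box l u") auto
      then show "x \<in> cbox l u"
        using box_subset_cbox by blast
    qed
  qed (rule closed_cbox)
  then have "compact (closure {x. complex_of_real (bump m l u x) \<noteq> 0})"
    using compact_cbox closed_closure compact_closed_subset by blast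
  ultimately show ?thesis
    by (simp add: test_function_def)
qed

lemma bounded_linear_scaleC_L2: "bounded_linear (scaleC_L2 c :: 'a::euclidean_space L2 \<Rightarrow> 'a L2)"
proof (rule bounded_linear_intro)
  fix x y :: "'a L2" and r :: real
  obtain f g where f: "square_integrable f" "x = L2_of f" and g: "square_integrable g" "y = L2_of g"
    by (meson L2_cases)
  show "scaleC_L2 c (x + y) = scaleC_L2 c x + scaleC_L2 c y"
    using f g by (simp add: add_L2_of scaleC_L2_of square_integrable_add square_integrable_mult_left distrib_left)
  show "scaleC_L2 c (r *\<^sub>R x) = r *\<^sub>R scaleC_L2 c x"
    using f by (simp add: scaleR_L2_def scaleC_L2_of square_integrable_mult_left mult.left_commute)
  show "norm (scaleC_L2 c x) \<le> norm x * cmod c"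
    using f by (simp add: scaleC_L2_of norm_L2_of square_integrable_mult_left norm_mult
        power_mult_distrib real_sqrt_mult)
qed

text \<open>Dynkin's argument: the Borel sets whose intersection with a fixed box has its indicator in
  the closure form a Dynkin system containing the boxes.\<close>

theorem test_function_dense: "closure {L2_of f |f. test_function f} = (UNIV :: 'a::euclidean_space L2 set)"
proof -
  define S where "S = {L2_of f |f::'a \<Rightarrow> complex. test_function f}"
  define V where "V = closure S"
  have S_V: "L2_of f \<in> V" if "test_function f" for f :: "'a \<Rightarrow> complex"
    using that closure_subset[of S] by (auto simp: V_def S_def)
  have V_lim: "l \<in> V" if "\<And>n. s n \<in> V" "s \<longlonglongrightarrow> l" for s l
    using closed_sequentially[of V s l] that by (simp add: V_def)
  have V_limS: "l \<in> V" if "\<And>n. s n \<in> S" "s \<longlonglongrightarrow> l" for s l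
    unfolding V_def closure_sequential using that by (intro exI[of _ s]) auto
  have V_add: "a + b \<in> V" if ab: "a \<in> V" "b \<in> V" for a b
  proof -
    obtain s where s: "\<And>n. s n \<in> S" "s \<longlonglongrightarrow> a"
      using ab(1) unfolding V_def closure_sequential by blast
    obtain t where t: "\<And>n. t n \<in> S" "t \<longlonglongrightarrow> b"
      using ab(2) unfolding V_def closure_sequential by blast
    have "s n + t n \<in> S" for n
    proof -
      obtain f g where f: "test_function f" "s n = L2_of f" and g: "test_function g" "t n = L2_of g"
        using s(1)[of n] t(1)[of n] by (auto simp: S_def)
      then have "s n + t n = L2_of (\<lambda>x. f x + g x)"
        by (simp add: add_L2_of test_function_square_integrable)
      with f g show ?thesis
        by (auto simp: S_def intro!: test_function_add)
    qed
    then show ?thesis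
      by (rule V_limS[OF _ tendsto_add[OF s(2) t(2)]])
  qed
  have V_scale: "scaleC_L2 c a \<in> V" if a: "a \<in> V" for a c
  proof -
    obtain s where s: "\<And>n. s n \<in> S" "s \<longlonglongrightarrow> a"
      using a unfolding V_def closure_sequential by blast
    have "scaleC_L2 c (s n) \<in> S" for n
    proof -
      obtain f where f: "test_function f" "s n = L2_of f"
        using s(1)[of n] by (auto simp: S_def)
      then have "scaleC_L2 c (s n) = L2_of (\<lambda>x. c * f x)"
        by (simp add: scaleC_L2_of test_function_square_integrable)
      with f show ?thesis
        by (auto simp: S_def intro!: test_function_mult_left)
    qed
    moreover have "(\<lambda>n. scaleC_L2 c (s n)) \<longlonglongrightarrow> scaleC_L2 c a"
      by (rule bounded_linear.tendsto[OF bounded_linear_scaleC_L2 s(2)])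
    ultimately show ?thesis
      by (rule V_limS)
  qed
  have V_diff: "a - b \<in> V" if "a \<in> V" "b \<in> V" for a b
    using V_add[OF that(1) V_scale[OF that(2), of "- 1"]] by (simp add: minus_L2_def uminus_L2_def)
  have V_sum: "(\<Sum>i\<in>I. a i) \<in> V" if "\<And>i. i \<in> I \<Longrightarrow> a i \<in> V" for a and I :: "'i set"
    using that
  proof (induction I rule: infinite_finite_induct)
    case empty
    show ?case
      using S_V[OF test_function_zero] by (simp add: zero_L2_of)
  next
    case (infinite A)
    then show ?case
      using S_V[OF test_function_zero] by (simp add: zero_L2_of)
  qed (auto intro: V_add)
  have box_int: "integrable lborel (\<lambda>x. (indicator (box l u) x :: real)\<^sup>2)" for l u :: 'a
  proof -
    have "(\<lambda>x. (indicator (box l u) x :: real)\<^sup>2) = indicator (box l u)"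
      by (auto split: split_indicator)
    then show ?thesis
      using emeasure_bounded_finite[of "box l u"] by (simp add: integrable_indicator_iff bounded_box)
  qed
  have box_si: "square_integrable (indicator (A \<inter> box l u))"
    if [measurable]: "A \<in> sets borel" for A and l u :: 'a
    by (rule square_integrable_bound[OF _ box_int[of l u]]) (auto split: split_indicator)
  have box_V: "L2_of (indicator (box l u)) \<in> V" for l u :: 'a
  proof (rule V_lim)
    show "(\<lambda>n. L2_of (\<lambda>x. complex_of_real (bump (Suc n) l u x))) \<longlonglongrightarrow> L2_of (indicator (box l u))"
    proof (rule L2_dominated_convergence(2)[OF _ _ box_int])
      show "(\<lambda>x. complex_of_real (bump (Suc n) l u x)) \<in> borel_measurable borel" for n
        by (intro borel_measurable_continuous_onI test_function_continuous test_function_bump) simp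
      show "AE x in lborel. cmod (complex_of_real (bump (Suc n) l u x)) \<le> indicator (box l u) x" for n
        using bump_le_indicator[of "Suc n" l u] by simp
      have "(\<lambda>n. complex_of_real (bump (Suc n) l u x)) \<longlonglongrightarrow> of_real (indicator (box l u) x)" for x
        by (intro tendsto_of_real bump_tendsto)
      then show "AE x in lborel. (\<lambda>n. complex_of_real (bump (Suc n) l u x)) \<longlonglongrightarrow> indicator (box l u) x"
        by (simp add: of_real_indicator)
    qed simp
    show "L2_of (\<lambda>x. complex_of_real (bump (Suc n) l u x)) \<in> V" for n
      by (intro S_V test_function_bump) simp
  qed
  \<comment> \<open>Intersecting with a fixed box keeps all measures finite: the indicator of the
    box dominates every limit, and complements are taken by subtraction inside the box.\<close>
  have Borel_V: "L2_of (indicator (A \<inter> box l u)) \<in> V" if A: "A \<in> sets borel" for A and l u :: 'a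
  proof -
    have "Int_stable (range (\<lambda>(a, b). box a b :: 'a set))"
      by (auto simp: Int_stable_def box_Int_box)
    moreover have "(range (\<lambda>(a, b). box a b :: 'a set)) \<subseteq> Pow UNIV"
      by auto
    moreover have "A \<in> sigma_sets UNIV (range (\<lambda>(a, b). box a b))"
      using A unfolding borel_eq_box by simp
    ultimately show ?thesis
    proof (induction rule: sigma_sets_induct_disjoint)
      case (basic A)
      then show ?case
        by (auto simp: box_Int_box box_V)
    next
      case empty
      then show ?case
        using S_V[OF test_function_zero] by (simp add: indicator_def)
    next
      case (compl A)
      then have [measurable]: "A \<in> sets borel"
        by (simp add: borel_eq_box)
      have "(indicator ((UNIV - A) \<inter> box l u) :: 'a \<Rightarrow> complex)
          = (\<lambda>x. indicator (UNIV \<inter> box l u) x - indicator (A \<inter> box l u) x)"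
        by (auto simp: fun_eq_iff split: split_indicator)
      then have "L2_of (indicator ((UNIV - A) \<inter> box l u))
          = L2_of (indicator (UNIV \<inter> box l u)) - L2_of (indicator (A \<inter> box l u))"
        using diff_L2_of[OF box_si[of UNIV l u] box_si[OF \<open>A \<in> sets borel\<close>, of l u]] by simp
      with V_diff[OF box_V compl.IH] show ?case by simp
    next
      case (union F)
      then have F[measurable]: "F i \<in> sets borel" for i
        by (simp add: borel_eq_box subset_eq)
      have disj: "disjoint_family_on (\<lambda>i. F i \<inter> box l u) {..<n}" for n :: nat
        using union(1) by (auto simp: disjoint_family_on_def)
      have ind: "(\<Sum>i<n. indicator (F i \<inter> box l u) x :: complex) = indicator (\<Union>i<n. F i \<inter> box l u) x" for n x
        by (rule indicator_UN_disjoint[OF _ disj[of n], symmetric]) simp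
      show ?case
      proof (rule V_lim)
        show "(\<lambda>n. L2_of (\<lambda>x. \<Sum>i<n. indicator (F i \<inter> box l u) x)) \<longlonglongrightarrow> L2_of (indicator (\<Union> (range F) \<inter> box l u))"
        proof (rule L2_dominated_convergence(2)[OF _ _ box_int])
          show "AE x in lborel. cmod (\<Sum>i<n. indicator (F i \<inter> box l u) x) \<le> indicator (box l u) x" for n
            unfolding ind by (auto split: split_indicator)
          have "(\<lambda>n. indicator (\<Union>i<n. F i \<inter> box l u) x :: complex) \<longlonglongrightarrow> indicator (\<Union>i. F i \<inter> box l u) x" for x
            by (rule LIMSEQ_indicator_UN)
          then show "AE x in lborel. (\<lambda>n. \<Sum>i<n. indicator (F i \<inter> box l u) x :: complex)
              \<longlonglongrightarrow> indicator (\<Union> (range F) \<inter> box l u) x"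
            unfolding ind by simp
        qed simp_all
        have "(\<Sum>i<n. L2_of (indicator (F i \<inter> box l u))) \<in> V" for n :: nat
          by (intro V_sum union.IH)
        moreover have "(\<Sum>i<n. L2_of (indicator (F i \<inter> box l u)))
            = L2_of (\<lambda>x. \<Sum>i<n. indicator (F i \<inter> box l u) x)" for n :: nat
          using sum_L2_of[of "{..<n}" "\<lambda>i. indicator (F i \<inter> box l u)"] box_si[OF F] by blast
        ultimately show "L2_of (\<lambda>x. \<Sum>i<n. indicator (F i \<inter> box l u) x) \<in> V" for n :: nat
          by metis
      qed
    qed
  qed
  have local_V: "L2_of f \<in> V" if f: "square_integrable f" and B: "\<And>x. x \<notin> box l u \<Longrightarrow> f x = 0"
    for f and l u :: 'a
  proof -
    have fm: "f \<in> borel_measurable lborel"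
      using f by (simp add: square_integrable_def)
    \<comment> \<open>The approximants are chosen near 0, which gives |F i| \<le> 2 |f|. This bound
      is both the majorant for the limit and the reason why each \<open>F i\<close> vanishes outside
      the box, so that it is a finite combination of the indicators handled by
      \<open>Borel_V\<close>.\<close>
    obtain F where F: "\<And>i. simple_function lborel (F i)" "\<And>x. (\<lambda>i. F i x) \<longlonglongrightarrow> f x"
      "\<And>i x. cmod (F i x) \<le> 2 * cmod (f x)"
      using borel_measurable_implies_sequence_metric[OF fm, of 0] by auto
    show ?thesis
    proof (rule V_lim)
      show "(\<lambda>i. L2_of (F i)) \<longlonglongrightarrow> L2_of f"
      proof (rule L2_dominated_convergence(2))
        show "integrable lborel (\<lambda>x. (2 * cmod (f x))\<^sup>2)"
          using f by (simp add: square_integrable_def power_mult_distrib)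
        show "F i \<in> borel_measurable borel" for i
          using borel_measurable_simple_function[OF F(1)] by simp
      qed (use F fm in auto)
      show "L2_of (F i) \<in> V" for i
      proof -
        have fin: "finite (range (F i))"
          using F(1)[of i] by (simp add: simple_function_def)
        have meas: "F i -` {y} \<in> sets borel" for y
        proof (cases "y \<in> range (F i)")
          case False
          then have "F i -` {y} = {}" by auto
          then show ?thesis by simp
        qed (use F(1)[of i] in \<open>auto simp: simple_function_def\<close>)
        have "F i x = (\<Sum>y\<in>range (F i). y * indicator (F i -` {y} \<inter> box l u) x)" for x
        proof (cases "x \<in> box l u")
          case True
          have "(\<Sum>y\<in>range (F i). y * indicator (F i -` {y} \<inter> box l u) x)
              = (\<Sum>y\<in>range (F i). if y = F i x then F i x else 0)"
            by (rule sum.cong) (use True in \<open>auto split: split_indicator\<close>)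
          also have "\<dots> = F i x"
            using fin by simp
          finally show ?thesis by simp
        next
          case False
          with F(3)[of i x] B show ?thesis by simp
        qed
        then have eq: "F i = (\<lambda>x. \<Sum>y\<in>range (F i). y * indicator (F i -` {y} \<inter> box l u) x)"
          by blast
        have "(\<Sum>y\<in>range (F i). scaleC_L2 y (L2_of (indicator (F i -` {y} \<inter> box l u))))
            = (\<Sum>y\<in>range (F i). L2_of (\<lambda>x. y * indicator (F i -` {y} \<inter> box l u) x))"
          by (intro sum.cong refl scaleC_L2_of box_si meas)
        also have "\<dots> = L2_of (\<lambda>x. \<Sum>y\<in>range (F i). y * indicator (F i -` {y} \<inter> box l u) x)"
          using sum_L2_of[of "range (F i)" "\<lambda>y x. y * indicator (F i -` {y} \<inter> box l u) x"]
            square_integrable_mult_left[OF box_si[OF meas]] by blast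
        also have "\<dots> = L2_of (F i)"
          by (rule arg_cong[where f = L2_of, OF eq[symmetric]])
        finally have "(\<Sum>y\<in>range (F i). scaleC_L2 y (L2_of (indicator (F i -` {y} \<inter> box l u)))) = L2_of (F i)" .
        moreover have "(\<Sum>y\<in>range (F i). scaleC_L2 y (L2_of (indicator (F i -` {y} \<inter> box l u)))) \<in> V"
          by (rule V_sum) (rule V_scale[OF Borel_V[OF meas]])
        ultimately show ?thesis
          by (simp only:)
      qed
    qed
  qed
  have "x \<in> V" for x
  proof -
    obtain f where f: "square_integrable f" "x = L2_of f"
      by (rule L2_cases)
    \<comment> \<open>Cutting off with boxes that exhaust the space reduces the general case to
      functions vanishing outside a box; |f| itself is the majorant.\<close>
    define B where "B n = box (- real n *\<^sub>R One) (real n *\<^sub>R One :: 'a)" for n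
    have [measurable]: "f \<in> borel_measurable borel" "B n \<in> sets borel" for n
      using f by (auto simp: square_integrable_def B_def)
    define s where "s n x = indicator (B n) x * f x" for n x
    have [measurable]: "s n \<in> borel_measurable borel" for n
      unfolding s_def by measurable
    have si: "square_integrable (s n)" for n
      by (rule square_integrable_bound[where w = "\<lambda>x. cmod (f x)"])
        (use f in \<open>auto simp: s_def square_integrable_def split: split_indicator\<close>)
    show ?thesis
    proof (rule V_lim)
      show "(\<lambda>n. L2_of (s n)) \<longlonglongrightarrow> x"
        unfolding f(2)
      proof (rule L2_dominated_convergence(2)[where w = "\<lambda>x. cmod (f x)"])
        have "(\<lambda>n. indicator (B n) x :: complex) \<longlonglongrightarrow> indicator (\<Union>n. B n) x" for x
          by (rule LIMSEQ_indicator_incseq) (auto simp: B_def incseq_def box_def)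
        then have "(\<lambda>n. indicator (B n) x :: complex) \<longlonglongrightarrow> 1" for x
          by (simp add: B_def UN_box_eq_UNIV)
        then have "(\<lambda>n. s n x) \<longlonglongrightarrow> 1 * f x" for x
          unfolding s_def by (intro tendsto_intros)
        then show "AE x in lborel. (\<lambda>n. s n x) \<longlonglongrightarrow> f x" by simp
      qed (use f in \<open>auto simp: s_def square_integrable_def split: split_indicator\<close>)
      show "L2_of (s n) \<in> V" for n
        by (rule local_V[OF si, of "- real n *\<^sub>R One" "real n *\<^sub>R One"]) (simp add: s_def B_def)
    qed
  qed
  then have "V = UNIV"
    by blast
  then show ?thesis
    by (simp only: V_def S_def)
qed

subsection \<open>Plancherel's theorem\<close>

lemma borel_measurable_cis [measurable (raw)]:
  "f \<in> borel_measurable M \<Longrightarrow> (\<lambda>x. cis (f x)) \<in> borel_measurable M"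
  by (rule measurable_compose[of f M borel]) (auto intro!: borel_measurable_continuous_onI continuous_intros)

lemma borel_measurable_cnj [measurable (raw)]:
  "f \<in> borel_measurable M \<Longrightarrow> (\<lambda>x. cnj (f x)) \<in> borel_measurable M"
  by (rule measurable_compose[of f M borel]) (auto intro!: borel_measurable_continuous_onI continuous_intros)

lemma integrable_pairI:
  fixes f :: "'a::euclidean_space \<Rightarrow> 'b::euclidean_space \<Rightarrow> 'c::{banach, second_countable_topology}"
  assumes [measurable]: "case_prod f \<in> borel_measurable (lborel \<Otimes>\<^sub>M lborel)"
    and "(\<integral>\<^sup>+x. \<integral>\<^sup>+y. ennreal (norm (f x y)) \<partial>lborel \<partial>lborel) < \<infinity>"
  shows "integrable (lborel \<Otimes>\<^sub>M lborel) (case_prod f)"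
proof (rule integrableI_bounded)
  have "(\<integral>\<^sup>+p. ennreal (norm (case_prod f p)) \<partial>(lborel \<Otimes>\<^sub>M lborel))
      = (\<integral>\<^sup>+x. \<integral>\<^sup>+y. ennreal (norm (f x y)) \<partial>lborel \<partial>lborel)"
    by (subst lborel.nn_integral_fst[symmetric]) simp_all
  with assms(2) show "(\<integral>\<^sup>+p. ennreal (norm (case_prod f p)) \<partial>(lborel \<Otimes>\<^sub>M lborel)) < \<infinity>"
    by simp
qed simp

lemma integrable_pair_mult:
  fixes f :: "'a::euclidean_space \<Rightarrow> 'c::{banach, second_countable_topology, real_normed_algebra}"
    and g :: "'b::euclidean_space \<Rightarrow> 'c"
  assumes f: "integrable lborel f" and g: "integrable lborel g"
  shows "integrable (lborel \<Otimes>\<^sub>M lborel) (\<lambda>(x, y). f x * g y)"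
proof (rule integrable_pairI)
  have [measurable]: "f \<in> borel_measurable borel" "g \<in> borel_measurable borel"
    using f g by auto
  show "(\<lambda>(x, y). f x * g y) \<in> borel_measurable (lborel \<Otimes>\<^sub>M lborel)"
    by measurable
  have "(\<integral>\<^sup>+x. \<integral>\<^sup>+y. ennreal (norm (f x * g y)) \<partial>lborel \<partial>lborel)
      \<le> (\<integral>\<^sup>+x. \<integral>\<^sup>+y. ennreal (norm (f x)) * ennreal (norm (g y)) \<partial>lborel \<partial>lborel)"
    by (intro nn_integral_mono) (simp add: norm_mult_ineq flip: ennreal_mult)
  also have "\<dots> = (\<integral>\<^sup>+x. ennreal (norm (f x)) \<partial>lborel) * (\<integral>\<^sup>+y. ennreal (norm (g y)) \<partial>lborel)"
    by (simp add: nn_integral_cmult nn_integral_multc)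
  also have "\<dots> < \<infinity>"
    using f g by (auto simp: integrable_iff_bounded ennreal_mult_less_top)
  finally show "(\<integral>\<^sup>+x. \<integral>\<^sup>+y. ennreal (norm (f x * g y)) \<partial>lborel \<partial>lborel) < \<infinity>" .
qed

section \<open>Gaussian integrals and the Fourier transform on the line\<close>

lemma integral_exp_square:
  fixes \<alpha> :: real
  assumes "\<alpha> > 0"
  shows "integrable lborel (\<lambda>x. exp (- \<alpha> * x\<^sup>2))" "(LINT x|lborel. exp (- \<alpha> * x\<^sup>2)) = sqrt (pi / \<alpha>)"
proof -
  define \<sigma> where "\<sigma> = 1 / sqrt (2 * \<alpha>)"
  have \<sigma>: "\<sigma> > 0" "\<sigma>\<^sup>2 = 1 / (2 * \<alpha>)"
    using assms by (auto simp: \<sigma>_def power_divide)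
  have *: "exp (- \<alpha> * x\<^sup>2) = sqrt (pi / \<alpha>) * normal_density 0 \<sigma> x" for x
    using assms by (simp add: normal_density_def \<sigma>)
  show "integrable lborel (\<lambda>x. exp (- \<alpha> * x\<^sup>2))"
    unfolding * using \<sigma> by (intro integrable_mult_right integrable_normal_density)
  show "(LINT x|lborel. exp (- \<alpha> * x\<^sup>2)) = sqrt (pi / \<alpha>)"
    unfolding * using \<sigma> by simp
qed

text \<open>This is the characteristic function of the standard normal law, evaluated at
  \<open>t\<close> and transported by the substitution x \<mapsto> c x. The choice of
  \<open>c\<close> turns the density exponent into - \<alpha> x^2, and \<open>t\<close> is \<kappa>
  / c so that the phase becomes \<kappa> x.\<close>

lemma integral_exp_square_cis:
  fixes \<alpha> \<kappa> :: real
  assumes "\<alpha> > 0"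
  shows "(LINT x|lborel. complex_of_real (exp (- \<alpha> * x\<^sup>2)) * cis (\<kappa> * x))
      = complex_of_real (sqrt (pi / \<alpha>) * exp (- \<kappa>\<^sup>2 / (4 * \<alpha>)))"
proof -
  define t where "t = \<kappa> / sqrt (2 * \<alpha>)"
  define c where "c = sqrt (2 * \<alpha>)"
  have c: "c > 0" "c\<^sup>2 = 2 * \<alpha>"
    using assms by (auto simp: c_def)
  have "complex_of_real (exp (- t\<^sup>2 / 2)) = char std_normal_distribution t"
    by (simp add: char_std_normal_distribution)
  also have "\<dots> = (LINT x|lborel. std_normal_density x *\<^sub>R cis (t * x))"
    unfolding char_def by (subst integral_density) (auto simp: cis_conv_exp)
  also have "\<dots> = \<bar>c\<bar> *\<^sub>R (LINT x|lborel. std_normal_density (0 + c * x) *\<^sub>R cis (t * (0 + c * x)))"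
    using c by (intro lborel_integral_real_affine) simp
  also have "(\<lambda>x. std_normal_density (0 + c * x) *\<^sub>R cis (t * (0 + c * x)))
      = (\<lambda>x. (1 / sqrt (2 * pi)) *\<^sub>R (complex_of_real (exp (- \<alpha> * x\<^sup>2)) * cis (\<kappa> * x)))"
  proof
    fix x
    have "t * (0 + c * x) = \<kappa> * x"
      using assms by (simp add: t_def c_def)
    moreover have "std_normal_density (0 + c * x) = (1 / sqrt (2 * pi)) * exp (- \<alpha> * x\<^sup>2)"
      using c by (simp add: std_normal_density_def power_mult_distrib)
    ultimately show "std_normal_density (0 + c * x) *\<^sub>R cis (t * (0 + c * x))
        = (1 / sqrt (2 * pi)) *\<^sub>R (complex_of_real (exp (- \<alpha> * x\<^sup>2)) * cis (\<kappa> * x))"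
      by (simp only: scaleR_conv_of_real of_real_mult mult.assoc)
  qed
  finally have eq: "complex_of_real (exp (- t\<^sup>2 / 2)) = complex_of_real (c / sqrt (2 * pi))
      * (LINT x|lborel. complex_of_real (exp (- \<alpha> * x\<^sup>2)) * cis (\<kappa> * x))"
    using c by (simp add: scaleR_conv_of_real)
  have t: "t\<^sup>2 / 2 = \<kappa>\<^sup>2 / (4 * \<alpha>)"
    using assms by (simp add: t_def power_divide)
  have c2: "sqrt (2 * pi) / c = sqrt (pi / \<alpha>)"
    unfolding c_def real_sqrt_divide[symmetric] by simp
  have "(LINT x|lborel. complex_of_real (exp (- \<alpha> * x\<^sup>2)) * cis (\<kappa> * x))
      = complex_of_real (sqrt (2 * pi) / c) * complex_of_real (exp (- t\<^sup>2 / 2))"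
    unfolding eq using c by (simp add: field_simps)
  then show ?thesis
    unfolding c2 using t by simp
qed

text \<open>The transform is not normalised, hence the factor 2 pi in Plancherel's theorem. As a
  Lebesgue integral it carries its meaning only on integrable functions.\<close>

definition fourier :: "(real \<Rightarrow> complex) \<Rightarrow> real \<Rightarrow> complex" where
  "fourier f \<xi> = (LINT x|lborel. cis (- \<xi> * x) * f x)"

lemma integrable_cis_mult:
  fixes h :: "'a::euclidean_space \<Rightarrow> real"
  assumes "integrable lborel f" "h \<in> borel_measurable borel"
  shows "integrable lborel (\<lambda>x. cis (h x) * f x)"
  using assms by (intro Bochner_Integration.integrable_bound[OF assms(1)]) (auto simp: norm_mult)

lemma borel_measurable_fourier [measurable]:
  assumes [measurable]: "f \<in> borel_measurable borel"
  shows "fourier f \<in> borel_measurable borel"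
  unfolding fourier_def by measurable

lemma fourier_diff:
  assumes "integrable lborel f" "integrable lborel g"
  shows "fourier (\<lambda>x. f x - g x) = (\<lambda>\<xi>. fourier f \<xi> - fourier g \<xi>)"
proof
  fix \<xi>
  have "integrable lborel (\<lambda>x. cis (- \<xi> * x) * f x)" "integrable lborel (\<lambda>x. cis (- \<xi> * x) * g x)"
    using assms by (auto intro!: integrable_cis_mult)
  then show "fourier (\<lambda>x. f x - g x) \<xi> = fourier f \<xi> - fourier g \<xi>"
    unfolding fourier_def by (simp add: right_diff_distrib)
qed

lemma fourier_add:
  assumes "integrable lborel f" "integrable lborel g"
  shows "fourier (\<lambda>x. f x + g x) = (\<lambda>\<xi>. fourier f \<xi> + fourier g \<xi>)"
proof
  fix \<xi>
  have "integrable lborel (\<lambda>x. cis (- \<xi> * x) * f x)" "integrable lborel (\<lambda>x. cis (- \<xi> * x) * g x)"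
    using assms by (auto intro!: integrable_cis_mult)
  then show "fourier (\<lambda>x. f x + g x) \<xi> = fourier f \<xi> + fourier g \<xi>"
    unfolding fourier_def by (simp add: distrib_left)
qed

lemma norm_fourier_le:
  assumes "integrable lborel f"
  shows "cmod (fourier f \<xi>) \<le> (LINT x|lborel. cmod (f x))"
proof -
  have "cmod (fourier f \<xi>) \<le> (LINT x|lborel. cmod (cis (- \<xi> * x) * f x))"
    unfolding fourier_def by (rule integral_norm_bound)
  then show ?thesis by (simp add: norm_mult)
qed

text \<open>The Gaussian factor makes the triple integral in x, y and \<xi> absolutely convergent.
  Integrating in \<xi> first produces a heat kernel in x - y.\<close>

lemma integral_fourier_square_gauss:
  assumes f: "integrable lborel f" and \<epsilon>: "\<epsilon> > 0"
  shows "integrable lborel (\<lambda>\<xi>. (cmod (fourier f \<xi>))\<^sup>2 * exp (- \<epsilon> * \<xi>\<^sup>2))"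
    and "complex_of_real (LINT \<xi>|lborel. (cmod (fourier f \<xi>))\<^sup>2 * exp (- \<epsilon> * \<xi>\<^sup>2))
      = (LINT y|lborel. LINT x|lborel. f x * cnj (f y) * of_real (sqrt (pi / \<epsilon>) * exp (- (x - y)\<^sup>2 / (4 * \<epsilon>))))"
proof -
  have [measurable]: "f \<in> borel_measurable borel"
    using f by auto
  define B where "B = (LINT x|lborel. cmod (f x))"
  have bound: "(cmod (fourier f \<xi>))\<^sup>2 \<le> B\<^sup>2" for \<xi>
    unfolding B_def by (intro power_mono norm_fourier_le f) simp
  show "integrable lborel (\<lambda>\<xi>. (cmod (fourier f \<xi>))\<^sup>2 * exp (- \<epsilon> * \<xi>\<^sup>2))"
  proof (rule Bochner_Integration.integrable_bound)
    show "integrable lborel (\<lambda>\<xi>. B\<^sup>2 * exp (- \<epsilon> * \<xi>\<^sup>2))"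
      using integral_exp_square(1)[OF \<epsilon>] by (rule integrable_mult_right)
    show "AE \<xi> in lborel. norm ((cmod (fourier f \<xi>))\<^sup>2 * exp (- \<epsilon> * \<xi>\<^sup>2)) \<le> norm (B\<^sup>2 * exp (- \<epsilon> * \<xi>\<^sup>2))"
      using bound by (intro AE_I2) (simp add: abs_mult mult_right_mono)
  qed measurable
  have ff: "integrable (lborel \<Otimes>\<^sub>M lborel) (\<lambda>(y, x). cnj (f y) * f x)"
    using f by (intro integrable_pair_mult) auto
  have ff': "integrable (lborel :: (real \<times> real) measure) (\<lambda>(y, x). cnj (f y) * f x)"
    using ff by (simp add: lborel_prod)
  have E: "integrable lborel (\<lambda>\<xi>. complex_of_real (exp (- \<epsilon> * \<xi>\<^sup>2)))"
    using integral_exp_square(1)[OF \<epsilon>] by (rule integrable_of_real)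
  define F where "F = (\<lambda>p \<xi>. cnj (f (fst p)) * f (snd p) * cis (- \<xi> * (snd p - fst p)) * complex_of_real (exp (- \<epsilon> * \<xi>\<^sup>2)))"
  have F_meas: "case_prod F \<in> borel_measurable ((lborel \<Otimes>\<^sub>M lborel) \<Otimes>\<^sub>M lborel)"
    unfolding F_def by measurable
  have F: "integrable ((lborel :: (real \<times> real) measure) \<Otimes>\<^sub>M lborel) (case_prod F)"
  proof (rule Bochner_Integration.integrable_bound[OF integrable_pair_mult[OF ff' E]])
    show "case_prod F \<in> borel_measurable ((lborel :: (real \<times> real) measure) \<Otimes>\<^sub>M lborel)"
      using F_meas by (simp add: lborel_prod)
  qed (auto simp: F_def norm_mult)
  have inner1: "(LINT p|lborel. F p \<xi>) = complex_of_real ((cmod (fourier f \<xi>))\<^sup>2 * exp (- \<epsilon> * \<xi>\<^sup>2))" for \<xi>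
  proof -
    have "(LINT p|lborel. F p \<xi>)
        = (LINT p|(lborel \<Otimes>\<^sub>M lborel). (case p of (y, x) \<Rightarrow> cnj (cis (- \<xi> * y) * f y) * (cis (- \<xi> * x) * f x)))
          * complex_of_real (exp (- \<epsilon> * \<xi>\<^sup>2))"
    proof -
      have "cnj (f y) * f x * cis (- \<xi> * (x - y)) = cnj (cis (- \<xi> * y) * f y) * (cis (- \<xi> * x) * f x)" for x y
        by (simp add: cis_cnj cis_mult algebra_simps)
      then have "F p \<xi> = (case p of (y, x) \<Rightarrow> cnj (cis (- \<xi> * y) * f y) * (cis (- \<xi> * x) * f x))
          * complex_of_real (exp (- \<epsilon> * \<xi>\<^sup>2))" for p
        by (simp add: F_def split: prod.split)
      then show ?thesis
        by (simp add: lborel_prod)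
    qed
    also have "(LINT p|(lborel \<Otimes>\<^sub>M lborel). (case p of (y, x) \<Rightarrow> cnj (cis (- \<xi> * y) * f y) * (cis (- \<xi> * x) * f x)))
        = (LINT y|lborel. LINT x|lborel. cnj (cis (- \<xi> * y) * f y) * (cis (- \<xi> * x) * f x))"
      by (rule lborel_pair.integral_fst[symmetric]) (intro integrable_pair_mult integrable_cnj integrable_cis_mult f; measurable)
    also have "\<dots> = cnj (fourier f \<xi>) * fourier f \<xi>"
      by (simp add: fourier_def del: complex_cnj_mult)
    also have "\<dots> = complex_of_real ((cmod (fourier f \<xi>))\<^sup>2)"
      by (simp only: complex_norm_square mult.commute)
    finally show ?thesis by simp
  qed
  have inner2: "(LINT \<xi>|lborel. F (y, x) \<xi>) = f x * cnj (f y) * of_real (sqrt (pi / \<epsilon>) * exp (- (x - y)\<^sup>2 / (4 * \<epsilon>)))" for x y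
  proof -
    have "(LINT \<xi>|lborel. F (y, x) \<xi>)
        = f x * cnj (f y) * (LINT \<xi>|lborel. complex_of_real (exp (- \<epsilon> * \<xi>\<^sup>2)) * cis (- (x - y) * \<xi>))"
    proof -
      have "F (y, x) \<xi> = f x * cnj (f y) * (complex_of_real (exp (- \<epsilon> * \<xi>\<^sup>2)) * cis (- (x - y) * \<xi>))" for \<xi>
      proof -
        have "- \<xi> * (x - y) = - (x - y) * \<xi>" by (simp add: algebra_simps)
        then show ?thesis by (simp only: F_def fst_conv snd_conv mult_ac)
      qed
      then show ?thesis
        by (simp only: integral_mult_right_zero)
    qed
    also have "(LINT \<xi>|lborel. complex_of_real (exp (- \<epsilon> * \<xi>\<^sup>2)) * cis (- (x - y) * \<xi>))
        = complex_of_real (sqrt (pi / \<epsilon>) * exp (- (- (x - y))\<^sup>2 / (4 * \<epsilon>)))"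
      by (rule integral_exp_square_cis[OF \<epsilon>])
    finally show ?thesis by (simp add: power2_commute)
  qed
  have "complex_of_real (LINT \<xi>|lborel. (cmod (fourier f \<xi>))\<^sup>2 * exp (- \<epsilon> * \<xi>\<^sup>2))
      = (LINT \<xi>|lborel. LINT p|lborel. F p \<xi>)"
    unfolding inner1 by (rule integral_complex_of_real[symmetric])
  also have "\<dots> = (LINT p|lborel. LINT \<xi>|lborel. F p \<xi>)"
    by (rule lborel_pair.Fubini_integral[OF F])
  also have "\<dots> = (LINT p|(lborel \<Otimes>\<^sub>M lborel). LINT \<xi>|lborel. F p \<xi>)"
    by (simp add: lborel_prod)
  also have "\<dots> = (LINT p|(lborel \<Otimes>\<^sub>M lborel). (case p of (y, x) \<Rightarrow> LINT \<xi>|lborel. F (y, x) \<xi>))"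
    by (simp add: split_beta)
  also have "\<dots> = (LINT y|lborel. LINT x|lborel. LINT \<xi>|lborel. F (y, x) \<xi>)"
  proof (rule lborel_pair.integral_fst[symmetric])
    show "integrable (lborel \<Otimes>\<^sub>M lborel) (\<lambda>(y, x). LINT \<xi>|lborel. F (y, x) \<xi>)"
    proof -
      have "(\<lambda>(y, x). LINT \<xi>|lborel. F (y, x) \<xi>) = (\<lambda>p. LINT \<xi>|lborel. F p \<xi>)"
        by auto
      then show ?thesis
        using lborel_pair.integrable_fst'[OF F] by (simp add: lborel_prod)
    qed
  qed
  finally show "complex_of_real (LINT \<xi>|lborel. (cmod (fourier f \<xi>))\<^sup>2 * exp (- \<epsilon> * \<xi>\<^sup>2))
      = (LINT y|lborel. LINT x|lborel. f x * cnj (f y) * of_real (sqrt (pi / \<epsilon>) * exp (- (x - y)\<^sup>2 / (4 * \<epsilon>))))"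
    unfolding inner2 .
qed

text \<open>Schur's test: the heat kernel has mass 2 pi in each variable for every \<epsilon>, and
  |f x| |f y| is at most the mean of the two squares. The bound is therefore uniform in
  \<epsilon>.\<close>

lemma fourier_square_gauss_le:
  assumes f: "integrable lborel f" "square_integrable f" and \<epsilon>: "\<epsilon> > 0"
  shows "(LINT \<xi>|lborel. (cmod (fourier f \<xi>))\<^sup>2 * exp (- \<epsilon> * \<xi>\<^sup>2)) \<le> 2 * pi * (LINT x|lborel. (cmod (f x))\<^sup>2)"
proof -
  have [measurable]: "f \<in> borel_measurable borel"
    using f by auto
  define k where "k t = sqrt (pi / \<epsilon>) * exp (- t\<^sup>2 / (4 * \<epsilon>))" for t :: real
  have [measurable]: "k \<in> borel_measurable borel"
    unfolding k_def by measurable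
  have k0: "k t \<ge> 0" for t
    using \<epsilon> by (simp add: k_def)
  have k: "integrable lborel k" "(LINT t|lborel. k t) = 2 * pi"
  proof -
    have eq: "k = (\<lambda>t. sqrt (pi / \<epsilon>) * exp (- (1 / (4 * \<epsilon>)) * t\<^sup>2))"
      by (simp add: k_def fun_eq_iff)
    show "integrable lborel k"
      unfolding eq using \<epsilon> by (intro integrable_mult_right integral_exp_square) simp
    have "sqrt (pi / \<epsilon>) * sqrt (pi / (1 / (4 * \<epsilon>))) = 2 * pi"
      using \<epsilon> by (simp add: real_sqrt_mult real_sqrt_divide)
    then show "(LINT t|lborel. k t) = 2 * pi"
      unfolding eq using \<epsilon> integral_exp_square(2)[of "1 / (4 * \<epsilon>)"] by simp
  qed
  define S where "S = (LINT x|lborel. (cmod (f x))\<^sup>2)"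
  have sq: "integrable lborel (\<lambda>x. (cmod (f x))\<^sup>2)"
    using f by (simp add: square_integrable_def)
  have kmn: "(\<integral>\<^sup>+x. ennreal (k (x - y)) \<partial>lborel) = ennreal (2 * pi)" for y
  proof -
    have "(\<integral>\<^sup>+x. ennreal (k x) \<partial>lborel) = (\<integral>\<^sup>+x. ennreal (k (- y + 1 * x)) \<partial>lborel)"
      by (subst nn_integral_real_affine[where c = 1 and t = "- y"]) simp_all
    then show ?thesis
      using nn_integral_eq_integral[OF k(1)] k0 k(2) by simp
  qed
  have kmn': "(\<integral>\<^sup>+y. ennreal (k (x - y)) \<partial>lborel) = ennreal (2 * pi)" for x
    using kmn[of x] by (simp add: k_def power2_commute)
  have bound: "ennreal (cmod (f x * cnj (f y) * of_real (k (x - y))))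
      \<le> ennreal ((cmod (f x))\<^sup>2 / 2) * ennreal (k (x - y)) + ennreal ((cmod (f y))\<^sup>2 / 2) * ennreal (k (x - y))" for x y
  proof -
    have "cmod (f x) * cmod (f y) \<le> (cmod (f x))\<^sup>2 / 2 + (cmod (f y))\<^sup>2 / 2"
      using sum_squares_bound[of "cmod (f x)" "cmod (f y)"] by simp
    then have "cmod (f x) * cmod (f y) * k (x - y) \<le> ((cmod (f x))\<^sup>2 / 2 + (cmod (f y))\<^sup>2 / 2) * k (x - y)"
      using k0 by (rule mult_right_mono)
    then show ?thesis
      using k0[of "x - y"]
      by (simp add: norm_mult distrib_right flip: ennreal_mult ennreal_plus)
  qed
  have half: "(\<integral>\<^sup>+x. ennreal ((cmod (f x))\<^sup>2 / 2) \<partial>lborel) = ennreal (S / 2)"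
    using nn_integral_eq_integral[of lborel "\<lambda>x. (cmod (f x))\<^sup>2 / 2"] sq by (simp add: S_def)
  have "(\<integral>\<^sup>+y. \<integral>\<^sup>+x. ennreal (cmod (f x * cnj (f y) * of_real (k (x - y)))) \<partial>lborel \<partial>lborel)
      \<le> (\<integral>\<^sup>+y. \<integral>\<^sup>+x. ennreal ((cmod (f x))\<^sup>2 / 2) * ennreal (k (x - y)) + ennreal ((cmod (f y))\<^sup>2 / 2) * ennreal (k (x - y)) \<partial>lborel \<partial>lborel)"
    by (intro nn_integral_mono bound)
  also have "\<dots> = (\<integral>\<^sup>+y. \<integral>\<^sup>+x. ennreal ((cmod (f x))\<^sup>2 / 2) * ennreal (k (x - y)) \<partial>lborel \<partial>lborel)
      + (\<integral>\<^sup>+y. \<integral>\<^sup>+x. ennreal ((cmod (f y))\<^sup>2 / 2) * ennreal (k (x - y)) \<partial>lborel \<partial>lborel)"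
    by (subst nn_integral_add[symmetric]) (auto intro!: nn_integral_cong nn_integral_add)
  also have "(\<integral>\<^sup>+y. \<integral>\<^sup>+x. ennreal ((cmod (f x))\<^sup>2 / 2) * ennreal (k (x - y)) \<partial>lborel \<partial>lborel)
      = (\<integral>\<^sup>+x. \<integral>\<^sup>+y. ennreal ((cmod (f x))\<^sup>2 / 2) * ennreal (k (x - y)) \<partial>lborel \<partial>lborel)"
    by (rule lborel_pair.Fubini') measurable
  also have "\<dots> = ennreal (S / 2) * ennreal (2 * pi)"
    by (simp add: nn_integral_cmult nn_integral_multc kmn' half)
  also have "(\<integral>\<^sup>+y. \<integral>\<^sup>+x. ennreal ((cmod (f y))\<^sup>2 / 2) * ennreal (k (x - y)) \<partial>lborel \<partial>lborel)
      = ennreal (S / 2) * ennreal (2 * pi)"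
    by (simp add: nn_integral_cmult nn_integral_multc kmn half)
  also have "ennreal (S / 2) * ennreal (2 * pi) + ennreal (S / 2) * ennreal (2 * pi) = ennreal (2 * pi * S)"
    by (simp add: S_def flip: ennreal_mult ennreal_plus)
  finally have main: "(\<integral>\<^sup>+y. \<integral>\<^sup>+x. ennreal (cmod (f x * cnj (f y) * of_real (k (x - y)))) \<partial>lborel \<partial>lborel)
      \<le> ennreal (2 * pi * S)" .
  have J0: "(LINT \<xi>|lborel. (cmod (fourier f \<xi>))\<^sup>2 * exp (- \<epsilon> * \<xi>\<^sup>2)) \<ge> 0"
    by (rule Bochner_Integration.integral_nonneg) simp
  have int: "integrable (lborel \<Otimes>\<^sub>M lborel) (\<lambda>(y, x). f x * cnj (f y) * of_real (k (x - y)))"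
    by (rule integrable_pairI) (auto intro!: le_less_trans[OF main])
  have "complex_of_real (LINT \<xi>|lborel. (cmod (fourier f \<xi>))\<^sup>2 * exp (- \<epsilon> * \<xi>\<^sup>2))
      = (LINT y|lborel. LINT x|lborel. f x * cnj (f y) * of_real (k (x - y)))"
    using integral_fourier_square_gauss(2)[OF f(1) \<epsilon>] unfolding k_def .
  also have "\<dots> = (LINT p|(lborel \<Otimes>\<^sub>M lborel). (case p of (y, x) \<Rightarrow> f x * cnj (f y) * of_real (k (x - y))))"
    by (rule lborel_pair.integral_fst[OF int])
  finally have "cmod (complex_of_real (LINT \<xi>|lborel. (cmod (fourier f \<xi>))\<^sup>2 * exp (- \<epsilon> * \<xi>\<^sup>2)))
      = cmod (LINT p|(lborel \<Otimes>\<^sub>M lborel). (case p of (y, x) \<Rightarrow> f x * cnj (f y) * of_real (k (x - y))))"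
    by (rule arg_cong)
  then have "ennreal (LINT \<xi>|lborel. (cmod (fourier f \<xi>))\<^sup>2 * exp (- \<epsilon> * \<xi>\<^sup>2))
      = ennreal (cmod (LINT p|(lborel \<Otimes>\<^sub>M lborel). (case p of (y, x) \<Rightarrow> f x * cnj (f y) * of_real (k (x - y)))))"
    unfolding norm_of_real abs_of_nonneg[OF J0] by (rule arg_cong)
  also have "\<dots> \<le> (\<integral>\<^sup>+p. ennreal (cmod (case p of (y, x) \<Rightarrow> f x * cnj (f y) * of_real (k (x - y)))) \<partial>(lborel \<Otimes>\<^sub>M lborel))"
    by (rule integral_norm_bound_ennreal[OF int])
  also have "\<dots> = (\<integral>\<^sup>+y. \<integral>\<^sup>+x. ennreal (cmod (f x * cnj (f y) * of_real (k (x - y)))) \<partial>lborel \<partial>lborel)"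
    by (subst lborel.nn_integral_fst[symmetric]) simp_all
  also have "\<dots> \<le> ennreal (2 * pi * S)"
    by (rule main)
  finally show ?thesis
    by (simp add: S_def)
qed

lemma exp_neg_inverse_Suc_tendsto: "(\<lambda>n. exp (- (1 / real (Suc n)) * t)) \<longlonglongrightarrow> 1"
proof -
  have "(\<lambda>n. exp (- (1 / real (Suc n)) * t)) \<longlonglongrightarrow> exp (- 0 * t)"
    by (intro tendsto_intros LIMSEQ_inverse_real_of_nat[unfolded inverse_eq_divide])
  then show ?thesis by simp
qed

text \<open>Fatou's lemma along \<epsilon> = 1 / (n + 1) removes the Gaussian factor from the
  uniform bound. This already gives the inequality for all functions; equality is obtained first for
  continuous functions of compact support.\<close>

lemma bessel:
  assumes f: "integrable lborel f" "square_integrable f"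
  shows "square_integrable (fourier f)"
    and "(LINT \<xi>|lborel. (cmod (fourier f \<xi>))\<^sup>2) \<le> 2 * pi * (LINT x|lborel. (cmod (f x))\<^sup>2)"
proof -
  have [measurable]: "f \<in> borel_measurable borel"
    using f by auto
  define g where "g n \<xi> = (cmod (fourier f \<xi>))\<^sup>2 * exp (- (1 / real (Suc n)) * \<xi>\<^sup>2)" for n \<xi>
  define S where "S = 2 * pi * (LINT x|lborel. (cmod (f x))\<^sup>2)"
  have S0: "S \<ge> 0" by (simp add: S_def)
  have [measurable]: "g n \<in> borel_measurable borel" for n
    unfolding g_def by measurable
  have g: "(\<lambda>n. g n \<xi>) \<longlonglongrightarrow> (cmod (fourier f \<xi>))\<^sup>2 * 1" for \<xi>
    unfolding g_def by (intro tendsto_mult tendsto_const exp_neg_inverse_Suc_tendsto)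
  have "(\<integral>\<^sup>+\<xi>. ennreal ((cmod (fourier f \<xi>))\<^sup>2) \<partial>lborel) = (\<integral>\<^sup>+\<xi>. liminf (\<lambda>n. ennreal (g n \<xi>)) \<partial>lborel)"
  proof (rule nn_integral_cong)
    fix \<xi>
    have "(\<lambda>n. ennreal (g n \<xi>)) \<longlonglongrightarrow> ennreal ((cmod (fourier f \<xi>))\<^sup>2)"
      using g by (intro tendsto_ennrealI) simp
    then show "ennreal ((cmod (fourier f \<xi>))\<^sup>2) = liminf (\<lambda>n. ennreal (g n \<xi>))"
      by (intro lim_imp_Liminf[symmetric]) simp
  qed
  also have "\<dots> \<le> liminf (\<lambda>n. \<integral>\<^sup>+\<xi>. ennreal (g n \<xi>) \<partial>lborel)"
    by (rule nn_integral_liminf) measurable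
  also have "\<dots> \<le> liminf (\<lambda>n::nat. ennreal S)"
  proof (rule Liminf_mono, rule always_eventually, rule allI)
    fix n
    have "(\<integral>\<^sup>+\<xi>. ennreal (g n \<xi>) \<partial>lborel) = ennreal (LINT \<xi>|lborel. g n \<xi>)"
      unfolding g_def
      by (rule nn_integral_eq_integral[OF integral_fourier_square_gauss(1)[OF f(1)]]) simp_all
    also have "\<dots> \<le> ennreal S"
      unfolding g_def S_def by (intro ennreal_leI fourier_square_gauss_le f) simp
    finally show "(\<integral>\<^sup>+\<xi>. ennreal (g n \<xi>) \<partial>lborel) \<le> ennreal S" .
  qed
  also have "\<dots> = ennreal S"
    by (simp add: Liminf_const)
  finally have le: "(\<integral>\<^sup>+\<xi>. ennreal ((cmod (fourier f \<xi>))\<^sup>2) \<partial>lborel) \<le> ennreal S" .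
  then have int: "integrable lborel (\<lambda>\<xi>. (cmod (fourier f \<xi>))\<^sup>2)"
    by (intro integrableI_bounded) (auto intro: le_less_trans)
  then show "square_integrable (fourier f)"
    by (simp add: square_integrable_def)
  have "ennreal (LINT \<xi>|lborel. (cmod (fourier f \<xi>))\<^sup>2) = (\<integral>\<^sup>+\<xi>. ennreal ((cmod (fourier f \<xi>))\<^sup>2) \<partial>lborel)"
    by (rule nn_integral_eq_integral[OF int, symmetric]) simp
  with le have "ennreal (LINT \<xi>|lborel. (cmod (fourier f \<xi>))\<^sup>2) \<le> ennreal S" by simp
  then show "(LINT \<xi>|lborel. (cmod (fourier f \<xi>))\<^sup>2) \<le> 2 * pi * (LINT x|lborel. (cmod (f x))\<^sup>2)"
    unfolding ennreal_le_iff[OF S0] by (simp only: S_def)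
qed

text \<open>Both sides of the regularised identity are passed to the limit by dominated convergence.
  On the frequency side the majorant comes from \<open>bessel\<close>. On the other side a
  substitution moves \<epsilon> from the kernel into the argument of f, where continuity gives the
  limit and boundedness the majorant.\<close>

lemma plancherel_compact_support:
  assumes f: "continuous_on UNIV f" "compact (closure {x. f x \<noteq> 0})"
  shows "(LINT \<xi>|lborel. (cmod (fourier f \<xi>))\<^sup>2) = 2 * pi * (LINT x|lborel. (cmod (f x))\<^sup>2)"
proof -
  have fi: "integrable lborel f"
    by (rule compact_support_integrable[OF f])
  have fsq: "integrable lborel (\<lambda>x. (cmod (f x))\<^sup>2)"
    using f by (intro compact_support_integrable) (auto intro!: continuous_intros)
  have [measurable]: "f \<in> borel_measurable borel"
    using f by (simp add: borel_measurable_continuous_onI)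
  have si: "square_integrable f"
    using fsq by (simp add: square_integrable_def)
  obtain B where B: "B \<ge> 0" "\<And>x. norm (f x) \<le> B * indicator (closure {x. f x \<noteq> 0}) x"
    using compact_support_bounded[OF f] by blast
  have Bf: "cmod (f x) \<le> B" for x
    using B(2)[of x] B(1) by (auto split: split_indicator_asm)
  define J where "J n = (LINT \<xi>|lborel. (cmod (fourier f \<xi>))\<^sup>2 * exp (- (1 / real (Suc n)) * \<xi>\<^sup>2))" for n
  \<comment> \<open>With \<epsilon> = 1 / (n + 1) this is 2 sqrt \<epsilon>, so x = y + c t turns
    the exponent (x - y)^2 / (4 \<epsilon>) into t^2, and the Jacobian cancels \<epsilon> in the
    prefactor.\<close>
  define c where "c n = 2 * sqrt (1 / real (Suc n))" for n
  define G where "G n p = (case p of (y, t) \<Rightarrow>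
    (f (y + c n * t) * cnj (f y)) * complex_of_real (2 * sqrt pi * exp (- 1 * t\<^sup>2)))" for n p
  have [measurable]: "G n \<in> borel_measurable (lborel \<Otimes>\<^sub>M lborel)" for n
    unfolding G_def by measurable
  have JL: "J \<longlonglongrightarrow> (LINT \<xi>|lborel. (cmod (fourier f \<xi>))\<^sup>2)"
    unfolding J_def
  proof (rule integral_dominated_convergence)
    show "integrable lborel (\<lambda>\<xi>. (cmod (fourier f \<xi>))\<^sup>2)"
      using bessel(1)[OF fi si] by (simp add: square_integrable_def)
    show "AE \<xi> in lborel. (\<lambda>n. (cmod (fourier f \<xi>))\<^sup>2 * exp (- (1 / real (Suc n)) * \<xi>\<^sup>2))
        \<longlonglongrightarrow> (cmod (fourier f \<xi>))\<^sup>2"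
    proof (rule AE_I2)
      fix \<xi>
      have "(\<lambda>n. (cmod (fourier f \<xi>))\<^sup>2 * exp (- (1 / real (Suc n)) * \<xi>\<^sup>2))
          \<longlonglongrightarrow> (cmod (fourier f \<xi>))\<^sup>2 * 1"
        by (intro tendsto_mult tendsto_const exp_neg_inverse_Suc_tendsto)
      then show "(\<lambda>n. (cmod (fourier f \<xi>))\<^sup>2 * exp (- (1 / real (Suc n)) * \<xi>\<^sup>2))
          \<longlonglongrightarrow> (cmod (fourier f \<xi>))\<^sup>2" by simp
    qed
    show "AE \<xi> in lborel. norm ((cmod (fourier f \<xi>))\<^sup>2 * exp (- (1 / real (Suc n)) * \<xi>\<^sup>2))
        \<le> (cmod (fourier f \<xi>))\<^sup>2" for n
      by (intro AE_I2) (simp add: abs_mult mult_left_le)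
  qed measurable
  have dom: "integrable (lborel \<Otimes>\<^sub>M lborel) (\<lambda>(y, t). (B * cmod (f y)) * (2 * sqrt pi * exp (- 1 * t\<^sup>2)))"
    using fi by (intro integrable_pair_mult integrable_mult_right integral_exp_square) auto
  have Gle: "cmod (G n p) \<le> (case p of (y, t) \<Rightarrow> (B * cmod (f y)) * (2 * sqrt pi * exp (- 1 * t\<^sup>2)))" for n p
  proof (cases p)
    case (Pair y t)
    have "cmod (f (y + c n * t)) * cmod (f y) * (2 * sqrt pi * exp (- 1 * t\<^sup>2))
        \<le> B * cmod (f y) * (2 * sqrt pi * exp (- 1 * t\<^sup>2))"
      by (intro mult_right_mono Bf) auto
    then show ?thesis
      by (simp add: G_def Pair norm_mult)
  qed
  have Gint: "integrable (lborel \<Otimes>\<^sub>M lborel) (G n)" for n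
    by (rule Bochner_Integration.integrable_bound[OF dom]) (auto intro!: AE_I2 order_trans[OF Gle])
  have JG: "complex_of_real (J n) = (LINT p|(lborel \<Otimes>\<^sub>M lborel). G n p)" for n
  proof -
    define \<epsilon> where "\<epsilon> = 1 / real (Suc n)"
    have \<epsilon>: "\<epsilon> > 0" by (simp add: \<epsilon>_def)
    have cn: "c n = 2 * sqrt \<epsilon>" "c n > 0" by (simp_all add: c_def \<epsilon>_def)
    have inner: "(LINT x|lborel. f x * cnj (f y) * of_real (sqrt (pi / \<epsilon>) * exp (- (x - y)\<^sup>2 / (4 * \<epsilon>))))
        = (LINT t|lborel. G n (y, t))" for y
    proof -
      have "(LINT x|lborel. f x * cnj (f y) * of_real (sqrt (pi / \<epsilon>) * exp (- (x - y)\<^sup>2 / (4 * \<epsilon>))))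
          = \<bar>c n\<bar> *\<^sub>R (LINT t|lborel. f (y + c n * t) * cnj (f y)
              * of_real (sqrt (pi / \<epsilon>) * exp (- (y + c n * t - y)\<^sup>2 / (4 * \<epsilon>))))"
        using cn by (intro lborel_integral_real_affine) simp
      also have "\<dots> = (LINT t|lborel. \<bar>c n\<bar> *\<^sub>R (f (y + c n * t) * cnj (f y)
              * of_real (sqrt (pi / \<epsilon>) * exp (- (y + c n * t - y)\<^sup>2 / (4 * \<epsilon>)))))"
        by simp
      also have "\<dots> = (LINT t|lborel. G n (y, t))"
      proof (rule Bochner_Integration.integral_cong[OF refl])
        fix t
        have "c n * sqrt (pi / \<epsilon>) = 2 * sqrt pi"
          using \<epsilon> by (simp add: cn real_sqrt_divide)
        moreover have "(y + c n * t - y)\<^sup>2 / (4 * \<epsilon>) = t\<^sup>2"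
          using \<epsilon> by (simp add: cn power_mult_distrib)
        ultimately show "\<bar>c n\<bar> *\<^sub>R (f (y + c n * t) * cnj (f y)
              * of_real (sqrt (pi / \<epsilon>) * exp (- (y + c n * t - y)\<^sup>2 / (4 * \<epsilon>)))) = G n (y, t)"
          using cn(2) by (simp add: G_def scaleR_conv_of_real mult_ac flip: of_real_mult)
      qed
      finally show ?thesis .
    qed
    have "complex_of_real (J n)
        = (LINT y|lborel. LINT x|lborel. f x * cnj (f y) * of_real (sqrt (pi / \<epsilon>) * exp (- (x - y)\<^sup>2 / (4 * \<epsilon>))))"
      unfolding J_def \<epsilon>_def[symmetric] by (rule integral_fourier_square_gauss(2)[OF fi \<epsilon>])
    also have "\<dots> = (LINT y|lborel. LINT t|lborel. G n (y, t))"
      by (simp only: inner)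
    also have "\<dots> = (LINT p|(lborel \<Otimes>\<^sub>M lborel). G n p)"
      by (rule lborel_pair.integral_fst'[OF Gint])
    finally show ?thesis .
  qed
  define H where "H = (\<lambda>p. case p of (y, t) \<Rightarrow>
    (f y * cnj (f y)) * complex_of_real (2 * sqrt pi * exp (- 1 * t\<^sup>2)))"
  have [measurable]: "H \<in> borel_measurable (lborel \<Otimes>\<^sub>M lborel)"
    unfolding H_def by measurable
  have lim: "(\<lambda>n. G n p) \<longlonglongrightarrow> H p" for p
  proof (cases p)
    case (Pair y t)
    have "(\<lambda>n. 2 * sqrt (1 / real (Suc n))) \<longlonglongrightarrow> 2 * sqrt 0"
      by (intro tendsto_intros LIMSEQ_inverse_real_of_nat[unfolded inverse_eq_divide])
    then have "(\<lambda>n. y + c n * t) \<longlonglongrightarrow> y + 0 * t"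
      unfolding c_def by (intro tendsto_intros) simp
    then have "(\<lambda>n. f (y + c n * t)) \<longlonglongrightarrow> f y"
      using f(1) by (intro isCont_tendsto_compose[of y f]) (auto simp: continuous_on_eq_continuous_at)
    then show ?thesis
      unfolding G_def H_def Pair prod.case by (intro tendsto_intros)
  qed
  have "(\<lambda>n. LINT p|(lborel \<Otimes>\<^sub>M lborel). G n p) \<longlonglongrightarrow> (LINT p|(lborel \<Otimes>\<^sub>M lborel). H p)"
    by (rule integral_dominated_convergence[OF _ _ dom]) (use lim Gle in auto)
  moreover have "(LINT p|(lborel \<Otimes>\<^sub>M lborel). H p) = complex_of_real (2 * pi * (LINT x|lborel. (cmod (f x))\<^sup>2))"
  proof -
    have "(\<lambda>x. complex_of_real ((cmod (f x))\<^sup>2)) = (\<lambda>x. f x * cnj (f x))"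
      by (simp only: complex_norm_square)
    then have ff: "integrable lborel (\<lambda>x. f x * cnj (f x))"
      "(LINT x|lborel. f x * cnj (f x)) = complex_of_real (LINT x|lborel. (cmod (f x))\<^sup>2)"
      using fsq integral_complex_of_real[of lborel "\<lambda>x. (cmod (f x))\<^sup>2"] integrable_of_real[OF fsq, where 'a = complex] by metis+
    have e: "integrable lborel (\<lambda>t::real. 2 * sqrt pi * exp (- 1 * t\<^sup>2))"
      "(LINT t::real|lborel. 2 * sqrt pi * exp (- 1 * t\<^sup>2)) = 2 * pi"
      using integral_exp_square[of 1] by simp_all
    have "(LINT p|(lborel \<Otimes>\<^sub>M lborel). H p)
        = (LINT y|lborel. LINT t|lborel. (f y * cnj (f y)) * complex_of_real (2 * sqrt pi * exp (- 1 * t\<^sup>2)))"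
      unfolding H_def
      by (rule lborel_pair.integral_fst[symmetric]) (intro integrable_pair_mult ff integrable_of_real e)
    also have "\<dots> = (LINT y|lborel. f y * cnj (f y)) * complex_of_real (2 * pi)"
      unfolding integral_mult_right_zero integral_mult_left_zero integral_complex_of_real
      by (simp only: e(2)[unfolded integral_mult_right_zero])
    finally show ?thesis
      by (simp add: ff)
  qed
  ultimately have "(\<lambda>n. complex_of_real (J n)) \<longlonglongrightarrow> complex_of_real (2 * pi * (LINT x|lborel. (cmod (f x))\<^sup>2))"
    by (simp only: JG)
  then have "J \<longlonglongrightarrow> 2 * pi * (LINT x|lborel. (cmod (f x))\<^sup>2)"
    by (simp only: tendsto_of_real_iff)
  with JL show ?thesis
    by (rule LIMSEQ_unique)
qed

text \<open>By \<open>bessel\<close> applied to differences, the transform is Lipschitz in the norm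
  of \<open>L2\<close> on integrable square-integrable functions. Equality on test functions thus
  survives the limit.\<close>

theorem plancherel:
  assumes f: "integrable lborel f" "square_integrable f"
  shows "(norm (L2_of (fourier f)))\<^sup>2 = 2 * pi * (norm (L2_of f))\<^sup>2"
proof -
  have "L2_of f \<in> closure {L2_of g |g. test_function g}"
    by (simp add: test_function_dense)
  then obtain s where s: "\<And>n. s n \<in> {L2_of g |g. test_function g}" "s \<longlonglongrightarrow> L2_of f"
    unfolding closure_sequential by blast
  then obtain g where g: "\<And>n. test_function (g n)" "\<And>n. s n = L2_of (g n)"
    by simp metis
  have gi: "integrable lborel (g n)" "square_integrable (g n)" for n
    using compact_support_integrable[OF test_function_continuous] test_function_square_integrable g(1)[of n]
    unfolding test_function_def by blast+
  note sq = bessel(1)[OF f] bessel(1)[OF gi]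
  have norm_sq: "(norm (L2_of h))\<^sup>2 = (LINT x|lborel. (cmod (h x))\<^sup>2)" if "square_integrable h" for h :: "real \<Rightarrow> complex"
    using that by (simp add: norm_L2_of)
  have le: "norm (L2_of (fourier (g n)) - L2_of (fourier f)) \<le> sqrt (2 * pi) * norm (s n - L2_of f)" for n
  proof -
    have d: "integrable lborel (\<lambda>x. g n x - f x)" "square_integrable (\<lambda>x. g n x - f x)"
      using f gi by (auto intro: square_integrable_diff)
    have "L2_of (fourier (g n)) - L2_of (fourier f) = L2_of (fourier (\<lambda>x. g n x - f x))"
      using sq f gi by (simp add: diff_L2_of fourier_diff)
    then have "(norm (L2_of (fourier (g n)) - L2_of (fourier f)))\<^sup>2 \<le> 2 * pi * (norm (L2_of (\<lambda>x. g n x - f x)))\<^sup>2"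
      using bessel[OF d] d by (simp add: norm_sq)
    also have "\<dots> = (sqrt (2 * pi) * norm (s n - L2_of f))\<^sup>2"
      using f gi by (simp add: power_mult_distrib g diff_L2_of)
    finally show ?thesis
      by (rule power2_le_imp_le) simp
  qed
  have "(\<lambda>n. L2_of (fourier (g n)) - L2_of (fourier f)) \<longlonglongrightarrow> 0"
    by (rule Lim_null_comparison[OF _ tendsto_mult_right_zero[OF tendsto_norm_zero[OF LIM_zero[OF s(2)]]]])
      (rule always_eventually, rule allI, rule le)
  then have "(\<lambda>n. L2_of (fourier (g n))) \<longlonglongrightarrow> L2_of (fourier f)"
    by (rule LIM_zero_cancel)
  then have lim: "(\<lambda>n. (norm (L2_of (fourier (g n))))\<^sup>2) \<longlonglongrightarrow> (norm (L2_of (fourier f)))\<^sup>2"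
    by (intro tendsto_intros)
  have "(norm (L2_of (fourier (g n))))\<^sup>2 = 2 * pi * (norm (s n))\<^sup>2" for n
    using plancherel_compact_support[of "g n"] g(1)[of n] gi(2)[of n] sq(2)[of n]
    by (simp add: norm_sq g test_function_continuous test_function_def)
  with lim have "(\<lambda>n. 2 * pi * (norm (s n))\<^sup>2) \<longlonglongrightarrow> (norm (L2_of (fourier f)))\<^sup>2"
    by simp
  moreover have "(\<lambda>n. 2 * pi * (norm (s n))\<^sup>2) \<longlonglongrightarrow> 2 * pi * (norm (L2_of f))\<^sup>2"
    by (intro tendsto_intros s)
  ultimately show ?thesis
    by (rule LIMSEQ_unique)
qed

text \<open>Polarisation of \<open>plancherel\<close>. The inner product is the real part of the
  Hermitian one, so the single sum f + g is enough.\<close>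

corollary parseval:
  assumes f: "integrable lborel f" "square_integrable f" and g: "integrable lborel g" "square_integrable g"
  shows "L2_of (fourier f) \<bullet> L2_of (fourier g) = 2 * pi * (L2_of f \<bullet> L2_of g)"
proof -
  have fg: "integrable lborel (\<lambda>x. f x + g x)" "square_integrable (\<lambda>x. f x + g x)"
    using f g by (auto intro: square_integrable_add)
  have "L2_of (fourier f) + L2_of (fourier g) = L2_of (fourier (\<lambda>x. f x + g x))"
    using f g by (simp add: add_L2_of bessel(1) fourier_add)
  then have "(norm (L2_of (fourier f) + L2_of (fourier g)))\<^sup>2 = 2 * pi * (norm (L2_of f + L2_of g))\<^sup>2"
    using plancherel[OF fg] f g by (simp add: add_L2_of)
  then show ?thesis
    using plancherel[OF f] plancherel[OF g] by (simp add: dot_norm algebra_simps)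
qed

subsection \<open>Schur kernels\<close>

text \<open>The class of bounded integrable functions lies inside the square-integrable ones, is
  preserved by operators with Schur kernels, and makes all integrals in compositions and adjoints
  absolutely convergent. Operators can thus be handled as honest integrals of functions.\<close>

definition tame :: "('a::euclidean_space \<Rightarrow> complex) \<Rightarrow> bool" where
  "tame f \<longleftrightarrow> integrable lborel f \<and> bounded (range f)"

text \<open>The pointwise bound sends integrable functions to bounded ones; the bound on the
  integrals over the first variable sends integrable functions to integrable ones. Bounding both
  marginals makes the condition symmetric, hence stable under adjoints.\<close>

definition schur_kernel :: "('a::euclidean_space \<Rightarrow> 'a \<Rightarrow> complex) \<Rightarrow> bool" where
  "schur_kernel \<kappa> \<longleftrightarrow> case_prod \<kappa> \<in> borel_measurable (lborel \<Otimes>\<^sub>M lborel) \<and>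
     (\<exists>B. \<forall>z w. cmod (\<kappa> z w) \<le> B) \<and>
     (\<exists>C. (\<forall>z. (\<integral>\<^sup>+w. ennreal (cmod (\<kappa> z w)) \<partial>lborel) \<le> ennreal C) \<and>
          (\<forall>w. (\<integral>\<^sup>+z. ennreal (cmod (\<kappa> z w)) \<partial>lborel) \<le> ennreal C))"

definition kernel_op :: "('a::euclidean_space \<Rightarrow> 'a \<Rightarrow> complex) \<Rightarrow> ('a \<Rightarrow> complex) \<Rightarrow> 'a \<Rightarrow> complex" where
  "kernel_op \<kappa> f z = (LINT w|lborel. \<kappa> z w * f w)"

definition adjoint_kernel :: "('a \<Rightarrow> 'a \<Rightarrow> complex) \<Rightarrow> 'a \<Rightarrow> 'a \<Rightarrow> complex" where
  "adjoint_kernel \<kappa> z w = cnj (\<kappa> w z)"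

lemma tameD:
  assumes "tame f"
  shows "integrable lborel f" "f \<in> borel_measurable borel" "\<exists>B\<ge>0. \<forall>x. cmod (f x) \<le> B"
proof -
  show "\<exists>B\<ge>0. \<forall>x. cmod (f x) \<le> B"
    using assms unfolding tame_def bounded_pos by (auto intro: less_imp_le)
qed (use assms in \<open>auto simp: tame_def\<close>)

lemma tame_square_integrable:
  assumes "tame f"
  shows "square_integrable f"
proof -
  obtain B where B: "B \<ge> 0" "\<And>x. cmod (f x) \<le> B"
    using tameD(3)[OF assms] by blast
  have [measurable]: "f \<in> borel_measurable borel"
    by (rule tameD(2)[OF assms])
  have "integrable lborel (\<lambda>x. (cmod (f x))\<^sup>2)"
  proof (rule Bochner_Integration.integrable_bound)
    show "integrable lborel (\<lambda>x. B * cmod (f x))"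
      using tameD(1)[OF assms] by simp
    show "AE x in lborel. norm ((cmod (f x))\<^sup>2) \<le> norm (B * cmod (f x))"
      using B by (auto intro!: AE_I2 mult_right_mono simp: power2_eq_square)
  qed measurable
  then show ?thesis
    by (simp add: square_integrable_def)
qed

lemma schur_kernelD:
  assumes "schur_kernel \<kappa>"
  shows "case_prod \<kappa> \<in> borel_measurable (lborel \<Otimes>\<^sub>M lborel)"
    and "\<exists>B\<ge>0. \<forall>z w. cmod (\<kappa> z w) \<le> B"
    and "\<exists>C\<ge>0. (\<forall>z. (\<integral>\<^sup>+w. ennreal (cmod (\<kappa> z w)) \<partial>lborel) \<le> ennreal C) \<and>
          (\<forall>w. (\<integral>\<^sup>+z. ennreal (cmod (\<kappa> z w)) \<partial>lborel) \<le> ennreal C)"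
proof -
  show "\<exists>B\<ge>0. \<forall>z w. cmod (\<kappa> z w) \<le> B"
    using assms unfolding schur_kernel_def by (meson norm_ge_zero order_trans)
  obtain C where "(\<forall>z. (\<integral>\<^sup>+w. ennreal (cmod (\<kappa> z w)) \<partial>lborel) \<le> ennreal C) \<and>
          (\<forall>w. (\<integral>\<^sup>+z. ennreal (cmod (\<kappa> z w)) \<partial>lborel) \<le> ennreal C)"
    using assms unfolding schur_kernel_def by blast
  moreover have "ennreal C \<le> ennreal (max C 0)"
    by (simp add: ennreal_leI)
  ultimately show "\<exists>C\<ge>0. (\<forall>z. (\<integral>\<^sup>+w. ennreal (cmod (\<kappa> z w)) \<partial>lborel) \<le> ennreal C) \<and>
          (\<forall>w. (\<integral>\<^sup>+z. ennreal (cmod (\<kappa> z w)) \<partial>lborel) \<le> ennreal C)"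
    by (intro exI[of _ "max C 0"]) (auto intro: order_trans)
qed (use assms in \<open>auto simp: schur_kernel_def\<close>)

lemma schur_kernel_adjoint:
  assumes "schur_kernel \<kappa>"
  shows "schur_kernel (adjoint_kernel \<kappa>)"
proof -
  have [measurable]: "case_prod \<kappa> \<in> borel_measurable (lborel \<Otimes>\<^sub>M lborel)"
    by (rule schur_kernelD[OF assms])
  have "(\<lambda>(z, w). cnj (\<kappa> w z)) \<in> borel_measurable (lborel \<Otimes>\<^sub>M lborel)"
    by measurable
  with assms show ?thesis
    unfolding schur_kernel_def by (auto simp: adjoint_kernel_def[abs_def])
qed

lemma adjoint_kernel_adjoint [simp]: "adjoint_kernel (adjoint_kernel \<kappa>) = \<kappa>"
  by (simp add: adjoint_kernel_def fun_eq_iff)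

lemma integrable_schur_kernel:
  assumes "schur_kernel \<kappa>"
  shows "integrable lborel (\<kappa> z)" "integrable lborel (\<lambda>z. \<kappa> z w)"
proof -
  have [measurable]: "case_prod \<kappa> \<in> borel_measurable (lborel \<Otimes>\<^sub>M lborel)"
    by (rule schur_kernelD[OF assms])
  obtain C where C: "\<And>z. (\<integral>\<^sup>+w. ennreal (cmod (\<kappa> z w)) \<partial>lborel) \<le> ennreal C"
    "\<And>w. (\<integral>\<^sup>+z. ennreal (cmod (\<kappa> z w)) \<partial>lborel) \<le> ennreal C"
    using schur_kernelD(3)[OF assms] by blast
  show "integrable lborel (\<kappa> z)"
    by (rule integrableI_bounded) (auto intro: le_less_trans[OF C(1)])
  show "integrable lborel (\<lambda>z. \<kappa> z w)"
    by (rule integrableI_bounded) (auto intro: le_less_trans[OF C(2)])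
qed

lemma integrable_kernel_mult:
  assumes "schur_kernel \<kappa>" "tame f"
  shows "integrable lborel (\<lambda>w. \<kappa> z w * f w)"
proof -
  obtain B where B: "B \<ge> 0" "\<And>z w. cmod (\<kappa> z w) \<le> B"
    using schur_kernelD(2)[OF assms(1)] by blast
  have [measurable]: "case_prod \<kappa> \<in> borel_measurable (lborel \<Otimes>\<^sub>M lborel)" "f \<in> borel_measurable borel"
    using schur_kernelD(1)[OF assms(1)] tameD(2)[OF assms(2)] by auto
  show ?thesis
  proof (rule Bochner_Integration.integrable_bound)
    show "integrable lborel (\<lambda>w. B * cmod (f w))"
      using tameD(1)[OF assms(2)] by simp
    show "AE w in lborel. cmod (\<kappa> z w * f w) \<le> norm (B * cmod (f w))"
      using B by (auto intro!: AE_I2 mult_right_mono simp: norm_mult)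
  qed measurable
qed

text \<open>By Tonelli the integral over \<open>z\<close> is taken first, where the marginal bound C
  applies; the integrable factor f remains.\<close>

lemma nn_integral_kernel_mult:
  assumes "schur_kernel \<kappa>" "tame f"
  shows "(\<integral>\<^sup>+z. \<integral>\<^sup>+w. ennreal (cmod (\<kappa> z w * f w)) \<partial>lborel \<partial>lborel) < \<infinity>"
proof -
  have [measurable]: "case_prod \<kappa> \<in> borel_measurable (lborel \<Otimes>\<^sub>M lborel)" "f \<in> borel_measurable borel"
    using schur_kernelD(1)[OF assms(1)] tameD(2)[OF assms(2)] by auto
  obtain C where C: "\<And>w. (\<integral>\<^sup>+z. ennreal (cmod (\<kappa> z w)) \<partial>lborel) \<le> ennreal C"
    using schur_kernelD(3)[OF assms(1)] by blast
  have "(\<integral>\<^sup>+z. \<integral>\<^sup>+w. ennreal (cmod (\<kappa> z w * f w)) \<partial>lborel \<partial>lborel)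
      = (\<integral>\<^sup>+w. \<integral>\<^sup>+z. ennreal (cmod (\<kappa> z w * f w)) \<partial>lborel \<partial>lborel)"
    by (rule lborel_pair.Fubini'[symmetric]) measurable
  also have "\<dots> = (\<integral>\<^sup>+w. (\<integral>\<^sup>+z. ennreal (cmod (\<kappa> z w)) \<partial>lborel) * ennreal (cmod (f w)) \<partial>lborel)"
    by (simp add: norm_mult ennreal_mult nn_integral_multc)
  also have "\<dots> \<le> (\<integral>\<^sup>+w. ennreal C * ennreal (cmod (f w)) \<partial>lborel)"
    by (intro nn_integral_mono mult_right_mono C) simp
  also have "\<dots> = ennreal C * (\<integral>\<^sup>+w. ennreal (cmod (f w)) \<partial>lborel)"
    by (simp add: nn_integral_cmult)
  also have "\<dots> < \<infinity>"
    using tameD(1)[OF assms(2)] by (simp add: integrable_iff_bounded ennreal_mult_less_top)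
  finally show ?thesis .
qed

lemma tame_kernel_op:
  assumes "schur_kernel \<kappa>" "tame f"
  shows "tame (kernel_op \<kappa> f)"
proof -
  have [measurable]: "case_prod \<kappa> \<in> borel_measurable (lborel \<Otimes>\<^sub>M lborel)" "f \<in> borel_measurable borel"
    using schur_kernelD(1)[OF assms(1)] tameD(2)[OF assms(2)] by auto
  have "integrable (lborel \<Otimes>\<^sub>M lborel) (\<lambda>(z, w). \<kappa> z w * f w)"
    by (rule integrable_pairI) (use nn_integral_kernel_mult[OF assms] in auto)
  then have "integrable lborel (kernel_op \<kappa> f)"
    unfolding kernel_op_def by (rule lborel_pair.integrable_fst)
  moreover obtain B where B: "B \<ge> 0" "\<And>z w. cmod (\<kappa> z w) \<le> B"
    using schur_kernelD(2)[OF assms(1)] by blast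
  have "cmod (kernel_op \<kappa> f z) \<le> (LINT w|lborel. B * cmod (f w))" for z
    unfolding kernel_op_def
  proof (rule order_trans[OF integral_norm_bound integral_mono])
    show "integrable lborel (\<lambda>w. cmod (\<kappa> z w * f w))"
      by (intro integrable_norm integrable_kernel_mult assms)
    show "integrable lborel (\<lambda>w. B * cmod (f w))"
      using tameD(1)[OF assms(2)] by simp
    show "cmod (\<kappa> z w * f w) \<le> B * cmod (f w)" for w
      using B by (auto intro!: mult_right_mono simp: norm_mult)
  qed
  then have "bounded (range (kernel_op \<kappa> f))"
    by (auto simp: bounded_iff)
  ultimately show ?thesis
    by (simp add: tame_def)
qed

lemma kernel_op_compose:
  assumes \<kappa>: "schur_kernel \<kappa>" and \<mu>: "schur_kernel \<mu>" and f: "tame f"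
    and comp: "\<And>v. (LINT w|lborel. \<kappa> z w * \<mu> w v) = \<nu> z v"
  shows "kernel_op \<kappa> (kernel_op \<mu> f) z = kernel_op \<nu> f z"
proof -
  have [measurable]: "case_prod \<kappa> \<in> borel_measurable (lborel \<Otimes>\<^sub>M lborel)"
    "case_prod \<mu> \<in> borel_measurable (lborel \<Otimes>\<^sub>M lborel)" "f \<in> borel_measurable borel"
    using schur_kernelD(1) \<kappa> \<mu> tameD(2)[OF f] by auto
  obtain B where B: "B \<ge> 0" "\<And>x y. cmod (\<kappa> x y) \<le> B"
    using schur_kernelD(2)[OF \<kappa>] by blast
  have "integrable (lborel \<Otimes>\<^sub>M lborel) (\<lambda>(w, v). \<kappa> z w * (\<mu> w v * f v))"
  proof (rule Bochner_Integration.integrable_bound)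
    have "integrable (lborel \<Otimes>\<^sub>M lborel) (\<lambda>(w, v). \<mu> w v * f v)"
      by (rule integrable_pairI) (use nn_integral_kernel_mult[OF \<mu> f] in auto)
    then show "integrable (lborel \<Otimes>\<^sub>M lborel) (\<lambda>p. B * cmod (case p of (w, v) \<Rightarrow> \<mu> w v * f v))"
      by (intro integrable_mult_right integrable_norm)
    show "AE p in lborel \<Otimes>\<^sub>M lborel. cmod (case p of (w, v) \<Rightarrow> \<kappa> z w * (\<mu> w v * f v))
        \<le> norm (B * cmod (case p of (w, v) \<Rightarrow> \<mu> w v * f v))"
      using B by (auto intro!: AE_I2 mult_right_mono simp: norm_mult)
  qed measurable
  then have "(LINT w|lborel. LINT v|lborel. \<kappa> z w * (\<mu> w v * f v))
      = (LINT v|lborel. LINT w|lborel. \<kappa> z w * (\<mu> w v * f v))"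
    by (rule lborel_pair.Fubini_integral[symmetric])
  then show ?thesis
    unfolding kernel_op_def comp[symmetric] by (simp add: mult.assoc flip: integral_mult_left_zero)
qed

text \<open>Fubini is applied to the complex integrand \<open>h\<close>, and the real part is taken
  outside: the real inner product alone would not separate the conjugated kernel from g.\<close>

lemma kernel_op_adjoint:
  assumes \<kappa>: "schur_kernel \<kappa>" and f: "tame f" and g: "tame g"
  shows "L2_of (kernel_op \<kappa> f) \<bullet> L2_of g = L2_of f \<bullet> L2_of (kernel_op (adjoint_kernel \<kappa>) g)"
proof -
  have [measurable]: "case_prod \<kappa> \<in> borel_measurable (lborel \<Otimes>\<^sub>M lborel)"
    "f \<in> borel_measurable borel" "g \<in> borel_measurable borel"
    using schur_kernelD(1) \<kappa> tameD(2)[OF f] tameD(2)[OF g] by auto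
  define h where "h z w = \<kappa> z w * f w * cnj (g z)" for z w
  obtain B where B: "B \<ge> 0" "\<And>x. cmod (g x) \<le> B"
    using tameD(3)[OF g] by blast
  have h: "integrable (lborel \<Otimes>\<^sub>M lborel) (case_prod h)"
  proof (rule Bochner_Integration.integrable_bound)
    have "integrable (lborel \<Otimes>\<^sub>M lborel) (\<lambda>(w, v). \<kappa> w v * f v)"
      by (rule integrable_pairI) (use nn_integral_kernel_mult[OF \<kappa> f] in auto)
    then show "integrable (lborel \<Otimes>\<^sub>M lborel) (\<lambda>p. B * cmod (case p of (w, v) \<Rightarrow> \<kappa> w v * f v))"
      by (intro integrable_mult_right integrable_norm)
    show "AE p in lborel \<Otimes>\<^sub>M lborel. cmod (case_prod h p)
        \<le> norm (B * cmod (case p of (w, v) \<Rightarrow> \<kappa> w v * f v))"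
      using B by (auto intro!: AE_I2 mult_right_mono simp: norm_mult h_def mult.commute[of B])
        (simp add: mult_left_mono)
  qed (unfold h_def, measurable)
  have in_Re: "x \<bullet> y = Re (x * cnj y)" for x y :: complex
    by (simp add: inner_complex_def)
  have "L2_of (kernel_op \<kappa> f) \<bullet> L2_of g = (LINT z|lborel. Re (LINT w|lborel. h z w))"
    using tame_square_integrable[OF g] tame_square_integrable[OF tame_kernel_op[OF \<kappa> f]]
    by (simp add: inner_L2_of in_Re kernel_op_def h_def del: times_complex.sel)
  also have "\<dots> = Re (LINT z|lborel. LINT w|lborel. h z w)"
    by (rule integral_Re[OF lborel_pair.integrable_fst[OF h]])
  also have "(LINT z|lborel. LINT w|lborel. h z w) = (LINT w|lborel. LINT z|lborel. h z w)"
    by (rule lborel_pair.Fubini_integral[OF h, symmetric])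
  also have "Re \<dots> = (LINT w|lborel. Re (LINT z|lborel. h z w))"
    by (rule integral_Re[OF lborel_pair.integrable_snd[OF h], symmetric])
  also have "\<dots> = (LINT w|lborel. Re (f w * cnj (kernel_op (adjoint_kernel \<kappa>) g w)))"
  proof (rule Bochner_Integration.integral_cong[OF refl])
    fix w
    have "f w * cnj (kernel_op (adjoint_kernel \<kappa>) g w) = (LINT z|lborel. f w * cnj (cnj (\<kappa> z w) * g z))"
      by (simp only: kernel_op_def adjoint_kernel_def integral_mult_right_zero
          Bochner_Integration.integral_cnj[where f = "\<lambda>z. cnj (\<kappa> z w) * g z"])
    also have "\<dots> = (LINT z|lborel. h z w)"
      by (simp add: h_def mult_ac)
    finally show "Re (LINT z|lborel. h z w) = Re (f w * cnj (kernel_op (adjoint_kernel \<kappa>) g w))"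
      by simp
  qed
  also have "\<dots> = L2_of f \<bullet> L2_of (kernel_op (adjoint_kernel \<kappa>) g)"
    using tame_square_integrable[OF f] tame_square_integrable[OF tame_kernel_op[OF schur_kernel_adjoint[OF \<kappa>] g]]
    by (simp add: inner_L2_of in_Re del: times_complex.sel)
  finally show ?thesis .
qed

text \<open>\<open>TT\<close> and \<open>PP\<close> are the kernel forms of the operator identities:
  T composed with its adjoint is c P, and P is idempotent. With \<open>P_adjoint\<close>, P acts as
  an orthogonal projection. They are stated pointwise on kernels because at this stage operators act
  only on tame functions.\<close>

locale coisometric_kernel =
  fixes T P :: "'a::euclidean_space \<Rightarrow> 'a \<Rightarrow> complex" and c :: real
  assumes T: "schur_kernel T" and P: "schur_kernel P" and c: "c \<ge> 0"
    and TT: "\<And>z w. (LINT \<zeta>|lborel. T z \<zeta> * cnj (T w \<zeta>)) = of_real c * P z w"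
    and PP: "\<And>z w. (LINT v|lborel. P z v * P v w) = P z w"
    and P_adjoint: "adjoint_kernel P = P"
begin

lemma norm_P_square:
  assumes "tame f"
  shows "(norm (L2_of (kernel_op P f)))\<^sup>2 = L2_of f \<bullet> L2_of (kernel_op P f)"
proof -
  have "kernel_op P (kernel_op P f) = kernel_op P f"
    by (rule ext) (rule kernel_op_compose[OF P P assms PP])
  then show ?thesis
    using kernel_op_adjoint[OF P assms tame_kernel_op[OF P assms]]
    by (simp add: power2_norm_eq_inner P_adjoint)
qed

text \<open>Cauchy-Schwarz applied to the square norm of P f, which equals the inner product of f
  with P f; one factor is cancelled when it is nonzero.\<close>

lemma norm_P_le:
  assumes "tame f"
  shows "norm (L2_of (kernel_op P f)) \<le> norm (L2_of f)"
proof (cases "norm (L2_of (kernel_op P f)) = 0")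
  case False
  have "norm (L2_of (kernel_op P f)) * norm (L2_of (kernel_op P f)) \<le> norm (L2_of f) * norm (L2_of (kernel_op P f))"
    using norm_P_square[OF assms] norm_cauchy_schwarz[of "L2_of f" "L2_of (kernel_op P f)"]
    by (simp add: power2_eq_square)
  with False show ?thesis
    by (simp add: mult_le_cancel_right)
qed (simp add: norm_ge_zero del: norm_eq_zero)

text \<open>Moving the adjoint of T across the inner product leaves the inner product of f with T
  applied to the adjoint image, that is c times that of f with P f. The equality, and not only the
  upper bound, is what the extremal pair uses.\<close>

lemma norm_adjoint_square:
  assumes "tame f"
  shows "(norm (L2_of (kernel_op (adjoint_kernel T) f)))\<^sup>2 = c * (norm (L2_of (kernel_op P f)))\<^sup>2"
proof -
  note T' = schur_kernel_adjoint[OF T]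
  have "kernel_op T (kernel_op (adjoint_kernel T) f) = kernel_op (\<lambda>z w. of_real c * P z w) f"
    by (rule ext) (rule kernel_op_compose[OF T T' assms], simp add: adjoint_kernel_def TT)
  also have "\<dots> = (\<lambda>z. of_real c * kernel_op P f z)"
    by (simp add: kernel_op_def fun_eq_iff mult.assoc)
  finally have eq: "L2_of (kernel_op T (kernel_op (adjoint_kernel T) f)) = c *\<^sub>R L2_of (kernel_op P f)"
    by (simp add: scaleR_L2_of scaleR_conv_of_real tame_square_integrable tame_kernel_op P assms)
  show ?thesis
    using kernel_op_adjoint[OF T' assms tame_kernel_op[OF T' assms]] norm_P_square[OF assms]
    by (simp add: power2_norm_eq_inner eq)
qed

lemma norm_adjoint_le:
  assumes "tame f"
  shows "norm (L2_of (kernel_op (adjoint_kernel T) f)) \<le> sqrt c * norm (L2_of f)"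
proof (rule power2_le_imp_le)
  have "c * (norm (L2_of (kernel_op P f)))\<^sup>2 \<le> c * (norm (L2_of f))\<^sup>2"
    by (intro mult_left_mono power_mono norm_P_le assms c) simp
  then show "(norm (L2_of (kernel_op (adjoint_kernel T) f)))\<^sup>2 \<le> (sqrt c * norm (L2_of f))\<^sup>2"
    using c by (simp add: norm_adjoint_square[OF assms] power_mult_distrib)
qed (use c in simp)

text \<open>T inherits the bound of its adjoint: the square norm of T f is the inner product of f
  with the adjoint image of T f, and one factor of the norm of T f cancels.\<close>

lemma norm_T_square_le:
  assumes "tame f"
  shows "(norm (L2_of (kernel_op T f)))\<^sup>2 \<le> c * (norm (L2_of f))\<^sup>2"
proof (cases "norm (L2_of (kernel_op T f)) = 0")
  case False
  let ?g = "kernel_op T f"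
  have g: "tame ?g" by (rule tame_kernel_op[OF T assms])
  have "norm (L2_of ?g) * norm (L2_of ?g) = L2_of f \<bullet> L2_of (kernel_op (adjoint_kernel T) ?g)"
    using kernel_op_adjoint[OF T assms g] by (simp add: power2_norm_eq_inner flip: power2_eq_square)
  also have "\<dots> \<le> norm (L2_of f) * norm (L2_of (kernel_op (adjoint_kernel T) ?g))"
    by (rule norm_cauchy_schwarz)
  also have "\<dots> \<le> norm (L2_of f) * (sqrt c * norm (L2_of ?g))"
    by (intro mult_left_mono norm_adjoint_le g) simp
  finally have "norm (L2_of ?g) \<le> sqrt c * norm (L2_of f)"
    using False by (simp add: mult_ac mult_le_cancel_left)
  then have "(norm (L2_of ?g))\<^sup>2 \<le> (sqrt c * norm (L2_of f))\<^sup>2"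
    by (rule power_mono) simp
  then show ?thesis
    using c by (simp add: power_mult_distrib)
qed (use c in simp)

end

subsection \<open>Gaussian kernels\<close>

lemma borel_measurable_Complex [measurable (raw)]:
  assumes [measurable]: "f \<in> borel_measurable M" "g \<in> borel_measurable M"
  shows "(\<lambda>x. Complex (f x) (g x)) \<in> borel_measurable M"
  unfolding Complex_eq by measurable

lemma integral_pair_mult:
  fixes F :: "'a::euclidean_space \<Rightarrow> complex" and G :: "'b::euclidean_space \<Rightarrow> complex"
  assumes "integrable lborel F" "integrable lborel G"
  shows "(LINT p|lborel. F (fst p) * G (snd p)) = (LINT x|lborel. F x) * (LINT y|lborel. G y)"
proof -
  have "(LINT p|lborel. F (fst p) * G (snd p)) = (LINT p|(lborel \<Otimes>\<^sub>M lborel). (case p of (x, y) \<Rightarrow> F x * G y))"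
    by (simp add: lborel_prod split_beta)
  also have "\<dots> = (LINT x|lborel. LINT y|lborel. F x * G y)"
    by (rule lborel_pair.integral_fst[symmetric]) (rule integrable_pair_mult[OF assms])
  finally show ?thesis by simp
qed

text \<open>Completing the square moves the two centres \<open>u\<close> and \<open>v\<close> to
  their midpoint. The frequency is written as 2 \<gamma> \<delta> so that the Fourier transform of
  the Gaussian contributes \<delta>^2 with the same coefficient as (u - v)^2; this symmetry later
  yields isotropic kernels.\<close>

lemma gaussian_product_integral:
  fixes \<gamma> \<delta> u v :: real
  assumes "\<gamma> > 0"
  shows "integrable lborel (\<lambda>s. exp (Complex (- \<gamma> * ((s - u)\<^sup>2 + (s - v)\<^sup>2)) (2 * \<gamma> * \<delta> * s)))" (is ?i)
    and "(LINT s|lborel. exp (Complex (- \<gamma> * ((s - u)\<^sup>2 + (s - v)\<^sup>2)) (2 * \<gamma> * \<delta> * s)))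
      = of_real (sqrt (pi / (2 * \<gamma>))) * exp (Complex (- \<gamma> * ((u - v)\<^sup>2 + \<delta>\<^sup>2) / 2) (\<gamma> * \<delta> * (u + v)))" (is ?e)
proof -
  define m where "m = (u + v) / 2"
  define \<kappa> where "\<kappa> = 2 * \<gamma> * \<delta>"
  define F where "F s = complex_of_real (exp (- (2 * \<gamma>) * s\<^sup>2)) * cis (\<kappa> * s)" for s
  have exp_Complex: "exp (Complex p q) = complex_of_real (exp p) * cis q" for p q
    by (simp add: exp_eq_polar)
  have eq: "exp (Complex (- \<gamma> * ((s - u)\<^sup>2 + (s - v)\<^sup>2)) (2 * \<gamma> * \<delta> * s))
      = exp (Complex (- \<gamma> * (u - v)\<^sup>2 / 2) (\<kappa> * m)) * F (- m + 1 * s)" for s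
  proof -
    have "- \<gamma> * ((s - u)\<^sup>2 + (s - v)\<^sup>2) = - \<gamma> * (u - v)\<^sup>2 / 2 + - (2 * \<gamma>) * (- m + 1 * s)\<^sup>2"
      by (simp add: m_def power2_eq_square field_simps)
    moreover have "2 * \<gamma> * \<delta> * s = \<kappa> * m + \<kappa> * (- m + 1 * s)"
      by (simp add: \<kappa>_def algebra_simps)
    ultimately show ?thesis
      unfolding F_def exp_Complex by (simp only: exp_add of_real_mult cis_mult[symmetric] mult_ac)
  qed
  have F: "integrable lborel F"
    unfolding F_def using integral_exp_square(1)[of "2 * \<gamma>"] assms
    by (subst mult.commute) (intro integrable_cis_mult integrable_of_real; simp)
  show ?i
    unfolding eq by (intro integrable_mult_right lborel_integrable_real_affine F) simp
  have "(LINT s|lborel. exp (Complex (- \<gamma> * ((s - u)\<^sup>2 + (s - v)\<^sup>2)) (2 * \<gamma> * \<delta> * s)))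
      = exp (Complex (- \<gamma> * (u - v)\<^sup>2 / 2) (\<kappa> * m)) * (LINT s|lborel. F s)"
    unfolding eq integral_mult_right_zero
    using lborel_integral_real_affine[of 1 F "- m"] by simp
  also have "(LINT s|lborel. F s) = of_real (sqrt (pi / (2 * \<gamma>)) * exp (- \<kappa>\<^sup>2 / (4 * (2 * \<gamma>))))"
    unfolding F_def using assms by (intro integral_exp_square_cis) simp
  also have "exp (Complex (- \<gamma> * (u - v)\<^sup>2 / 2) (\<kappa> * m)) * \<dots>
      = of_real (sqrt (pi / (2 * \<gamma>))) * exp (Complex (- \<gamma> * (u - v)\<^sup>2 / 2 + (- \<kappa>\<^sup>2 / (4 * (2 * \<gamma>)))) (\<kappa> * m))"
    unfolding exp_Complex exp_add by simp
  also have "- \<gamma> * (u - v)\<^sup>2 / 2 + (- \<kappa>\<^sup>2 / (4 * (2 * \<gamma>))) = - \<gamma> * ((u - v)\<^sup>2 + \<delta>\<^sup>2) / 2"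
    using assms by (simp add: \<kappa>_def power2_eq_square field_simps)
  also have "\<kappa> * m = \<gamma> * \<delta> * (u + v)"
    by (simp add: \<kappa>_def m_def)
  finally show ?e .
qed

lemma nn_integral_gaussian_pair:
  fixes p q M x y :: real
  assumes pq: "p > 0" "q > 0" and M: "M \<ge> 0"
  shows "(\<integral>\<^sup>+w. ennreal (M * (exp (- p * (fst w - x)\<^sup>2) * exp (- q * (snd w - y)\<^sup>2))) \<partial>lborel)
    = ennreal (M * (sqrt (pi / p) * sqrt (pi / q)))"
proof -
  have gauss: "(\<integral>\<^sup>+s. ennreal (exp (- r * (s - x)\<^sup>2)) \<partial>lborel) = ennreal (sqrt (pi / r))" if "r > 0" for r x :: real
  proof -
    have "(\<integral>\<^sup>+s. ennreal (exp (- r * s\<^sup>2)) \<partial>lborel) = (\<integral>\<^sup>+s. ennreal (exp (- r * (- x + 1 * s)\<^sup>2)) \<partial>lborel)"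
      by (subst nn_integral_real_affine[where c = 1 and t = "- x"]) simp_all
    then show ?thesis
      using nn_integral_eq_integral[OF integral_exp_square(1)[OF that]] integral_exp_square(2)[OF that] by simp
  qed
  have "(\<integral>\<^sup>+w. ennreal (M * (exp (- p * (fst w - x)\<^sup>2) * exp (- q * (snd w - y)\<^sup>2))) \<partial>lborel)
      = (\<integral>\<^sup>+w. (case w of (s, t) \<Rightarrow> ennreal M * (ennreal (exp (- p * (s - x)\<^sup>2)) * ennreal (exp (- q * (t - y)\<^sup>2))))
          \<partial>(lborel \<Otimes>\<^sub>M lborel))"
    using M by (simp add: lborel_prod split_beta flip: ennreal_mult)
  also have "\<dots> = (\<integral>\<^sup>+s. \<integral>\<^sup>+t. ennreal M * (ennreal (exp (- p * (s - x)\<^sup>2)) * ennreal (exp (- q * (t - y)\<^sup>2))) \<partial>lborel \<partial>lborel)"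
    by (subst lborel.nn_integral_fst[symmetric]) simp_all
  also have "\<dots> = ennreal M * (ennreal (sqrt (pi / p)) * ennreal (sqrt (pi / q)))"
    by (simp add: nn_integral_cmult nn_integral_multc gauss[OF pq(1), simplified] gauss[OF pq(2), simplified])
  finally show ?thesis
    using M pq by (simp flip: ennreal_mult)
qed

text \<open>The majorant depends only on the squared coordinate differences, so the same Gaussian
  integral bounds both marginals.\<close>

lemma schur_kernel_gaussian:
  fixes \<kappa> :: "real \<times> real \<Rightarrow> real \<times> real \<Rightarrow> complex"
  assumes meas: "case_prod \<kappa> \<in> borel_measurable (lborel \<Otimes>\<^sub>M lborel)" and pq: "p > 0" "q > 0" and M: "M \<ge> 0"
    and bound: "\<And>x y s t. cmod (\<kappa> (x, y) (s, t)) \<le> M * (exp (- p * (s - x)\<^sup>2) * exp (- q * (t - y)\<^sup>2))"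
  shows "schur_kernel \<kappa>"
proof -
  define C where "C = M * (sqrt (pi / p) * sqrt (pi / q))"
  note C = nn_integral_gaussian_pair[OF pq M, folded C_def]
  have "cmod (\<kappa> z w) \<le> M" for z w
  proof (cases z, cases w)
    fix x y s t assume zw: "z = (x, y)" "w = (s, t)"
    have "M * (exp (- p * (s - x)\<^sup>2) * exp (- q * (t - y)\<^sup>2)) \<le> M * (1 * 1)"
      using M pq by (intro mult_left_mono mult_mono) auto
    with bound[of x y s t] show ?thesis
      unfolding zw by simp
  qed
  moreover have "(\<integral>\<^sup>+w. ennreal (cmod (\<kappa> z w)) \<partial>lborel) \<le> ennreal C" for z
  proof (cases z)
    case (Pair x y)
    have "(\<integral>\<^sup>+w. ennreal (cmod (\<kappa> z w)) \<partial>lborel)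
        \<le> (\<integral>\<^sup>+w. ennreal (M * (exp (- p * (fst w - x)\<^sup>2) * exp (- q * (snd w - y)\<^sup>2))) \<partial>lborel)"
      using bound[of x y "fst w" "snd w" for w] by (intro nn_integral_mono ennreal_leI) (simp add: Pair)
    then show ?thesis by (simp only: C)
  qed
  moreover have "(\<integral>\<^sup>+z. ennreal (cmod (\<kappa> z w)) \<partial>lborel) \<le> ennreal C" for w
  proof (cases w)
    case (Pair s t)
    have "(\<integral>\<^sup>+z. ennreal (cmod (\<kappa> z w)) \<partial>lborel)
        \<le> (\<integral>\<^sup>+z. ennreal (M * (exp (- p * (fst z - s)\<^sup>2) * exp (- q * (snd z - t)\<^sup>2))) \<partial>lborel)"
      using bound[of "fst z" "snd z" s t for z]
      by (intro nn_integral_mono ennreal_leI) (simp add: Pair power2_commute)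
    then show ?thesis by (simp only: C)
  qed
  ultimately show ?thesis
    unfolding schur_kernel_def using meas by blast
qed

text \<open>With \<open>a = 1 + \<beta>\<close>, \<open>b = 1 - \<beta>\<close> and \<open>\<phi>(w) = |w|\<^sup>2 + \<beta> Re (w\<^sup>2)\<close>, the Leray kernel at frequency
  \<open>\<xi>\<close> is \<open>(2 \<xi> / \<pi>) exp (- \<xi> (\<phi>(w - z) + 2 \<i> Im ((cnj w + \<beta> w) (w - z))))\<close>. The second kernel is the
  Bargmann-Fock projection conjugated by the unimodular factor \<open>exp (\<i> \<xi> \<beta> Im (z\<^sup>2))\<close>.\<close>

definition leray_kernel :: "real \<Rightarrow> real \<Rightarrow> real \<Rightarrow> real \<times> real \<Rightarrow> real \<times> real \<Rightarrow> complex" where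
  "leray_kernel a b \<xi> z w = of_real (2 * \<xi> / pi) *
     exp (Complex (- \<xi> * (a * (fst w - fst z)\<^sup>2 + b * (snd w - snd z)\<^sup>2))
       (- 2 * \<xi> * (a * fst w * (snd w - snd z) - b * snd w * (fst w - fst z))))"

definition szego_kernel :: "real \<Rightarrow> real \<Rightarrow> real \<Rightarrow> real \<times> real \<Rightarrow> real \<times> real \<Rightarrow> complex" where
  "szego_kernel a b \<xi> z w = of_real (2 * \<xi> / pi) *
     exp (Complex (- \<xi> * ((fst z - fst w)\<^sup>2 + (snd z - snd w)\<^sup>2))
       (\<xi> * (a * (snd z - snd w) * (fst z + fst w) - b * (fst z - fst w) * (snd z + snd w))))"

lemma norm_leray_kernel:
  assumes "\<xi> \<ge> 0"
  shows "cmod (leray_kernel a b \<xi> z w)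
    = 2 * \<xi> / pi * exp (- \<xi> * (a * (fst w - fst z)\<^sup>2 + b * (snd w - snd z)\<^sup>2))"
  using assms by (simp add: leray_kernel_def norm_mult norm_divide)

lemma borel_measurable_fst_borel [measurable (raw)]:
  fixes f :: "'m \<Rightarrow> 'a::second_countable_topology \<times> 'b::second_countable_topology"
  shows "f \<in> borel_measurable M \<Longrightarrow> (\<lambda>x. fst (f x)) \<in> borel_measurable M"
  by (rule measurable_compose[of f M borel]) (auto intro!: borel_measurable_continuous_onI continuous_intros)

lemma borel_measurable_snd_borel [measurable (raw)]:
  fixes f :: "'m \<Rightarrow> 'a::second_countable_topology \<times> 'b::second_countable_topology"
  shows "f \<in> borel_measurable M \<Longrightarrow> (\<lambda>x. snd (f x)) \<in> borel_measurable M"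
  by (rule measurable_compose[of f M borel]) (auto intro!: borel_measurable_continuous_onI continuous_intros)

lemma borel_measurable_leray_kernel [measurable (raw)]:
  assumes [measurable]: "g \<in> borel_measurable M" "z \<in> borel_measurable M" "w \<in> borel_measurable M"
  shows "(\<lambda>x. leray_kernel a b (g x) (z x) (w x)) \<in> borel_measurable M"
  unfolding leray_kernel_def by measurable

lemma borel_measurable_szego_kernel [measurable (raw)]:
  assumes [measurable]: "g \<in> borel_measurable M" "z \<in> borel_measurable M" "w \<in> borel_measurable M"
  shows "(\<lambda>x. szego_kernel a b (g x) (z x) (w x)) \<in> borel_measurable M"
  unfolding szego_kernel_def by measurable

lemma exp_Complex_mult: "exp (Complex p q) * exp (Complex r s) = exp (Complex (p + r) (q + s))"
proof -
  have "Complex p q + Complex r s = Complex (p + r) (q + s)"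
    by (simp add: complex_eq_iff)
  then show ?thesis
    by (simp flip: exp_add)
qed

lemma cnj_exp_Complex: "cnj (exp (Complex p q)) = exp (Complex p (- q))"
proof -
  have "cnj (Complex p q) = Complex p (- q)"
    by (simp add: complex_eq_iff)
  then show ?thesis
    by (simp add: exp_cnj)
qed

text \<open>For both products the phase term bilinear in the two coordinates of the integration
  variable cancels. What is left is linear in each coordinate, so the integral splits into two
  one-dimensional Gaussians. The condition a + b = 2 makes the unequal weights average to an
  isotropic exponent.\<close>

lemma coisometric_leray_kernel:
  assumes ab: "a > 0" "b > 0" "a + b = 2" and \<xi>: "\<xi> > 0"
  shows "coisometric_kernel (leray_kernel a b \<xi>) (szego_kernel a b \<xi>) (1 / sqrt (a * b))"
proof
  show "schur_kernel (leray_kernel a b \<xi>)"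
  proof (rule schur_kernel_gaussian[of _ "\<xi> * a" "\<xi> * b" "2 * \<xi> / pi"])
    show "cmod (leray_kernel a b \<xi> (x, y) (s, t))
        \<le> 2 * \<xi> / pi * (exp (- (\<xi> * a) * (s - x)\<^sup>2) * exp (- (\<xi> * b) * (t - y)\<^sup>2))" for x y s t
      using \<xi> by (simp add: norm_leray_kernel algebra_simps flip: exp_add)
  qed (use ab \<xi> in \<open>simp_all, measurable\<close>)
  show "schur_kernel (szego_kernel a b \<xi>)"
  proof (rule schur_kernel_gaussian[of _ \<xi> \<xi> "2 * \<xi> / pi"])
    show "cmod (szego_kernel a b \<xi> (x, y) (s, t))
        \<le> 2 * \<xi> / pi * (exp (- \<xi> * (s - x)\<^sup>2) * exp (- \<xi> * (t - y)\<^sup>2))" for x y s t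
      using \<xi> by (simp add: szego_kernel_def norm_mult norm_divide algebra_simps power2_commute flip: exp_add)
  qed (use ab \<xi> in \<open>simp_all, measurable\<close>)
  show "0 \<le> 1 / sqrt (a * b)"
    using ab by simp
  show "adjoint_kernel (szego_kernel a b \<xi>) = szego_kernel a b \<xi>"
    by (auto simp: adjoint_kernel_def szego_kernel_def fun_eq_iff cnj_exp_Complex power2_commute algebra_simps)
next
  fix z w :: "real \<times> real"
  obtain x y x' y' where zw: "z = (x, y)" "w = (x', y')"
    by (cases z, cases w)
  define F where "F s = exp (Complex (- (\<xi> * a) * ((s - x)\<^sup>2 + (s - x')\<^sup>2)) (2 * (\<xi> * a) * (y - y') * s))" for s
  define G where "G t = exp (Complex (- (\<xi> * b) * ((t - y)\<^sup>2 + (t - y')\<^sup>2)) (2 * (\<xi> * b) * (x' - x) * t))" for t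
  have pos: "\<xi> * a > 0" "\<xi> * b > 0" using ab \<xi> by auto
  note F = gaussian_product_integral[OF pos(1), of x x' "y - y'", folded F_def]
  note G = gaussian_product_integral[OF pos(2), of y y' "x' - x", folded G_def]
  \<comment> \<open>With \<zeta> = (s, t), the term (a - b) s t occurs in both phases with opposite
    signs, because of the conjugation; only the linear frequencies of \<open>F\<close> and
    \<open>G\<close> survive.\<close>
  have "leray_kernel a b \<xi> z \<zeta> * cnj (leray_kernel a b \<xi> w \<zeta>)
      = of_real ((2 * \<xi> / pi)\<^sup>2) * (F (fst \<zeta>) * G (snd \<zeta>))" for \<zeta>
    unfolding leray_kernel_def zw F_def G_def fst_conv snd_conv complex_cnj_mult cnj_exp_Complex
      complex_cnj_complex_of_real exp_Complex_mult
    by (simp add: power2_eq_square mult.assoc mult.left_commute[of "exp _"] exp_Complex_mult)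
      (simp add: algebra_simps)
  then have "(LINT \<zeta>|lborel. leray_kernel a b \<xi> z \<zeta> * cnj (leray_kernel a b \<xi> w \<zeta>))
      = of_real ((2 * \<xi> / pi)\<^sup>2) * ((LINT s|lborel. F s) * (LINT t|lborel. G t))"
    by (simp add: integral_pair_mult[OF F(1) G(1)])
  also have "\<dots> = of_real ((2 * \<xi> / pi)\<^sup>2 * (sqrt (pi / (2 * (\<xi> * a))) * sqrt (pi / (2 * (\<xi> * b)))))
      * (exp (Complex (- (\<xi> * a) * ((x - x')\<^sup>2 + (y - y')\<^sup>2) / 2) (\<xi> * a * (y - y') * (x + x')))
       * exp (Complex (- (\<xi> * b) * ((y - y')\<^sup>2 + (x' - x)\<^sup>2) / 2) (\<xi> * b * (x' - x) * (y + y'))))"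
    unfolding F(2) G(2) by (simp only: of_real_mult mult_ac)
  \<comment> \<open>An idempotent kernel of this shape needs the prefactor 2 \<xi> / pi. The weights
    a and b change the Gaussian mass pi / (2 \<xi>) only by 1 / sqrt (a * b), which is the constant
    c, free of \<xi>.\<close>
  also have "(2 * \<xi> / pi)\<^sup>2 * (sqrt (pi / (2 * (\<xi> * a))) * sqrt (pi / (2 * (\<xi> * b))))
      = 1 / sqrt (a * b) * (2 * \<xi> / pi)"
  proof -
    have "sqrt (pi / (2 * (\<xi> * a))) * sqrt (pi / (2 * (\<xi> * b))) = sqrt ((pi / (2 * \<xi>))\<^sup>2 / (a * b))"
      using ab \<xi> by (simp add: power2_eq_square field_simps flip: real_sqrt_mult)
    also have "\<dots> = pi / (2 * \<xi>) / sqrt (a * b)"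
      using ab \<xi> by (simp add: real_sqrt_divide)
    finally show ?thesis
      using \<xi> by (simp add: power2_eq_square field_simps)
  qed
  also have "exp (Complex (- (\<xi> * a) * ((x - x')\<^sup>2 + (y - y')\<^sup>2) / 2) (\<xi> * a * (y - y') * (x + x')))
       * exp (Complex (- (\<xi> * b) * ((y - y')\<^sup>2 + (x' - x)\<^sup>2) / 2) (\<xi> * b * (x' - x) * (y + y')))
      = exp (Complex (- \<xi> * ((x - x')\<^sup>2 + (y - y')\<^sup>2)) (\<xi> * (a * (y - y') * (x + x') - b * (x - x') * (y + y'))))"
  proof -
    have "- (\<xi> * a) * X / 2 + - (\<xi> * b) * X / 2 = - \<xi> * ((a + b) / 2 * X)" for X
      by (simp add: field_simps)
    then have "- (\<xi> * a) * ((x - x')\<^sup>2 + (y - y')\<^sup>2) / 2 + - (\<xi> * b) * ((y - y')\<^sup>2 + (x' - x)\<^sup>2) / 2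
        = - \<xi> * ((x - x')\<^sup>2 + (y - y')\<^sup>2)"
      by (simp add: ab add.commute[of "(y - y')\<^sup>2"] power2_commute[of x'])
    moreover have "\<xi> * a * (y - y') * (x + x') + \<xi> * b * (x' - x) * (y + y')
        = \<xi> * (a * (y - y') * (x + x') - b * (x - x') * (y + y'))"
      by (simp add: algebra_simps)
    ultimately show ?thesis
      by (simp only: exp_Complex_mult)
  qed
  finally show "(LINT \<zeta>|lborel. leray_kernel a b \<xi> z \<zeta> * cnj (leray_kernel a b \<xi> w \<zeta>))
      = complex_of_real (1 / sqrt (a * b)) * szego_kernel a b \<xi> z w"
    by (simp add: szego_kernel_def zw)
next
  fix z w :: "real \<times> real"
  obtain x y x' y' where zw: "z = (x, y)" "w = (x', y')"
    by (cases z, cases w)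
  define F where "F s = exp (Complex (- \<xi> * ((s - x)\<^sup>2 + (s - x')\<^sup>2)) (2 * \<xi> * (y - y') * s))" for s
  define G where "G t = exp (Complex (- \<xi> * ((t - y)\<^sup>2 + (t - y')\<^sup>2)) (2 * \<xi> * (x' - x) * t))" for t
  note F = gaussian_product_integral[OF \<xi>, of x x' "y - y'", folded F_def]
  note G = gaussian_product_integral[OF \<xi>, of y y' "x' - x", folded G_def]
  \<comment> \<open>The part of the phase that does not involve v. It is a difference of one
    function at z and at w, namely the phase of the unimodular conjugating factor, and for the Leray
    weights a - b = 2 \<beta>.\<close>
  define \<theta> where "\<theta> = \<xi> * (a - b) * (x * y - x' * y')"
  have b: "b = 2 - a" using ab by simp
  have "szego_kernel a b \<xi> z v * szego_kernel a b \<xi> v w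
      = (of_real ((2 * \<xi> / pi)\<^sup>2) * exp (Complex 0 \<theta>)) * (F (fst v) * G (snd v))" for v
    unfolding szego_kernel_def zw F_def G_def fst_conv snd_conv
    by (simp add: power2_eq_square mult.assoc mult.left_commute[of "exp _"] exp_Complex_mult)
      (simp add: algebra_simps \<theta>_def b)
  then have "(LINT v|lborel. szego_kernel a b \<xi> z v * szego_kernel a b \<xi> v w)
      = (of_real ((2 * \<xi> / pi)\<^sup>2) * exp (Complex 0 \<theta>)) * ((LINT s|lborel. F s) * (LINT t|lborel. G t))"
    by (simp add: integral_pair_mult[OF F(1) G(1)])
  also have "\<dots> = of_real ((2 * \<xi> / pi)\<^sup>2 * (sqrt (pi / (2 * \<xi>)) * sqrt (pi / (2 * \<xi>))))
      * (exp (Complex 0 \<theta>) * (exp (Complex (- \<xi> * ((x - x')\<^sup>2 + (y - y')\<^sup>2) / 2) (\<xi> * (y - y') * (x + x')))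
       * exp (Complex (- \<xi> * ((y - y')\<^sup>2 + (x' - x)\<^sup>2) / 2) (\<xi> * (x' - x) * (y + y')))))"
    unfolding F(2) G(2) by (simp only: of_real_mult mult_ac)
  also have "(2 * \<xi> / pi)\<^sup>2 * (sqrt (pi / (2 * \<xi>)) * sqrt (pi / (2 * \<xi>))) = 2 * \<xi> / pi"
    using \<xi> by (simp add: power2_eq_square field_simps)
  also have "exp (Complex 0 \<theta>) * (exp (Complex (- \<xi> * ((x - x')\<^sup>2 + (y - y')\<^sup>2) / 2) (\<xi> * (y - y') * (x + x')))
       * exp (Complex (- \<xi> * ((y - y')\<^sup>2 + (x' - x)\<^sup>2) / 2) (\<xi> * (x' - x) * (y + y'))))
      = exp (Complex (- \<xi> * ((x - x')\<^sup>2 + (y - y')\<^sup>2)) (\<xi> * (a * (y - y') * (x + x') - b * (x - x') * (y + y'))))"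
  proof -
    have "0 + (- \<xi> * ((x - x')\<^sup>2 + (y - y')\<^sup>2) / 2 + - \<xi> * ((y - y')\<^sup>2 + (x' - x)\<^sup>2) / 2)
        = - \<xi> * ((x - x')\<^sup>2 + (y - y')\<^sup>2)"
      by (simp add: add.commute[of "(y - y')\<^sup>2"] power2_commute[of x'])
    moreover have "\<theta> + (\<xi> * (y - y') * (x + x') + \<xi> * (x' - x) * (y + y'))
        = \<xi> * (a * (y - y') * (x + x') - b * (x - x') * (y + y'))"
      unfolding \<theta>_def b by (simp add: algebra_simps)
    ultimately show ?thesis
      by (simp only: exp_Complex_mult)
  qed
  finally show "(LINT v|lborel. szego_kernel a b \<xi> z v * szego_kernel a b \<xi> v w) = szego_kernel a b \<xi> z w"
    by (simp add: szego_kernel_def zw)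
qed

subsection \<open>Partial Fourier transforms\<close>

lemma measurable_assoc [measurable]:
  "(\<lambda>(z, u). (fst z, snd z, u)) \<in> (lborel :: (real \<times> real) measure) \<Otimes>\<^sub>M lborel \<rightarrow>\<^sub>M (lborel :: (real \<times> real \<times> real) measure)"
  by (simp add: borel_measurable_continuous_onI lborel_prod)

text \<open>The type associates triples to the right, whereas slicing in the last variable groups
  the first two coordinates into a base point. This measure-preserving regrouping transfers Fubini
  between the two.\<close>

lemma distr_lborel_assoc:
  "distr ((lborel :: (real \<times> real) measure) \<Otimes>\<^sub>M lborel) lborel (\<lambda>(z, u). (fst z, snd z, u))
    = (lborel :: (real \<times> real \<times> real) measure)"
proof (rule measure_eqI)
  fix A :: "(real \<times> real \<times> real) set"
  assume "A \<in> sets (distr ((lborel :: (real \<times> real) measure) \<Otimes>\<^sub>M lborel) lborel (\<lambda>(z, u). (fst z, snd z, u)))"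
  then have A: "A \<in> sets (borel :: (real \<times> real \<times> real) measure)"
    by simp
  then have [measurable]: "A \<in> sets ((borel :: real measure) \<Otimes>\<^sub>M ((borel :: real measure) \<Otimes>\<^sub>M (borel :: real measure)))"
    unfolding borel_prod .
  have m: "(\<lambda>(z, u). (fst z, snd z, u)) \<in> measurable ((lborel :: (real \<times> real) measure) \<Otimes>\<^sub>M lborel) (lborel :: (real \<times> real \<times> real) measure)"
    by measurable
  have "emeasure (distr ((lborel :: (real \<times> real) measure) \<Otimes>\<^sub>M lborel) lborel (\<lambda>(z, u). (fst z, snd z, u))) A
      = (\<integral>\<^sup>+p. indicator A p \<partial>(distr ((lborel :: (real \<times> real) measure) \<Otimes>\<^sub>M lborel) lborel (\<lambda>(z, u). (fst z, snd z, u))))"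
    using A by simp
  also have "\<dots> = (\<integral>\<^sup>+p. indicator A (fst (fst p), snd (fst p), snd p) \<partial>((lborel :: (real \<times> real) measure) \<Otimes>\<^sub>M lborel))"
    using A by (subst nn_integral_distr[OF m]) (auto simp: split_beta)
  also have "\<dots> = (\<integral>\<^sup>+z. \<integral>\<^sup>+u. indicator A (fst z, snd z, u) \<partial>lborel \<partial>(lborel \<Otimes>\<^sub>M lborel))"
    unfolding lborel_prod[symmetric] by (subst lborel.nn_integral_fst[symmetric]) simp_all
  also have "\<dots> = (\<integral>\<^sup>+x. \<integral>\<^sup>+y. \<integral>\<^sup>+u. indicator A (x, y, u) \<partial>lborel \<partial>lborel \<partial>lborel)"
    by (subst lborel.nn_integral_fst[symmetric]) simp_all
  also have "\<dots> = (\<integral>\<^sup>+x. \<integral>\<^sup>+p. indicator A (x, p) \<partial>(lborel \<Otimes>\<^sub>M lborel) \<partial>lborel)"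
    by (intro nn_integral_cong) (subst lborel.nn_integral_fst[symmetric], simp_all)
  also have "\<dots> = (\<integral>\<^sup>+x. \<integral>\<^sup>+p. indicator A (x, p) \<partial>lborel \<partial>lborel)"
    by (simp only: lborel_prod)
  also have "\<dots> = (\<integral>\<^sup>+p. indicator A p \<partial>(lborel \<Otimes>\<^sub>M lborel))"
    by (rule lborel.nn_integral_fst) (use A in \<open>simp add: lborel_prod\<close>)
  finally show "emeasure (distr ((lborel :: (real \<times> real) measure) \<Otimes>\<^sub>M lborel) lborel (\<lambda>(z, u). (fst z, snd z, u))) A
      = emeasure lborel A"
    using A by (simp add: lborel_prod)
qed simp

lemma nn_integral_triple:
  fixes f :: "real \<times> real \<times> real \<Rightarrow> ennreal"
  assumes [measurable]: "f \<in> borel_measurable borel"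
  shows "(\<integral>\<^sup>+p. f p \<partial>lborel) = (\<integral>\<^sup>+z. \<integral>\<^sup>+u. f (fst z, snd z, u) \<partial>lborel \<partial>lborel)"
proof -
  have "(\<integral>\<^sup>+p. f p \<partial>lborel) = (\<integral>\<^sup>+p. f (case p of (z, u) \<Rightarrow> (fst z, snd z, u)) \<partial>((lborel :: (real \<times> real) measure) \<Otimes>\<^sub>M lborel))"
    by (subst distr_lborel_assoc[symmetric], subst nn_integral_distr) simp_all
  also have "\<dots> = (\<integral>\<^sup>+z. \<integral>\<^sup>+u. f (fst z, snd z, u) \<partial>lborel \<partial>lborel)"
    by (subst lborel.nn_integral_fst[symmetric]) simp_all
  finally show ?thesis .
qed

lemma integral_triple:
  fixes f :: "real \<times> real \<times> real \<Rightarrow> real"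
  assumes f: "integrable lborel f"
  shows "(LINT p|lborel. f p) = (LINT z|lborel. LINT u|lborel. f (fst z, snd z, u))"
proof -
  have [measurable]: "f \<in> borel_measurable borel"
    using f by auto
  have i: "integrable ((lborel :: (real \<times> real) measure) \<Otimes>\<^sub>M lborel) (\<lambda>p. f (case p of (z, u) \<Rightarrow> (fst z, snd z, u)))"
    using f by (subst (asm) distr_lborel_assoc[symmetric], subst (asm) integrable_distr_eq) simp_all
  have "(LINT p|lborel. f p) = (LINT p|((lborel :: (real \<times> real) measure) \<Otimes>\<^sub>M lborel). f (case p of (z, u) \<Rightarrow> (fst z, snd z, u)))"
    by (subst distr_lborel_assoc[symmetric], subst integral_distr) simp_all
  also have "\<dots> = (LINT z|lborel. LINT u|lborel. f (fst z, snd z, u))"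
    using lborel_pair.integral_fst'[OF i] by simp
  finally show ?thesis .
qed

lemma borel_measurable_fourier_param [measurable (raw)]:
  assumes [measurable]: "case_prod h \<in> borel_measurable (M \<Otimes>\<^sub>M lborel)" "g \<in> borel_measurable M"
  shows "(\<lambda>x. fourier (h x) (g x)) \<in> borel_measurable M"
  unfolding fourier_def by measurable

text \<open>The extended nonnegative form can be integrated over the base points before the total is
  known to be finite.\<close>

lemma nn_plancherel:
  assumes f: "integrable lborel f" "square_integrable f"
  shows "(\<integral>\<^sup>+\<xi>. ennreal ((cmod (fourier f \<xi>))\<^sup>2) \<partial>lborel) = ennreal (2 * pi) * (\<integral>\<^sup>+x. ennreal ((cmod (f x))\<^sup>2) \<partial>lborel)"
proof -
  have nn: "(\<integral>\<^sup>+x. ennreal ((cmod (h x))\<^sup>2) \<partial>lborel) = ennreal ((norm (L2_of h))\<^sup>2)" if "square_integrable h" for h :: "real \<Rightarrow> complex"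
    using nn_integral_eq_integral[OF square_integrableD(2)[OF that]] by (simp add: norm_L2_of that)
  show ?thesis
    by (simp add: nn f bessel(1)[OF f] plancherel[OF f] ennreal_mult)
qed

lemma nn_integral_reflect:
  fixes f :: "real \<Rightarrow> ennreal"
  assumes [measurable]: "f \<in> borel_measurable borel"
  shows "(\<integral>\<^sup>+x. f (- x) \<partial>lborel) = (\<integral>\<^sup>+x. f x \<partial>lborel)"
  using nn_integral_real_affine[of f "- 1" 0] by simp

text \<open>The multiplication formula moves the transform from one factor to the other by Fubini.
  It takes the place of Fourier inversion when the pairing with the extremal function is
  computed.\<close>

lemma fourier_duality:
  assumes f: "integrable lborel f" and g: "integrable lborel g"
  shows "(LINT x|lborel. f x \<bullet> fourier g (- x)) = (LINT \<xi>|lborel. fourier f \<xi> \<bullet> g \<xi>)"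
proof -
  have [measurable]: "f \<in> borel_measurable borel" "g \<in> borel_measurable borel"
    using f g by auto
  define h where "h x \<xi> = f x * cnj (g \<xi>) * cis (- \<xi> * x)" for x \<xi>
  have h: "integrable (lborel \<Otimes>\<^sub>M lborel) (case_prod h)"
  proof (rule Bochner_Integration.integrable_bound)
    show "integrable (lborel \<Otimes>\<^sub>M lborel) (\<lambda>(x, \<xi>). f x * cnj (g \<xi>))"
      using f g by (intro integrable_pair_mult) auto
  qed (unfold h_def, measurable, auto simp: norm_mult)
  have in_Re: "x \<bullet> y = Re (x * cnj y)" for x y :: complex
    by (simp add: inner_complex_def)
  have 1: "f x * cnj (fourier g (- x)) = (LINT \<xi>|lborel. h x \<xi>)" for x
  proof -
    have "f x * cnj (fourier g (- x)) = (LINT \<xi>|lborel. f x * cnj (cis (- (- x) * \<xi>) * g \<xi>))"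
      by (simp only: fourier_def integral_mult_right_zero
          Bochner_Integration.integral_cnj[where f = "\<lambda>\<xi>. cis (- (- x) * \<xi>) * g \<xi>"])
    then show ?thesis
      by (simp add: h_def cis_cnj mult_ac)
  qed
  have 2: "fourier f \<xi> * cnj (g \<xi>) = (LINT x|lborel. h x \<xi>)" for \<xi>
  proof -
    have "fourier f \<xi> * cnj (g \<xi>) = (LINT x|lborel. cis (- \<xi> * x) * f x * cnj (g \<xi>))"
      by (simp only: fourier_def integral_mult_left_zero)
    then show ?thesis
      by (simp add: h_def mult_ac)
  qed
  have "(LINT x|lborel. f x \<bullet> fourier g (- x)) = Re (LINT x|lborel. LINT \<xi>|lborel. h x \<xi>)"
    unfolding in_Re 1 by (rule integral_Re[OF lborel_pair.integrable_fst[OF h]])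
  also have "\<dots> = Re (LINT \<xi>|lborel. LINT x|lborel. h x \<xi>)"
    by (rule arg_cong[where f = Re]) (rule lborel_pair.Fubini_integral[OF h, symmetric])
  also have "\<dots> = (LINT \<xi>|lborel. fourier f \<xi> \<bullet> g \<xi>)"
    unfolding in_Re 2 by (rule integral_Re[OF lborel_pair.integrable_snd[OF h], symmetric])
  finally show ?thesis .
qed

text \<open>The inverse transform in the last variable, expressed through the forward transform at
  the reflected point so that \<open>plancherel\<close> and \<open>parseval\<close> apply
  directly.\<close>

definition inverse_partial_fourier :: "(real \<times> real \<Rightarrow> real \<Rightarrow> complex) \<Rightarrow> real \<times> real \<times> real \<Rightarrow> complex" where
  "inverse_partial_fourier H p = of_real (1 / (2 * pi)) * fourier (H (fst p, fst (snd p))) (- snd (snd p))"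

lemma borel_measurable_inverse_partial_fourier [measurable]:
  assumes [measurable]: "case_prod H \<in> borel_measurable (lborel \<Otimes>\<^sub>M lborel)"
  shows "inverse_partial_fourier H \<in> borel_measurable borel"
proof -
  have "(\<lambda>p. fourier (H (fst p, fst (snd p))) (- snd (snd p))) \<in> borel_measurable borel"
    by measurable
  then show ?thesis
    unfolding inverse_partial_fourier_def[abs_def] by measurable
qed

lemma nn_integral_inverse_partial_fourier:
  assumes H[measurable]: "case_prod H \<in> borel_measurable (lborel \<Otimes>\<^sub>M lborel)" and tame: "\<And>z. tame (H z)"
  shows "(\<integral>\<^sup>+p. ennreal ((cmod (inverse_partial_fourier H p))\<^sup>2) \<partial>lborel)
    = ennreal (1 / (2 * pi)) * (\<integral>\<^sup>+z. \<integral>\<^sup>+\<xi>. ennreal ((cmod (H z \<xi>))\<^sup>2) \<partial>lborel \<partial>lborel)"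
proof -
  have "(\<integral>\<^sup>+p. ennreal ((cmod (inverse_partial_fourier H p))\<^sup>2) \<partial>lborel)
      = (\<integral>\<^sup>+z. \<integral>\<^sup>+u. ennreal ((cmod (inverse_partial_fourier H (fst z, snd z, u)))\<^sup>2) \<partial>lborel \<partial>lborel)"
    by (rule nn_integral_triple) measurable
  also have "\<dots> = (\<integral>\<^sup>+z. ennreal (1 / (2 * pi)) * (\<integral>\<^sup>+\<xi>. ennreal ((cmod (H z \<xi>))\<^sup>2) \<partial>lborel) \<partial>lborel)"
  proof (rule nn_integral_cong)
    fix z
    have [measurable]: "H z \<in> borel_measurable borel"
      using tameD(2)[OF tame] .
    have "(\<integral>\<^sup>+u. ennreal ((cmod (inverse_partial_fourier H (fst z, snd z, u)))\<^sup>2) \<partial>lborel)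
        = (\<integral>\<^sup>+u. ennreal ((1 / (2 * pi))\<^sup>2) * ennreal ((cmod (fourier (H z) (- u)))\<^sup>2) \<partial>lborel)"
      by (simp add: inverse_partial_fourier_def norm_mult norm_divide power_mult_distrib power_divide flip: ennreal_mult)
    also have "\<dots> = ennreal ((1 / (2 * pi))\<^sup>2) * (\<integral>\<^sup>+u. ennreal ((cmod (fourier (H z) u))\<^sup>2) \<partial>lborel)"
      by (subst nn_integral_cmult) (simp_all add: nn_integral_reflect[of "\<lambda>u. ennreal ((cmod (fourier (H z) u))\<^sup>2)"])
    also have "\<dots> = ennreal ((1 / (2 * pi))\<^sup>2) * (ennreal (2 * pi) * (\<integral>\<^sup>+\<xi>. ennreal ((cmod (H z \<xi>))\<^sup>2) \<partial>lborel))"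
      by (simp only: nn_plancherel[OF tameD(1) tame_square_integrable, OF tame tame])
    also have "\<dots> = ennreal (1 / (2 * pi)) * (\<integral>\<^sup>+\<xi>. ennreal ((cmod (H z \<xi>))\<^sup>2) \<partial>lborel)"
      by (simp add: power2_eq_square flip: mult.assoc ennreal_mult)
    finally show "(\<integral>\<^sup>+u. ennreal ((cmod (inverse_partial_fourier H (fst z, snd z, u)))\<^sup>2) \<partial>lborel)
      = ennreal (1 / (2 * pi)) * (\<integral>\<^sup>+\<xi>. ennreal ((cmod (H z \<xi>))\<^sup>2) \<partial>lborel)" .
  qed
  also have "\<dots> = ennreal (1 / (2 * pi)) * (\<integral>\<^sup>+z. \<integral>\<^sup>+\<xi>. ennreal ((cmod (H z \<xi>))\<^sup>2) \<partial>lborel \<partial>lborel)"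
    by (rule nn_integral_cmult) measurable
  finally show ?thesis .
qed

lemma nn_integral_norm_square:
  "square_integrable f \<Longrightarrow> (\<integral>\<^sup>+x. ennreal ((cmod (f x))\<^sup>2) \<partial>lborel) = ennreal ((norm (L2_of f))\<^sup>2)"
  by (subst nn_integral_eq_integral) (simp_all add: square_integrable_def norm_L2_of)

lemma square_integrable_inverse_partial_fourier:
  assumes H: "case_prod H \<in> borel_measurable (lborel \<Otimes>\<^sub>M lborel)" "\<And>z. tame (H z)"
    and fin: "(\<integral>\<^sup>+z. \<integral>\<^sup>+\<xi>. ennreal ((cmod (H z \<xi>))\<^sup>2) \<partial>lborel \<partial>lborel) < \<infinity>"
  shows "square_integrable (inverse_partial_fourier H)"
proof -
  have [measurable]: "inverse_partial_fourier H \<in> borel_measurable borel"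
    by (rule borel_measurable_inverse_partial_fourier[OF H(1)])
  have "integrable lborel (\<lambda>p. (cmod (inverse_partial_fourier H p))\<^sup>2)"
    by (rule integrableI_bounded)
      (use fin in \<open>auto simp: nn_integral_inverse_partial_fourier[OF H] ennreal_mult_less_top\<close>)
  then show ?thesis
    by (simp add: square_integrable_def)
qed

lemma inner_inverse_partial_fourier:
  assumes H: "case_prod H \<in> borel_measurable (lborel \<Otimes>\<^sub>M lborel)" "\<And>z. tame (H z)"
      "(\<integral>\<^sup>+z. \<integral>\<^sup>+\<xi>. ennreal ((cmod (H z \<xi>))\<^sup>2) \<partial>lborel \<partial>lborel) < \<infinity>"
    and K: "case_prod K \<in> borel_measurable (lborel \<Otimes>\<^sub>M lborel)" "\<And>z. tame (K z)"
      "(\<integral>\<^sup>+z. \<integral>\<^sup>+\<xi>. ennreal ((cmod (K z \<xi>))\<^sup>2) \<partial>lborel \<partial>lborel) < \<infinity>"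
  shows "L2_of (inverse_partial_fourier H) \<bullet> L2_of (inverse_partial_fourier K)
    = 1 / (2 * pi) * (LINT z|lborel. LINT \<xi>|lborel. H z \<xi> \<bullet> K z \<xi>)"
proof -
  note si = square_integrable_inverse_partial_fourier[OF H] square_integrable_inverse_partial_fourier[OF K]
  have inner: "(LINT u|lborel. inverse_partial_fourier H (fst z, snd z, u) \<bullet> inverse_partial_fourier K (fst z, snd z, u))
      = 1 / (2 * pi) * (LINT \<xi>|lborel. H z \<xi> \<bullet> K z \<xi>)" for z
  proof -
    note t = H(2)[of z] K(2)[of z]
    note L = tameD(1)[OF t(1)] tame_square_integrable[OF t(1)] tameD(1)[OF t(2)] tame_square_integrable[OF t(2)]
    have "inverse_partial_fourier H (fst z, snd z, u) \<bullet> inverse_partial_fourier K (fst z, snd z, u)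
        = (1 / (2 * pi))\<^sup>2 * (fourier (H z) (0 + - 1 * u) \<bullet> fourier (K z) (0 + - 1 * u))" for u
      by (simp add: inverse_partial_fourier_def power2_eq_square flip: scaleR_conv_of_real of_real_divide)
    then have "(LINT u|lborel. inverse_partial_fourier H (fst z, snd z, u) \<bullet> inverse_partial_fourier K (fst z, snd z, u))
        = (1 / (2 * pi))\<^sup>2 * (LINT u|lborel. fourier (H z) u \<bullet> fourier (K z) u)"
      using lborel_integral_real_affine[of "- 1" "\<lambda>u. fourier (H z) u \<bullet> fourier (K z) u" 0] by simp
    also have "\<dots> = (1 / (2 * pi))\<^sup>2 * (2 * pi * (LINT \<xi>|lborel. H z \<xi> \<bullet> K z \<xi>))"
      using parseval[OF L] by (simp add: inner_L2_of L bessel(1))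
    finally show ?thesis by (simp add: power2_eq_square)
  qed
  have "L2_of (inverse_partial_fourier H) \<bullet> L2_of (inverse_partial_fourier K)
      = (LINT z|lborel. LINT u|lborel. inverse_partial_fourier H (fst z, snd z, u) \<bullet> inverse_partial_fourier K (fst z, snd z, u))"
    unfolding inner_L2_of[OF si] by (rule integral_triple[OF square_integrable_inner[OF si]])
  also have "\<dots> = 1 / (2 * pi) * (LINT z|lborel. LINT \<xi>|lborel. H z \<xi> \<bullet> K z \<xi>)"
    by (simp only: inner integral_mult_right_zero)
  finally show ?thesis .
qed

subsection \<open>The Leray transform on the Fourier side\<close>

text \<open>Two integrations by parts identify (1 + \<xi>^2) times the transform of f with the
  transform of f - f'', which is bounded by its supremum times the length of the support.\<close>

lemma fourier_decay:
  fixes f f' f'' :: "real \<Rightarrow> complex"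
  assumes f: "\<And>x. (f has_vector_derivative f' x) (at x)" "\<And>x. (f' has_vector_derivative f'' x) (at x)"
    and cont: "continuous_on UNIV f''"
    and supp: "\<And>x. \<bar>x\<bar> > R \<Longrightarrow> f x = 0 \<and> f' x = 0 \<and> f'' x = 0"
    and R: "R \<ge> 0" and M: "\<And>x. cmod (f x - f'' x) \<le> M"
  shows "cmod (fourier f \<xi>) \<le> 2 * R * M / (1 + \<xi>\<^sup>2)"
proof -
  have fc: "continuous_on UNIV f"
    using f(1) has_vector_derivative_continuous continuous_at_imp_continuous_on by blast
  have compact: "compact (closure {x. h x \<noteq> 0})" if "\<And>x. \<bar>x\<bar> > R \<Longrightarrow> h x = 0" for h :: "real \<Rightarrow> complex"
  proof -
    have "closure {x. h x \<noteq> 0} \<subseteq> {- R..R}"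
      by (rule closure_minimal) (use that in \<open>force simp: abs_le_iff not_less[symmetric]\<close>, simp)
    then show ?thesis
      using compact_closed_subset[OF compact_Icc closed_closure] by blast
  qed
  have fi: "integrable lborel f" "integrable lborel f''"
    using supp by (auto intro!: compact_support_integrable fc cont compact)
  \<comment> \<open>Both integrations by parts at once: the derivative of \<open>F\<close> is
    \<open>G\<close>, whose integral is the transform of f'' plus \<xi>^2 times that of f.\<close>
  define F where "F x = cis (- \<xi> * x) * (f' x + \<i> * of_real \<xi> * f x)" for x
  define G where "G x = cis (- \<xi> * x) * (f'' x + of_real (\<xi>\<^sup>2) * f x)" for x
  have cis_deriv: "((\<lambda>x. cis (- \<xi> * x)) has_vector_derivative (- \<i> * of_real \<xi> * cis (- \<xi> * x))) (at x within S)" for x S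
    unfolding cis_conv_exp
    by (rule has_vector_derivative_real_field derivative_eq_intros refl | simp)+
  have "(F has_vector_derivative cis (- \<xi> * x) * (f'' x + \<i> * of_real \<xi> * f' x)
      + (- \<i> * of_real \<xi> * cis (- \<xi> * x)) * (f' x + \<i> * of_real \<xi> * f x)) (at x within S)" for x S
    unfolding F_def
    by (intro has_vector_derivative_mult cis_deriv has_vector_derivative_add
        has_vector_derivative_mult_right has_vector_derivative_at_within[OF f(1)] has_vector_derivative_at_within[OF f(2)])
  moreover have "cis (- \<xi> * x) * (f'' x + \<i> * of_real \<xi> * f' x)
      + (- \<i> * of_real \<xi> * cis (- \<xi> * x)) * (f' x + \<i> * of_real \<xi> * f x) = G x" for x
    by (simp add: G_def algebra_simps power2_eq_square)
  ultimately have F: "(F has_vector_derivative G x) (at x within S)" for x S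
    by simp
  have Gc: "continuous_on S G" for S
    unfolding G_def by (intro continuous_intros continuous_on_subset[OF fc] continuous_on_subset[OF cont]) auto
  \<comment> \<open>The interval is widened by 1 because the functions are known to vanish only
    strictly beyond R; at these endpoints the boundary terms are zero.\<close>
  have "(LINT x|lborel. indicator {- R - 1..R + 1} x *\<^sub>R G x) = F (R + 1) - F (- R - 1)"
    using R by (intro integral_FTC_atLeastAtMost F Gc) simp
  also have "\<dots> = 0"
    using supp[of "R + 1"] supp[of "- R - 1"] R by (simp add: F_def)
  also have "(\<lambda>x. indicator {- R - 1..R + 1} x *\<^sub>R G x) = G"
  proof
    fix x
    show "indicator {- R - 1..R + 1} x *\<^sub>R G x = G x"
      using supp[of x] by (cases "\<bar>x\<bar> > R") (auto simp: G_def split: split_indicator)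
  qed
  finally have G0: "(LINT x|lborel. G x) = 0" .
  have ci: "integrable lborel (\<lambda>x. cis (- \<xi> * x) * f x)" "integrable lborel (\<lambda>x. cis (- \<xi> * x) * f'' x)"
    using fi by (auto intro!: integrable_cis_mult)
  have "(\<lambda>x. cis (- \<xi> * x) * (f x - f'' x)) = (\<lambda>x. of_real (1 + \<xi>\<^sup>2) * (cis (- \<xi> * x) * f x) - G x)"
    by (simp add: G_def fun_eq_iff algebra_simps)
  moreover have "integrable lborel G"
    using ci unfolding G_def distrib_left mult.left_commute[of "cis _"]
    by (intro Bochner_Integration.integrable_add integrable_mult_right)
  ultimately have "of_real (1 + \<xi>\<^sup>2) * fourier f \<xi> = (LINT x|lborel. cis (- \<xi> * x) * (f x - f'' x))"
    using ci G0 by (simp add: fourier_def)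
  also have "cmod \<dots> \<le> (LINT x|lborel. M * indicator {- R..R} x)"
  proof (rule order_trans[OF integral_norm_bound integral_mono])
    show "integrable lborel (\<lambda>x. cmod (cis (- \<xi> * x) * (f x - f'' x)))"
      using ci by (intro integrable_norm) (simp add: right_diff_distrib)
    show "integrable lborel (\<lambda>x. M * indicator {- R..R} x)"
      using R by (intro integrable_mult_right integrable_real_indicator) auto
    show "cmod (cis (- \<xi> * x) * (f x - f'' x)) \<le> M * indicator {- R..R} x" for x
      using M[of x] supp[of x] by (cases "\<bar>x\<bar> > R") (auto simp: norm_mult split: split_indicator)
  qed
  also have "\<dots> = 2 * R * M"
    using R by simp
  finally have "cmod (of_real (1 + \<xi>\<^sup>2) * fourier f \<xi>) \<le> 2 * R * M" .
  moreover have "cmod (of_real (1 + \<xi>\<^sup>2) * fourier f \<xi>) = (1 + \<xi>\<^sup>2) * cmod (fourier f \<xi>)"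
    by (simp only: norm_mult norm_of_real) simp
  moreover have "1 + \<xi>\<^sup>2 > 0"
    by (simp add: add_pos_nonneg)
  ultimately show ?thesis
    by (simp add: field_simps)
qed

lemma integrable_inverse_1_plus_square':
  "integrable lborel (\<lambda>\<xi>::real. 1 / (1 + \<xi>\<^sup>2))"
  using integrable_inverse_1_plus_square by (simp add: set_integrable_def inverse_eq_divide)

definition slice :: "(real \<times> real \<times> real \<Rightarrow> complex) \<Rightarrow> real \<times> real \<Rightarrow> real \<Rightarrow> complex" where
  "slice f \<zeta> x = f (fst \<zeta>, snd \<zeta>, x)"

lemma frechet_derivative_outside_support:
  assumes "x \<notin> closure {x. f x \<noteq> 0}"
  shows "frechet_derivative f (at x) v = 0"
proof -
  have "(f has_derivative (\<lambda>_. 0)) (at x)"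
  proof (rule has_derivative_transform_within_open[of "\<lambda>_. 0" _ _ _ "- closure {x. f x \<noteq> 0}"])
    show "0 = f y" if "y \<in> - closure {x. f x \<noteq> 0}" for y
      using that closure_subset[of "{x. f x \<noteq> 0}"] by auto
  qed (use assms in auto)
  then show ?thesis
    using frechet_derivative_at by metis
qed

text \<open>The point is uniformity: one R and one C serve all slices. The derivatives of a slice
  are the directional derivatives \<open>f1\<close>, \<open>f2\<close> of f along the last
  coordinate, which are supported in the same compact set, so a single bound of f - f2 feeds
  \<open>fourier_decay\<close>.\<close>

lemma test_function_slice:
  assumes f: "test_function f"
  obtains R C where "R \<ge> 0" "C \<ge> 0" "\<And>\<zeta> x. \<bar>x\<bar> > R \<Longrightarrow> slice f \<zeta> x = 0"
    "\<And>\<zeta> x. \<zeta> \<notin> cbox (- R, - R) (R, R) \<Longrightarrow> slice f \<zeta> x = 0"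
    "\<And>\<zeta> \<xi>. cmod (fourier (slice f \<zeta>) \<xi>) \<le> C / (1 + \<xi>\<^sup>2)"
proof -
  define e :: "real \<times> real \<times> real" where "e = (0, 0, 1)"
  define f1 where "f1 p = frechet_derivative f (at p) e" for p
  define f2 where "f2 p = frechet_derivative f1 (at p) e" for p
  have hd2: "higher_differentiable (Suc (Suc 0)) f" and K: "compact (closure {x. f x \<noteq> 0})"
    using f by (auto simp: test_function_def)
  have hd1: "higher_differentiable (Suc 0) f1"
    unfolding f1_def by (rule higher_differentiable_SucD(2)[OF hd2])
  have hd0: "higher_differentiable 0 f2"
    unfolding f2_def by (rule higher_differentiable_SucD(2)[OF hd1])
  have d: "(f has_derivative frechet_derivative f (at p)) (at p)" "(f1 has_derivative frechet_derivative f1 (at p)) (at p)" for p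
    using higher_differentiable_SucD(1)[OF hd2] higher_differentiable_SucD(1)[OF hd1] by auto
  have slice_deriv: "((\<lambda>x. g (fst \<zeta>, snd \<zeta>, x)) has_vector_derivative frechet_derivative g (at (fst \<zeta>, snd \<zeta>, x)) e) (at x)"
    if g: "\<And>p. (g has_derivative frechet_derivative g (at p)) (at p)" for g :: "real \<times> real \<times> real \<Rightarrow> complex" and \<zeta> x
  proof -
    have "((\<lambda>x. (fst \<zeta>, snd \<zeta>, x)) has_derivative (\<lambda>h. (0, 0, h))) (at x)"
      by (auto intro!: derivative_eq_intros)
    then have "((\<lambda>x. g (fst \<zeta>, snd \<zeta>, x)) has_derivative (\<lambda>h. frechet_derivative g (at (fst \<zeta>, snd \<zeta>, x)) (0, 0, h))) (at x)"
      by (rule has_derivative_compose[OF _ g])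
    moreover have "frechet_derivative g (at p) (0, 0, h) = h *\<^sub>R frechet_derivative g (at p) e" for p h
      using linear_scale[OF has_derivative_linear[OF g[of p]], of h e] by (simp add: e_def)
    ultimately show ?thesis
      by (simp add: has_vector_derivative_def)
  qed
  obtain R where R: "R > 0" "\<And>p. p \<in> closure {x. f x \<noteq> 0} \<Longrightarrow> norm p \<le> R"
    using compact_imp_bounded[OF K] by (auto simp: bounded_pos)
  have out: "f p = 0 \<and> f1 p = 0 \<and> f2 p = 0" if p: "p \<notin> closure {x. f x \<noteq> 0}" for p
  proof -
    have f0: "f q = 0 \<and> f1 q = 0" if "q \<notin> closure {x. f x \<noteq> 0}" for q
      using that closure_subset[of "{x. f x \<noteq> 0}"] frechet_derivative_outside_support[of q f]
      by (auto simp: f1_def)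
    have "{x. f1 x \<noteq> 0} \<subseteq> closure {x. f x \<noteq> 0}"
      using f0 by blast
    then have "closure {x. f1 x \<noteq> 0} \<subseteq> closure {x. f x \<noteq> 0}"
      by (rule closure_minimal) simp
    with p have "f2 p = 0"
      unfolding f2_def by (intro frechet_derivative_outside_support) auto
    with f0[OF p] show ?thesis by simp
  qed
  have comp: "\<bar>x\<bar> \<le> norm p" "\<bar>y\<bar> \<le> norm p" "\<bar>u\<bar> \<le> norm p" if "p = (x, y, u)" for p :: "real \<times> real \<times> real" and x y u
    using norm_fst_le[of x "(y, u)"] norm_snd_le[of "(y, u)" x] norm_fst_le[of y u] norm_snd_le[of u y] that
    by auto
  have out1: "f (x, y, u) = 0 \<and> f1 (x, y, u) = 0 \<and> f2 (x, y, u) = 0" if "\<bar>x\<bar> > R \<or> \<bar>y\<bar> > R \<or> \<bar>u\<bar> > R" for x y u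
    by (rule out) (use that comp[of "(x, y, u)" x y u] R(2)[of "(x, y, u)"] in auto)
  have cont: "continuous_on UNIV f" "continuous_on UNIV f2"
    using test_function_continuous[OF f] hd0 by auto
  have "compact (closure {p. f p - f2 p \<noteq> 0})"
  proof -
    have "{p. f p - f2 p \<noteq> 0} \<subseteq> closure {x. f x \<noteq> 0}"
    proof (rule subsetI, rule ccontr)
      fix p assume "p \<in> {p. f p - f2 p \<noteq> 0}" "p \<notin> closure {x. f x \<noteq> 0}"
      with out[of p] show False by simp
    qed
    then have "closure {p. f p - f2 p \<noteq> 0} \<subseteq> closure {x. f x \<noteq> 0}"
      by (rule closure_minimal) simp
    then show ?thesis
      using compact_closed_subset[OF K closed_closure] by blast
  qed
  then obtain M where M: "M \<ge> 0" "\<And>p. cmod (f p - f2 p) \<le> M * indicator (closure {p. f p - f2 p \<noteq> 0}) p"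
    using compact_support_bounded[of "\<lambda>p. f p - f2 p"] cont by (auto intro: continuous_intros)
  have M': "cmod (f p - f2 p) \<le> M" for p
    using M(2)[of p] M(1) by (auto split: split_indicator_asm)
  show ?thesis
  proof (rule that[of R "2 * R * M"])
    show "slice f \<zeta> x = 0" if "\<bar>x\<bar> > R" for \<zeta> x
      using out1 that by (simp add: slice_def)
    show "slice f \<zeta> x = 0" if "\<zeta> \<notin> cbox (- R, - R) (R, R)" for \<zeta> x
      using out1[of "fst \<zeta>" "snd \<zeta>" x] that by (cases \<zeta>) (force simp: slice_def cbox_Pair_eq abs_le_iff not_less[symmetric])
    show "cmod (fourier (slice f \<zeta>) \<xi>) \<le> 2 * R * M / (1 + \<xi>\<^sup>2)" for \<zeta> \<xi>
    proof (rule fourier_decay)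
      show "(slice f \<zeta> has_vector_derivative f1 (fst \<zeta>, snd \<zeta>, x)) (at x)" for x
        unfolding slice_def[abs_def] f1_def by (rule slice_deriv[OF d(1)])
      show "((\<lambda>x. f1 (fst \<zeta>, snd \<zeta>, x)) has_vector_derivative f2 (fst \<zeta>, snd \<zeta>, x)) (at x)" for x
        unfolding f2_def by (rule slice_deriv[OF d(2)])
      show "continuous_on UNIV (\<lambda>x. f2 (fst \<zeta>, snd \<zeta>, x))"
        by (rule continuous_on_compose2[OF cont(2)]) (auto intro!: continuous_intros)
    qed (use out1 M' R in \<open>auto simp: slice_def\<close>)
  qed (use R M in auto)
qed

text \<open>The Laplace transform of the identity function at a point with positive real part.
  Absolute integrability is read off from the Erlang density of shape 2; the value comes from an
  antiderivative on growing intervals.\<close>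

lemma laplace_square:
  fixes \<phi> \<sigma> :: real
  assumes \<phi>: "\<phi> > 0"
  shows "integrable lborel (\<lambda>\<xi>. indicator {0<..} \<xi> * (\<xi> * exp (- \<phi> * \<xi>)))"
    and "(LINT \<xi>|lborel. indicator {0<..} \<xi> *\<^sub>R (of_real (\<xi> * exp (- \<phi> * \<xi>)) * cis (- \<sigma> * \<xi>))) = 1 / (Complex \<phi> \<sigma>)\<^sup>2"
proof -
  show i: "integrable lborel (\<lambda>\<xi>. indicator {0<..} \<xi> * (\<xi> * exp (- \<phi> * \<xi>)))"
  proof -
    have "(\<integral>\<^sup>+ x. ennreal (erlang_density 1 \<phi> x) \<partial>lborel) = 1"
      using nn_integral_erlang_ith_moment[OF \<phi>, of 1 0] by simp
    then have "integrable lborel (erlang_density 1 \<phi>)"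
      using \<phi> by (intro integrableI_nonneg) auto
    then have "integrable lborel (\<lambda>\<xi>. 1 / \<phi>\<^sup>2 * erlang_density 1 \<phi> \<xi>)"
      by (rule integrable_mult_right)
    moreover have "1 / \<phi>\<^sup>2 * erlang_density 1 \<phi> \<xi> = indicator {0<..} \<xi> * (\<xi> * exp (- \<phi> * \<xi>))" for \<xi>
      using \<phi> by (auto simp: erlang_density_def power2_eq_square split: split_indicator)
    ultimately show ?thesis by simp
  qed
  define s where "s = Complex \<phi> \<sigma>"
  have s0: "s \<noteq> 0" using \<phi> by (auto simp: s_def complex_eq_iff)
  define g where "g \<xi> = of_real \<xi> * exp (- s * of_real \<xi>)" for \<xi> :: real
  \<comment> \<open>The antiderivative of \<open>g\<close> from one integration by parts; it
    vanishes at infinity since the real part of \<open>s\<close> is positive, and \<open>F 0\<close>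
    is - 1 / s^2.\<close>
  define F where "F \<xi> = - (of_real \<xi> / s + 1 / s\<^sup>2) * exp (- s * of_real \<xi>)" for \<xi> :: real
  have g: "g \<xi> = of_real (\<xi> * exp (- \<phi> * \<xi>)) * cis (- \<sigma> * \<xi>)" for \<xi>
    by (simp add: g_def exp_eq_polar s_def)
  have norm_g: "cmod (indicator {0<..} \<xi> *\<^sub>R g \<xi>) = indicator {0<..} \<xi> * (\<xi> * exp (- \<phi> * \<xi>))" for \<xi>
    by (auto simp: g norm_mult split: split_indicator)
  have [measurable]: "g \<in> borel_measurable borel"
    unfolding g[abs_def] by measurable
  have deriv: "(F has_vector_derivative g \<xi>) (at \<xi> within S)" for \<xi> S
    unfolding F_def g_def
    by (rule has_vector_derivative_real_field)
      (use s0 in \<open>auto intro!: derivative_eq_intros simp: field_simps power2_eq_square\<close>)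
  have "(\<lambda>n. LINT \<xi>|lborel. indicator {0..real n} \<xi> *\<^sub>R g \<xi>) \<longlonglongrightarrow> (LINT \<xi>|lborel. indicator {0<..} \<xi> *\<^sub>R g \<xi>)"
  proof (rule integral_dominated_convergence[OF _ _ i])
    show "AE \<xi> in lborel. (\<lambda>n. indicator {0..real n} \<xi> *\<^sub>R g \<xi>) \<longlonglongrightarrow> indicator {0<..} \<xi> *\<^sub>R g \<xi>"
    proof (rule AE_I2)
      fix \<xi> :: real
      have "\<forall>\<^sub>F n in sequentially. indicator {0..real n} \<xi> *\<^sub>R g \<xi> = indicator {0<..} \<xi> *\<^sub>R g \<xi>"
        using eventually_ge_at_top[of "nat \<lceil>\<xi>\<rceil>"]
      proof eventually_elim
        case (elim n)
        then have "\<xi> \<le> real n" by linarith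
        then show ?case by (auto simp: g_def split: split_indicator)
      qed
      then show "(\<lambda>n. indicator {0..real n} \<xi> *\<^sub>R g \<xi>) \<longlonglongrightarrow> indicator {0<..} \<xi> *\<^sub>R g \<xi>"
        by (rule tendsto_eventually)
    qed
    show "AE \<xi> in lborel. norm (indicator {0..real n} \<xi> *\<^sub>R g \<xi>) \<le> indicator {0<..} \<xi> * (\<xi> * exp (- \<phi> * \<xi>))" for n
      by (rule AE_I2) (auto simp: g norm_mult split: split_indicator)
  qed measurable
  moreover have "(LINT \<xi>|lborel. indicator {0..real n} \<xi> *\<^sub>R g \<xi>) = F (real n) - F 0" for n
    by (rule integral_FTC_atLeastAtMost[OF _ deriv]) (auto simp: g_def intro!: continuous_intros)
  moreover have "(\<lambda>n. F (real n) - F 0) \<longlonglongrightarrow> 0 - F 0"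
  proof (intro tendsto_diff tendsto_const)
    have top: "filterlim (\<lambda>n. \<phi> * real n) at_top sequentially"
      using \<phi> by (intro filterlim_tendsto_pos_mult_at_top[OF tendsto_const] filterlim_real_sequentially)
    have "(\<lambda>n. exp (- (\<phi> * real n))) \<longlonglongrightarrow> 0"
      using top by (intro filterlim_compose[OF exp_at_bot]) (simp add: filterlim_uminus_at_bot)
    then have l1: "(\<lambda>n. exp (- \<phi> * real n)) \<longlonglongrightarrow> 0"
      by simp
    have "((\<lambda>x::real. x ^ 1 / exp x) \<longlongrightarrow> 0) at_top"
      by (rule tendsto_power_div_exp_0)
    from this top have "(\<lambda>n. (\<phi> * real n) ^ 1 / exp (\<phi> * real n)) \<longlonglongrightarrow> 0"
      by (rule filterlim_compose)
    then have "(\<lambda>n. 1 / \<phi> * ((\<phi> * real n) ^ 1 / exp (\<phi> * real n))) \<longlonglongrightarrow> 0"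
      by (rule tendsto_mult_right_zero)
    moreover have "1 / \<phi> * ((\<phi> * real n) ^ 1 / exp (\<phi> * real n)) = real n * exp (- \<phi> * real n)" for n
      using \<phi> by (simp add: exp_minus field_simps)
    ultimately have l2: "(\<lambda>n. real n * exp (- \<phi> * real n)) \<longlonglongrightarrow> 0"
      by simp
    have "(\<lambda>n. 1 / cmod s * (real n * exp (- \<phi> * real n)) + 1 / cmod (s\<^sup>2) * exp (- \<phi> * real n)) \<longlonglongrightarrow> 1 / cmod s * 0 + 1 / cmod (s\<^sup>2) * 0"
      by (intro tendsto_intros l1 l2)
    then have lim: "(\<lambda>n. 1 / cmod s * (real n * exp (- \<phi> * real n)) + 1 / cmod (s\<^sup>2) * exp (- \<phi> * real n)) \<longlonglongrightarrow> 0"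
      by simp
    show "(\<lambda>n. F (real n)) \<longlonglongrightarrow> 0"
    proof (rule Lim_null_comparison[OF always_eventually lim], rule allI)
      fix n
      have "cmod (F (real n)) = cmod (of_real (real n) / s + 1 / s\<^sup>2) * exp (- \<phi> * real n)"
        by (simp add: F_def norm_mult s_def norm_minus_cancel del: minus_add_distrib)
      also have "\<dots> \<le> (cmod (of_real (real n) / s) + cmod (1 / s\<^sup>2)) * exp (- \<phi> * real n)"
        by (intro mult_right_mono norm_triangle_ineq) simp
      also have "\<dots> = 1 / cmod s * (real n * exp (- \<phi> * real n)) + 1 / cmod (s\<^sup>2) * exp (- \<phi> * real n)"
        by (simp add: norm_divide distrib_right)
      finally show "cmod (F (real n)) \<le> 1 / cmod s * (real n * exp (- \<phi> * real n)) + 1 / cmod (s\<^sup>2) * exp (- \<phi> * real n)" .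
    qed
  qed
  ultimately have "(LINT \<xi>|lborel. indicator {0<..} \<xi> *\<^sub>R g \<xi>) = 0 - F 0"
    by (simp add: LIMSEQ_unique)
  then show "(LINT \<xi>|lborel. indicator {0<..} \<xi> *\<^sub>R (of_real (\<xi> * exp (- \<phi> * \<xi>)) * cis (- \<sigma> * \<xi>))) = 1 / (Complex \<phi> \<sigma>)\<^sup>2"
    by (simp add: g F_def s_def)
qed

lemma borel_measurable_slice [measurable (raw)]:
  assumes [measurable]: "h \<in> borel_measurable borel"
    and [measurable]: "\<zeta> \<in> borel_measurable M" "x \<in> borel_measurable M"
  shows "(\<lambda>p. slice h (\<zeta> p) (x p)) \<in> borel_measurable M"
  unfolding slice_def by measurable

text \<open>Scaling: the prefactor \<xi> compensates the area of a Gaussian of width 1 / sqrt \<xi>.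
  The resulting independence of \<xi> is what lets the decay of the slices control the frequency
  integral.\<close>

lemma nn_integral_leray_kernel:
  assumes ab: "a > 0" "b > 0" and \<xi>: "\<xi> > 0"
  shows "(\<integral>\<^sup>+w. ennreal (cmod (leray_kernel a b \<xi> z w)) \<partial>lborel) = ennreal (2 / sqrt (a * b))"
    and "(\<integral>\<^sup>+z. ennreal (cmod (leray_kernel a b \<xi> z w)) \<partial>lborel) = ennreal (2 / sqrt (a * b))"
proof -
  have "2 * \<xi> / pi * (sqrt (pi / (\<xi> * a)) * sqrt (pi / (\<xi> * b))) = 2 / sqrt (a * b)"
  proof -
    have "sqrt (pi / (\<xi> * a)) * sqrt (pi / (\<xi> * b)) = sqrt ((pi / \<xi>)\<^sup>2 / (a * b))"
      by (simp add: power2_eq_square field_simps flip: real_sqrt_mult)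
    also have "\<dots> = pi / \<xi> / sqrt (a * b)"
      using \<xi> by (simp add: real_sqrt_divide)
    finally show ?thesis
      using \<xi> by simp
  qed
  moreover have "cmod (leray_kernel a b \<xi> z w)
      = 2 * \<xi> / pi * (exp (- (\<xi> * a) * (fst w - fst z)\<^sup>2) * exp (- (\<xi> * b) * (snd w - snd z)\<^sup>2))" for z w
    using \<xi> by (simp add: norm_leray_kernel algebra_simps flip: exp_add)
  moreover from this have "cmod (leray_kernel a b \<xi> z w)
      = 2 * \<xi> / pi * (exp (- (\<xi> * a) * (fst z - fst w)\<^sup>2) * exp (- (\<xi> * b) * (snd z - snd w)\<^sup>2))" for z w
    by (simp add: power2_commute)
  ultimately show "(\<integral>\<^sup>+w. ennreal (cmod (leray_kernel a b \<xi> z w)) \<partial>lborel) = ennreal (2 / sqrt (a * b))"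
      "(\<integral>\<^sup>+z. ennreal (cmod (leray_kernel a b \<xi> z w)) \<partial>lborel) = ennreal (2 / sqrt (a * b))"
    using nn_integral_gaussian_pair[of "\<xi> * a" "\<xi> * b" "2 * \<xi> / pi"] ab \<xi> by simp_all
qed

lemma norm_kernel_op_le:
  assumes \<kappa>: "schur_kernel \<kappa>" and g: "tame g" and M: "\<And>w. cmod (g w) \<le> M"
    and C: "(\<integral>\<^sup>+w. ennreal (cmod (\<kappa> z w)) \<partial>lborel) \<le> ennreal C" "C \<ge> 0"
  shows "cmod (kernel_op \<kappa> g z) \<le> M * C"
proof -
  have M0: "M \<ge> 0"
    using M norm_ge_zero order_trans by blast
  have [measurable]: "case_prod \<kappa> \<in> borel_measurable (lborel \<Otimes>\<^sub>M lborel)"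
    by (rule schur_kernelD[OF \<kappa>])
  have "ennreal (cmod (kernel_op \<kappa> g z)) \<le> (\<integral>\<^sup>+w. ennreal (cmod (\<kappa> z w * g w)) \<partial>lborel)"
    unfolding kernel_op_def by (rule integral_norm_bound_ennreal[OF integrable_kernel_mult[OF \<kappa> g]])
  also have "\<dots> \<le> (\<integral>\<^sup>+w. ennreal M * ennreal (cmod (\<kappa> z w)) \<partial>lborel)"
  proof (intro nn_integral_mono)
    fix w
    have "cmod (\<kappa> z w) * cmod (g w) \<le> cmod (\<kappa> z w) * M"
      by (intro mult_left_mono M) simp
    then show "ennreal (cmod (\<kappa> z w * g w)) \<le> ennreal M * ennreal (cmod (\<kappa> z w))"
      using M0 by (simp add: norm_mult mult.commute flip: ennreal_mult)
  qed
  also have "\<dots> = ennreal M * (\<integral>\<^sup>+w. ennreal (cmod (\<kappa> z w)) \<partial>lborel)"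
    by (rule nn_integral_cmult) measurable
  also have "\<dots> \<le> ennreal M * ennreal C"
    by (intro mult_left_mono C) simp
  finally show ?thesis
    using M0 C(2) by (simp flip: ennreal_mult)
qed

text \<open>The candidate for the partial Fourier transform of the Leray transform. The cutoff to
  positive frequencies reflects the Laplace representation, which contains no others.\<close>

definition fourier_leray :: "real \<Rightarrow> real \<Rightarrow> (real \<times> real \<times> real \<Rightarrow> complex) \<Rightarrow> real \<times> real \<Rightarrow> real \<Rightarrow> complex" where
  "fourier_leray a b h z \<xi> =
     indicator {0<..} \<xi> *\<^sub>R kernel_op (leray_kernel a b \<xi>) (\<lambda>\<zeta>. fourier (slice h \<zeta>) \<xi>) z"

lemma test_function_measurable: "test_function (h :: 'a::euclidean_space \<Rightarrow> complex) \<Longrightarrow> h \<in> borel_measurable borel"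
  using borel_measurable_continuous_onI test_function_continuous by blast

section \<open>Measurability, decay and norm bounds on the Fourier side\<close>

lemma borel_measurable_fourier_leray:
  assumes "test_function h"
  shows "case_prod (fourier_leray a b h) \<in> borel_measurable (lborel \<Otimes>\<^sub>M lborel)"
proof -
  have [measurable]: "h \<in> borel_measurable borel"
    by (rule test_function_measurable[OF assms])
  show ?thesis
    unfolding fourier_leray_def kernel_op_def by measurable
qed

lemma tame_slice:
  assumes h: "test_function h"
  shows "tame (slice h \<zeta>)"
proof -
  obtain R C where R: "R \<ge> 0" "\<And>\<zeta> x. \<bar>x\<bar> > R \<Longrightarrow> slice h \<zeta> x = 0"
    by (rule test_function_slice[OF h]) blast
  have [measurable]: "h \<in> borel_measurable borel"
    by (rule test_function_measurable[OF h])
  obtain B where B: "B \<ge> 0" "\<And>p. cmod (h p) \<le> B * indicator (closure {x. h x \<noteq> 0}) p"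
    using compact_support_bounded[OF test_function_continuous[OF h]] h unfolding test_function_def by blast
  have B': "cmod (slice h \<zeta> x) \<le> B" for x
    using B(2)[of "(fst \<zeta>, snd \<zeta>, x)"] B(1) by (auto simp: slice_def split: split_indicator_asm)
  have "integrable lborel (slice h \<zeta>)"
  proof (rule Bochner_Integration.integrable_bound)
    show "integrable lborel (\<lambda>x. B * indicator {- R..R} x)"
      using R by (intro integrable_mult_right integrable_real_indicator) auto
    show "AE x in lborel. norm (slice h \<zeta> x) \<le> norm (B * indicator {- R..R} x)"
    proof (rule AE_I2)
      fix x
      show "norm (slice h \<zeta> x) \<le> norm (B * indicator {- R..R} x)"
        using R(2)[of x \<zeta>] B'[of x] B(1) by (cases "\<bar>x\<bar> > R") (auto simp: indicator_def)
    qed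
  qed measurable
  then show ?thesis
    using B' by (auto simp: tame_def bounded_iff)
qed

lemma tame_fourier_slice:
  assumes h: "test_function h"
  shows "tame (\<lambda>\<zeta>. fourier (slice h \<zeta>) \<xi>)"
proof -
  obtain R C where R: "\<And>\<zeta> x. \<zeta> \<notin> cbox (- R, - R) (R, R) \<Longrightarrow> slice h \<zeta> x = 0"
    and C: "C \<ge> 0" "\<And>\<zeta> \<xi>. cmod (fourier (slice h \<zeta>) \<xi>) \<le> C / (1 + \<xi>\<^sup>2)"
    by (rule test_function_slice[OF h]) blast
  have [measurable]: "h \<in> borel_measurable borel"
    by (rule test_function_measurable[OF h])
  have out: "fourier (slice h \<zeta>) \<xi> = 0" if "\<zeta> \<notin> cbox (- R, - R) (R, R)" for \<zeta>
    using R[OF that] by (simp add: fourier_def)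
  have "integrable lborel (\<lambda>\<zeta>. fourier (slice h \<zeta>) \<xi>)"
  proof (rule Bochner_Integration.integrable_bound)
    have "emeasure lborel (cbox (- R, - R) (R, R)) < \<infinity>"
      by (rule emeasure_lborel_cbox_finite)
    then show "integrable lborel (\<lambda>\<zeta>. C / (1 + \<xi>\<^sup>2) * indicator (cbox (- R, - R) (R, R)) \<zeta>)"
      by (intro integrable_mult_right integrable_real_indicator) auto
    show "AE \<zeta> in lborel. norm (fourier (slice h \<zeta>) \<xi>) \<le> norm (C / (1 + \<xi>\<^sup>2) * indicator (cbox (- R, - R) (R, R)) \<zeta>)"
      using C out by (intro AE_I2) (simp add: indicator_def order_trans[OF C(2) abs_ge_self])
  qed measurable
  then show ?thesis
    using C(2) by (auto simp: tame_def bounded_iff)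
qed

text \<open>The decay is uniform in z, since the kernel mass does not depend on z or \<xi>. It makes
  each fibre integrable in \<xi>, so the inverse transform is an ordinary integral.\<close>

lemma fourier_leray_bound:
  assumes h: "test_function h" and ab: "a > 0" "b > 0" "a + b = 2"
  obtains K where "K \<ge> 0" "\<And>z \<xi>. cmod (fourier_leray a b h z \<xi>) \<le> K / (1 + \<xi>\<^sup>2)"
proof -
  obtain R C where C: "C \<ge> 0" "\<And>\<zeta> \<xi>. cmod (fourier (slice h \<zeta>) \<xi>) \<le> C / (1 + \<xi>\<^sup>2)"
    by (rule test_function_slice[OF h]) blast
  show ?thesis
  proof (rule that)
    show "0 \<le> C * (2 / sqrt (a * b))"
      using C ab by simp
    show "cmod (fourier_leray a b h z \<xi>) \<le> C * (2 / sqrt (a * b)) / (1 + \<xi>\<^sup>2)" for z \<xi>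
    proof (cases "\<xi> > 0")
      case True
      interpret coisometric_kernel "leray_kernel a b \<xi>" "szego_kernel a b \<xi>" "1 / sqrt (a * b)"
        by (rule coisometric_leray_kernel[OF ab True])
      have "cmod (kernel_op (leray_kernel a b \<xi>) (\<lambda>\<zeta>. fourier (slice h \<zeta>) \<xi>) z) \<le> C / (1 + \<xi>\<^sup>2) * (2 / sqrt (a * b))"
        using ab True by (intro norm_kernel_op_le T tame_fourier_slice h C) (simp_all add: nn_integral_leray_kernel)
      with True show ?thesis
        by (simp add: fourier_leray_def mult.commute)
    qed (use C ab in \<open>simp add: fourier_leray_def\<close>)
  qed
qed

lemma tame_fourier_leray:
  assumes h: "test_function h" and ab: "a > 0" "b > 0" "a + b = 2"
  shows "tame (fourier_leray a b h z)"
proof -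
  obtain K where K: "K \<ge> 0" "\<And>z \<xi>. cmod (fourier_leray a b h z \<xi>) \<le> K / (1 + \<xi>\<^sup>2)"
    by (rule fourier_leray_bound[OF assms]) blast
  have [measurable]: "case_prod (fourier_leray a b h) \<in> borel_measurable (lborel \<Otimes>\<^sub>M lborel)"
    by (rule borel_measurable_fourier_leray[OF h])
  have "integrable lborel (fourier_leray a b h z)"
  proof (rule Bochner_Integration.integrable_bound)
    show "integrable lborel (\<lambda>\<xi>. K * (1 / (1 + \<xi>\<^sup>2)))"
      by (rule integrable_mult_right[OF integrable_inverse_1_plus_square'])
    show "AE \<xi> in lborel. norm (fourier_leray a b h z \<xi>) \<le> norm (K * (1 / (1 + \<xi>\<^sup>2)))"
      using K by (intro AE_I2) (simp add: order_trans[OF K(2) abs_ge_self])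
  qed measurable
  moreover have "cmod (fourier_leray a b h z \<xi>) \<le> K" for \<xi>
  proof -
    have "K / (1 + \<xi>\<^sup>2) \<le> K / 1"
      using K(1) by (intro divide_left_mono) (auto intro: add_pos_nonneg)
    with K(2)[of z \<xi>] show ?thesis by simp
  qed
  ultimately show ?thesis
    by (auto simp: tame_def bounded_iff)
qed

text \<open>The operator bound is applied at each fixed frequency and integrated; Plancherel on the
  slices then returns to h. Its factor 2 pi is cancelled by the normalisation of
  \<open>inverse_partial_fourier\<close>.\<close>

lemma nn_integral_fourier_leray_le:
  assumes h: "test_function h" and ab: "a > 0" "b > 0" "a + b = 2"
  shows "(\<integral>\<^sup>+z. \<integral>\<^sup>+\<xi>. ennreal ((cmod (fourier_leray a b h z \<xi>))\<^sup>2) \<partial>lborel \<partial>lborel)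
    \<le> ennreal (1 / sqrt (a * b)) * (ennreal (2 * pi) * (\<integral>\<^sup>+p. ennreal ((cmod (h p))\<^sup>2) \<partial>lborel))"
proof -
  have [measurable]: "case_prod (fourier_leray a b h) \<in> borel_measurable (lborel \<Otimes>\<^sub>M lborel)"
    "h \<in> borel_measurable borel"
    by (rule borel_measurable_fourier_leray[OF h] test_function_measurable[OF h])+
  have fiber: "(\<integral>\<^sup>+z. ennreal ((cmod (fourier_leray a b h z \<xi>))\<^sup>2) \<partial>lborel)
      \<le> ennreal (1 / sqrt (a * b)) * (\<integral>\<^sup>+\<zeta>. ennreal ((cmod (fourier (slice h \<zeta>) \<xi>))\<^sup>2) \<partial>lborel)" for \<xi>
  proof (cases "\<xi> > 0")
    case True
    interpret coisometric_kernel "leray_kernel a b \<xi>" "szego_kernel a b \<xi>" "1 / sqrt (a * b)"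
      by (rule coisometric_leray_kernel[OF ab True])
    let ?f = "\<lambda>\<zeta>. fourier (slice h \<zeta>) \<xi>"
    have t: "tame ?f" "tame (kernel_op (leray_kernel a b \<xi>) ?f)"
      using tame_fourier_slice[OF h] tame_kernel_op[OF T] by auto
    have "(\<integral>\<^sup>+z. ennreal ((cmod (fourier_leray a b h z \<xi>))\<^sup>2) \<partial>lborel)
        = ennreal ((norm (L2_of (kernel_op (leray_kernel a b \<xi>) ?f)))\<^sup>2)"
      using True by (simp add: fourier_leray_def nn_integral_norm_square tame_square_integrable t)
    also have "\<dots> \<le> ennreal (1 / sqrt (a * b) * (norm (L2_of ?f))\<^sup>2)"
      by (intro ennreal_leI norm_T_square_le t)
    also have "\<dots> = ennreal (1 / sqrt (a * b)) * (\<integral>\<^sup>+\<zeta>. ennreal ((cmod (?f \<zeta>))\<^sup>2) \<partial>lborel)"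
      unfolding nn_integral_norm_square[OF tame_square_integrable[OF t(1)]] by (rule ennreal_mult[OF c]) simp
    finally show ?thesis .
  qed (simp add: fourier_leray_def)
  have "(\<integral>\<^sup>+z. \<integral>\<^sup>+\<xi>. ennreal ((cmod (fourier_leray a b h z \<xi>))\<^sup>2) \<partial>lborel \<partial>lborel)
      = (\<integral>\<^sup>+\<xi>. \<integral>\<^sup>+z. ennreal ((cmod (fourier_leray a b h z \<xi>))\<^sup>2) \<partial>lborel \<partial>lborel)"
    by (rule lborel_pair.Fubini'[symmetric]) measurable
  also have "\<dots> \<le> (\<integral>\<^sup>+\<xi>. ennreal (1 / sqrt (a * b)) * (\<integral>\<^sup>+\<zeta>. ennreal ((cmod (fourier (slice h \<zeta>) \<xi>))\<^sup>2) \<partial>lborel) \<partial>lborel)"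
    by (intro nn_integral_mono fiber)
  also have "\<dots> = ennreal (1 / sqrt (a * b)) * (\<integral>\<^sup>+\<xi>. \<integral>\<^sup>+\<zeta>. ennreal ((cmod (fourier (slice h \<zeta>) \<xi>))\<^sup>2) \<partial>lborel \<partial>lborel)"
    by (rule nn_integral_cmult) measurable
  also have "(\<integral>\<^sup>+\<xi>. \<integral>\<^sup>+\<zeta>. ennreal ((cmod (fourier (slice h \<zeta>) \<xi>))\<^sup>2) \<partial>lborel \<partial>lborel)
      = (\<integral>\<^sup>+\<zeta>. \<integral>\<^sup>+\<xi>. ennreal ((cmod (fourier (slice h \<zeta>) \<xi>))\<^sup>2) \<partial>lborel \<partial>lborel)"
    by (rule lborel_pair.Fubini') measurable
  also have "\<dots> = (\<integral>\<^sup>+\<zeta>. ennreal (2 * pi) * (\<integral>\<^sup>+x. ennreal ((cmod (slice h \<zeta> x))\<^sup>2) \<partial>lborel) \<partial>lborel)"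
    by (intro nn_integral_cong nn_plancherel tameD tame_square_integrable tame_slice h)
  also have "\<dots> = ennreal (2 * pi) * (\<integral>\<^sup>+\<zeta>. \<integral>\<^sup>+x. ennreal ((cmod (slice h \<zeta> x))\<^sup>2) \<partial>lborel \<partial>lborel)"
    by (rule nn_integral_cmult) measurable
  also have "(\<integral>\<^sup>+\<zeta>. \<integral>\<^sup>+x. ennreal ((cmod (slice h \<zeta> x))\<^sup>2) \<partial>lborel \<partial>lborel) = (\<integral>\<^sup>+p. ennreal ((cmod (h p))\<^sup>2) \<partial>lborel)"
    unfolding slice_def by (rule nn_integral_triple[symmetric]) measurable
  finally show ?thesis .
qed

lemma inverse_partial_fourier_leray:
  assumes h: "test_function h" and ab: "a > 0" "b > 0" "a + b = 2"
  shows "square_integrable (inverse_partial_fourier (fourier_leray a b h))"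
    and "(norm (L2_of (inverse_partial_fourier (fourier_leray a b h))))\<^sup>2 \<le> 1 / sqrt (a * b) * (norm (L2_of h))\<^sup>2"
    and "(\<integral>\<^sup>+z. \<integral>\<^sup>+\<xi>. ennreal ((cmod (fourier_leray a b h z \<xi>))\<^sup>2) \<partial>lborel \<partial>lborel) < \<infinity>"
proof -
  note hs = test_function_square_integrable[OF h]
  note F = borel_measurable_fourier_leray[OF h] tame_fourier_leray[OF assms]
  have c: "1 / sqrt (a * b) \<ge> 0" using ab by simp
  have le: "(\<integral>\<^sup>+z. \<integral>\<^sup>+\<xi>. ennreal ((cmod (fourier_leray a b h z \<xi>))\<^sup>2) \<partial>lborel \<partial>lborel)
      \<le> ennreal (1 / sqrt (a * b)) * (ennreal (2 * pi) * ennreal ((norm (L2_of h))\<^sup>2))"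
    using nn_integral_fourier_leray_le[OF assms] by (simp add: nn_integral_norm_square[OF hs])
  also have "\<dots> < \<infinity>"
    by (simp add: ennreal_mult_less_top)
  finally show fin: "(\<integral>\<^sup>+z. \<integral>\<^sup>+\<xi>. ennreal ((cmod (fourier_leray a b h z \<xi>))\<^sup>2) \<partial>lborel \<partial>lborel) < \<infinity>" .
  show si: "square_integrable (inverse_partial_fourier (fourier_leray a b h))"
    by (rule square_integrable_inverse_partial_fourier[OF F fin])
  have "ennreal ((norm (L2_of (inverse_partial_fourier (fourier_leray a b h))))\<^sup>2)
      = ennreal (1 / (2 * pi)) * (\<integral>\<^sup>+z. \<integral>\<^sup>+\<xi>. ennreal ((cmod (fourier_leray a b h z \<xi>))\<^sup>2) \<partial>lborel \<partial>lborel)"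
    using nn_integral_inverse_partial_fourier[OF F] by (simp add: nn_integral_norm_square[OF si])
  also have "\<dots> \<le> ennreal (1 / (2 * pi)) * (ennreal (1 / sqrt (a * b)) * (ennreal (2 * pi) * ennreal ((norm (L2_of h))\<^sup>2)))"
    by (intro mult_left_mono le) simp
  also have "\<dots> = ennreal (1 / sqrt (a * b) * (norm (L2_of h))\<^sup>2)"
    using c by (simp flip: ennreal_mult)
  finally show "(norm (L2_of (inverse_partial_fourier (fourier_leray a b h))))\<^sup>2 \<le> 1 / sqrt (a * b) * (norm (L2_of h))\<^sup>2"
    using c by simp
qed

text \<open>In real coordinates the defining function is a s^2 + b t^2, so the real part of the
  pairing completes to half of a definite quadratic form in the difference of the base points. It is
  positive off the singular fibre, which is what \<open>laplace_square\<close> requires.\<close>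

lemma leray_denominator_hypersurface_point:
  fixes \<beta> x0 y0 u x s t :: real
  defines "a \<equiv> 1 + \<beta>" and "b \<equiv> 1 - \<beta>"
  shows "leray_denominator \<beta> (hypersurface_point \<beta> (s, t, x)) (hypersurface_point \<beta> (x0, y0, u))
    = (Complex (a * (s - x0)\<^sup>2 + b * (t - y0)\<^sup>2) (x - u + 2 * (a * s * (t - y0) - b * t * (s - x0))))\<^sup>2 / 4"
proof -
  define q where "q s t = (cmod (Complex s t))\<^sup>2 + \<beta> * Re ((Complex s t)\<^sup>2)" for s t
  have q: "q s t = a * s\<^sup>2 + b * t\<^sup>2" for s t
  proof -
    have "(cmod (Complex s t))\<^sup>2 = s\<^sup>2 + t\<^sup>2" "Re ((Complex s t)\<^sup>2) = s\<^sup>2 - t\<^sup>2"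
      by (simp_all add: cmod_power2) (simp add: power2_eq_square)
    then have "q s t = s\<^sup>2 + t\<^sup>2 + \<beta> * (s\<^sup>2 - t\<^sup>2)"
      by (simp only: q_def)
    then show ?thesis
      by (simp add: a_def b_def algebra_simps)
  qed
  have eq: "(cnj (Complex s t) + of_real \<beta> * Complex s t) * (Complex s t - Complex x0 y0)
      + \<i> / 2 * (Complex x (q s t) - Complex u (q x0 y0))
    = Complex (a * (s - x0)\<^sup>2 + b * (t - y0)\<^sup>2) (x - u + 2 * (a * s * (t - y0) - b * t * (s - x0))) / 2"
    unfolding q by (simp add: complex_eq_iff a_def b_def power2_eq_square field_simps)
  show ?thesis
    unfolding leray_denominator_def hypersurface_point_def prod.case q_def[symmetric] eq power_divide by simp
qed

text \<open>Separates decay and oscillation in \<xi>, in the form in which they appear in the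
  Laplace integral.\<close>

lemma leray_kernel_polar:
  "leray_kernel a b \<xi> z \<zeta> = of_real (2 * \<xi> / pi * exp (- (a * (fst \<zeta> - fst z)\<^sup>2 + b * (snd \<zeta> - snd z)\<^sup>2) * \<xi>))
    * cis (- (2 * (a * fst \<zeta> * (snd \<zeta> - snd z) - b * snd \<zeta> * (fst \<zeta> - fst z))) * \<xi>)"
proof -
  have "exp (Complex p q) = complex_of_real (exp p) * cis q" for p q
    by (simp add: exp_eq_polar)
  moreover have "- \<xi> * (a * (fst \<zeta> - fst z)\<^sup>2 + b * (snd \<zeta> - snd z)\<^sup>2)
      = - (a * (fst \<zeta> - fst z)\<^sup>2 + b * (snd \<zeta> - snd z)\<^sup>2) * \<xi>"
    "- 2 * \<xi> * (a * fst \<zeta> * (snd \<zeta> - snd z) - b * snd \<zeta> * (fst \<zeta> - fst z))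
      = - (2 * (a * fst \<zeta> * (snd \<zeta> - snd z) - b * snd \<zeta> * (fst \<zeta> - fst z))) * \<xi>"
    by (simp_all only: mult_ac minus_mult_left[symmetric] minus_mult_right[symmetric])
  ultimately show ?thesis
    by (simp only: leray_kernel_def of_real_mult mult.assoc)
qed

text \<open>Writing \<open>1/D\<^sup>2\<close> as a Laplace integral turns the inner integral into
  the Fourier transform of a slice.\<close>

lemma leray_inner_integral:
  fixes a b u :: real and z \<zeta> :: "real \<times> real"
  assumes h: "test_function h"
  defines "\<phi> \<equiv> a * (fst \<zeta> - fst z)\<^sup>2 + b * (snd \<zeta> - snd z)\<^sup>2"
    and "\<tau> \<equiv> 2 * (a * fst \<zeta> * (snd \<zeta> - snd z) - b * snd \<zeta> * (fst \<zeta> - fst z))"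
  assumes \<phi>: "\<phi> > 0"
  shows "(LINT x|lborel. slice h \<zeta> x * (4 / (Complex \<phi> (x - u + \<tau>))\<^sup>2))
    = (LINT \<xi>|lborel. of_real (2 * pi) * (cis (\<xi> * u) *
        (indicator {0<..} \<xi> *\<^sub>R (leray_kernel a b \<xi> z \<zeta> * fourier (slice h \<zeta>) \<xi>))))"
proof -
  have [measurable]: "h \<in> borel_measurable borel"
    by (rule test_function_measurable[OF h])
  have s: "integrable lborel (slice h \<zeta>)"
    by (rule tameD(1)[OF tame_slice[OF h]])
  \<comment> \<open>The factor 4 comes from the halved base of the denominator. Under the integral
    in \<xi>, the exponential decay does not depend on x, so \<open>k\<close> is dominated by a
    product of a slice and a Laplace integrand.\<close>
  define k where "k x \<xi> = 4 * slice h \<zeta> x * (indicator {0<..} \<xi> *\<^sub>R (of_real (\<xi> * exp (- \<phi> * \<xi>)) * cis (- (x - u + \<tau>) * \<xi>)))" for x \<xi>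
  have k: "integrable (lborel \<Otimes>\<^sub>M lborel) (case_prod k)"
  proof (rule Bochner_Integration.integrable_bound)
    show "integrable (lborel \<Otimes>\<^sub>M lborel)
        (\<lambda>(x, \<xi>). 4 * slice h \<zeta> x * complex_of_real (indicator {0<..} \<xi> * (\<xi> * exp (- \<phi> * \<xi>))))"
      by (intro integrable_pair_mult integrable_mult_right integrable_of_real s laplace_square(1) \<phi>)
    show "AE p in lborel \<Otimes>\<^sub>M lborel. norm (case_prod k p)
        \<le> norm (case p of (x, \<xi>) \<Rightarrow> 4 * slice h \<zeta> x * complex_of_real (indicator {0<..} \<xi> * (\<xi> * exp (- \<phi> * \<xi>))))"
      by (intro AE_I2) (auto simp: k_def norm_mult split: split_indicator)
  qed (unfold k_def, measurable)
  have "slice h \<zeta> x * (4 / (Complex \<phi> (x - u + \<tau>))\<^sup>2) = (LINT \<xi>|lborel. k x \<xi>)" for x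
  proof -
    have "slice h \<zeta> x * (4 / (Complex \<phi> (x - u + \<tau>))\<^sup>2) = 4 * slice h \<zeta> x * (1 / (Complex \<phi> (x - u + \<tau>))\<^sup>2)"
      by simp
    then show ?thesis
      by (simp only: k_def integral_mult_right_zero laplace_square(2)[OF \<phi>, symmetric])
  qed
  then have "(LINT x|lborel. slice h \<zeta> x * (4 / (Complex \<phi> (x - u + \<tau>))\<^sup>2)) = (LINT x|lborel. LINT \<xi>|lborel. k x \<xi>)"
    by simp
  also have "\<dots> = (LINT \<xi>|lborel. LINT x|lborel. k x \<xi>)"
    by (rule lborel_pair.Fubini_integral[OF k, symmetric])
  also have "\<dots> = (LINT \<xi>|lborel. of_real (2 * pi) * (cis (\<xi> * u) *
        (indicator {0<..} \<xi> *\<^sub>R (leray_kernel a b \<xi> z \<zeta> * fourier (slice h \<zeta>) \<xi>))))"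
  proof (rule Bochner_Integration.integral_cong[OF refl])
    fix \<xi>
    have L: "leray_kernel a b \<xi> z \<zeta> = of_real (2 * \<xi> / pi * exp (- \<phi> * \<xi>)) * cis (- \<tau> * \<xi>)"
      unfolding \<phi>_def \<tau>_def by (rule leray_kernel_polar)
    have "k x \<xi> = (of_real (2 * pi) * (cis (\<xi> * u) * (indicator {0<..} \<xi> *\<^sub>R leray_kernel a b \<xi> z \<zeta>)))
        * (cis (- \<xi> * x) * slice h \<zeta> x)" for x
    proof -
      have c: "cis (- (x - u + \<tau>) * \<xi>) = cis (\<xi> * u) * cis (- \<tau> * \<xi>) * cis (- \<xi> * x)"
        by (simp add: cis_mult algebra_simps)
      have "k x \<xi> = (4 * of_real (\<xi> * exp (- \<phi> * \<xi>)))
          * (of_real (indicator {0<..} \<xi>) * (cis (\<xi> * u) * cis (- \<tau> * \<xi>)) * (cis (- \<xi> * x) * slice h \<zeta> x))"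
        unfolding k_def c scaleR_conv_of_real by (simp only: mult_ac)
      \<comment> \<open>The constant 4 \<xi> is split into the normalisation 2 \<xi> / pi of the
        kernel and the factor 2 pi, which partly survives in the inverse transform.\<close>
      also have "4 * of_real (\<xi> * exp (- \<phi> * \<xi>)) = complex_of_real (2 * pi) * of_real (2 * \<xi> / pi * exp (- \<phi> * \<xi>))"
      proof -
        have "complex_of_real (4 * (\<xi> * exp (- \<phi> * \<xi>))) = complex_of_real (2 * pi * (2 * \<xi> / pi * exp (- \<phi> * \<xi>)))"
          by (rule arg_cong[where f = complex_of_real]) simp
        then show ?thesis
          by (simp only: of_real_mult[of 4] of_real_mult[of "2 * pi"] of_real_numeral)
      qed
      also have "\<dots> * (of_real (indicator {0<..} \<xi>) * (cis (\<xi> * u) * cis (- \<tau> * \<xi>)) * (cis (- \<xi> * x) * slice h \<zeta> x))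
          = (of_real (2 * pi) * (cis (\<xi> * u) * (indicator {0<..} \<xi> *\<^sub>R leray_kernel a b \<xi> z \<zeta>)))
            * (cis (- \<xi> * x) * slice h \<zeta> x)"
        unfolding L scaleR_conv_of_real by (simp only: mult_ac)
      finally show ?thesis .
    qed
    then have "(LINT x|lborel. k x \<xi>)
        = (of_real (2 * pi) * (cis (\<xi> * u) * (indicator {0<..} \<xi> *\<^sub>R leray_kernel a b \<xi> z \<zeta>))) * fourier (slice h \<zeta>) \<xi>"
      by (simp only: integral_mult_right_zero fourier_def)
    then show "(LINT x|lborel. k x \<xi>) = of_real (2 * pi) * (cis (\<xi> * u) *
        (indicator {0<..} \<xi> *\<^sub>R (leray_kernel a b \<xi> z \<zeta> * fourier (slice h \<zeta>) \<xi>)))"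
      by simp
  qed
  finally show ?thesis .
qed

text \<open>Two exchanges of integrals: the first, for each base point off the singular fibre, is
  \<open>leray_inner_integral\<close>; the second exchanges base point and frequency. The frequency
  integral that remains is an inverse Fourier transform.\<close>

lemma leray_transform_hypersurface_point:
  assumes \<beta>: "0 \<le> \<beta>" "\<beta> < 1" and f: "test_function (f \<circ> hypersurface_point \<beta>)"
  shows "leray_transform \<beta> f \<circ> hypersurface_point \<beta>
    = inverse_partial_fourier (fourier_leray (1 + \<beta>) (1 - \<beta>) (f \<circ> hypersurface_point \<beta>))"
proof
  fix p :: "real \<times> real \<times> real"
  define h where "h = f \<circ> hypersurface_point \<beta>"
  define a where "a = 1 + \<beta>"
  define b where "b = 1 - \<beta>"
  have ab: "a > 0" "b > 0" "a + b = 2" using \<beta> by (auto simp: a_def b_def)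
  have h: "test_function h" using f by (simp add: h_def)
  have [measurable]: "h \<in> borel_measurable borel"
    by (rule test_function_measurable[OF h])
  obtain x0 y0 u where p: "p = (x0, y0, u)" by (cases p)
  define z where "z = (x0, y0)"
  define \<phi> where "\<phi> \<zeta> = a * (fst \<zeta> - fst z)\<^sup>2 + b * (snd \<zeta> - snd z)\<^sup>2" for \<zeta> :: "real \<times> real"
  define \<tau> where "\<tau> \<zeta> = 2 * (a * fst \<zeta> * (snd \<zeta> - snd z) - b * snd \<zeta> * (fst \<zeta> - fst z))" for \<zeta> :: "real \<times> real"
  define m where "m \<xi> \<zeta> = of_real (2 * pi) * (cis (\<xi> * u) *
        (indicator {0<..} \<xi> *\<^sub>R (leray_kernel a b \<xi> z \<zeta> * fourier (slice h \<zeta>) \<xi>)))" for \<xi> \<zeta>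
  have [measurable]: "case_prod m \<in> borel_measurable (lborel \<Otimes>\<^sub>M lborel)"
    unfolding m_def by measurable
  \<comment> \<open>For fixed \<xi> the integral over \<zeta> is at most a constant times 1 / (1 +
    \<xi>^2): the slices decay uniformly in \<zeta> and the kernel mass is constant in \<xi>. This
    absolute convergence is where the singularity disappears.\<close>
  have m: "integrable (lborel \<Otimes>\<^sub>M lborel) (case_prod m)"
  proof (rule integrable_pairI)
    obtain R C where C: "C \<ge> 0" "\<And>\<zeta> \<xi>. cmod (fourier (slice h \<zeta>) \<xi>) \<le> C / (1 + \<xi>\<^sup>2)"
      by (rule test_function_slice[OF h]) blast
    have pos: "2 * pi * (C / (1 + \<xi>\<^sup>2)) \<ge> 0" for \<xi>
      using C by (intro mult_nonneg_nonneg divide_nonneg_nonneg) auto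
    have c: "2 / sqrt (a * b) \<ge> 0" using ab by simp
    have "(\<integral>\<^sup>+\<zeta>. ennreal (norm (m \<xi> \<zeta>)) \<partial>lborel) \<le> ennreal (2 * pi * (2 / sqrt (a * b)) * (C / (1 + \<xi>\<^sup>2)))" for \<xi>
    proof (cases "\<xi> > 0")
      case True
      have "(\<integral>\<^sup>+\<zeta>. ennreal (norm (m \<xi> \<zeta>)) \<partial>lborel)
          \<le> (\<integral>\<^sup>+\<zeta>. ennreal (2 * pi * (C / (1 + \<xi>\<^sup>2))) * ennreal (cmod (leray_kernel a b \<xi> z \<zeta>)) \<partial>lborel)"
      proof (rule nn_integral_mono)
        fix \<zeta>
        have "cmod (leray_kernel a b \<xi> z \<zeta>) * cmod (fourier (slice h \<zeta>) \<xi>) \<le> cmod (leray_kernel a b \<xi> z \<zeta>) * (C / (1 + \<xi>\<^sup>2))"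
          by (intro mult_left_mono C) simp
        then have "2 * pi * (cmod (leray_kernel a b \<xi> z \<zeta>) * cmod (fourier (slice h \<zeta>) \<xi>))
            \<le> 2 * pi * (cmod (leray_kernel a b \<xi> z \<zeta>) * (C / (1 + \<xi>\<^sup>2)))"
          by (rule mult_left_mono) simp
        then have "norm (m \<xi> \<zeta>) \<le> 2 * pi * (C / (1 + \<xi>\<^sup>2)) * cmod (leray_kernel a b \<xi> z \<zeta>)"
          using True by (simp add: m_def norm_mult mult_ac)
        then show "ennreal (norm (m \<xi> \<zeta>)) \<le> ennreal (2 * pi * (C / (1 + \<xi>\<^sup>2))) * ennreal (cmod (leray_kernel a b \<xi> z \<zeta>))"
          unfolding ennreal_mult[OF pos norm_ge_zero, symmetric] by (rule ennreal_leI)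
      qed
      also have "\<dots> = ennreal (2 * pi * (C / (1 + \<xi>\<^sup>2))) * ennreal (2 / sqrt (a * b))"
        using nn_integral_leray_kernel(1)[OF ab(1,2) True, of z] by (subst nn_integral_cmult) simp_all
      also have "\<dots> = ennreal (2 * pi * (2 / sqrt (a * b)) * (C / (1 + \<xi>\<^sup>2)))"
        unfolding ennreal_mult[OF pos c, symmetric] by (simp add: mult_ac)
      finally show ?thesis .
    qed (simp add: m_def)
    then have "(\<integral>\<^sup>+\<xi>. \<integral>\<^sup>+\<zeta>. ennreal (norm (m \<xi> \<zeta>)) \<partial>lborel \<partial>lborel)
        \<le> (\<integral>\<^sup>+\<xi>. ennreal (2 * pi * (2 / sqrt (a * b)) * (C / (1 + \<xi>\<^sup>2))) \<partial>lborel)"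
      by (rule nn_integral_mono)
    also have "\<dots> < \<infinity>"
    proof -
      have "integrable lborel (\<lambda>\<xi>. 2 * pi * (2 / sqrt (a * b)) * (C * (1 / (1 + \<xi>\<^sup>2))))"
        by (intro integrable_mult_right integrable_inverse_1_plus_square')
      then show ?thesis
        using C ab by (simp add: integrable_iff_bounded)
    qed
    finally show "(\<integral>\<^sup>+\<xi>. \<integral>\<^sup>+\<zeta>. ennreal (norm (m \<xi> \<zeta>)) \<partial>lborel \<partial>lborel) < \<infinity>" .
  qed measurable
  have "leray_transform \<beta> f (hypersurface_point \<beta> p)
      = 1 / (4 * of_real pi ^ 2) * (LINT \<zeta>|lborel. LINT x|lborel. slice h \<zeta> x * (4 / (Complex (\<phi> \<zeta>) (x - u + \<tau> \<zeta>))\<^sup>2))"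
    unfolding leray_transform_def case_prod_unfold
    by (simp add: p leray_denominator_hypersurface_point h_def slice_def \<phi>_def \<tau>_def z_def flip: a_def b_def)
  also have "(LINT \<zeta>|lborel. LINT x|lborel. slice h \<zeta> x * (4 / (Complex (\<phi> \<zeta>) (x - u + \<tau> \<zeta>))\<^sup>2))
      = (LINT \<zeta>|lborel. LINT \<xi>|lborel. m \<xi> \<zeta>)"
  proof (rule integral_cong_AE)
    show "(\<lambda>\<zeta>. LINT x|lborel. slice h \<zeta> x * (4 / (Complex (\<phi> \<zeta>) (x - u + \<tau> \<zeta>))\<^sup>2)) \<in> borel_measurable lborel"
      unfolding \<phi>_def \<tau>_def by measurable
    \<comment> \<open>The singular fibre is a single base point, a null set of the plane; everywhere
      else \<phi> is positive because a and b are.\<close>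
    show "AE \<zeta> in lborel. (LINT x|lborel. slice h \<zeta> x * (4 / (Complex (\<phi> \<zeta>) (x - u + \<tau> \<zeta>))\<^sup>2)) = (LINT \<xi>|lborel. m \<xi> \<zeta>)"
      using AE_lborel_singleton[of z]
    proof eventually_elim
      case (elim \<zeta>)
      then have "fst \<zeta> - fst z \<noteq> 0 \<or> snd \<zeta> - snd z \<noteq> 0"
        by (auto simp: prod_eq_iff)
      then have "\<phi> \<zeta> > 0"
        using ab unfolding \<phi>_def by (auto intro: add_pos_nonneg add_nonneg_pos)
      then show ?case
        unfolding m_def \<phi>_def \<tau>_def by (rule leray_inner_integral[OF h])
    qed
  qed measurable
  also have "\<dots> = (LINT \<xi>|lborel. LINT \<zeta>|lborel. m \<xi> \<zeta>)"
    by (rule lborel_pair.Fubini_integral[OF m])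
  also have "\<dots> = (LINT \<xi>|lborel. of_real (2 * pi) * (cis (- (- u) * \<xi>) * fourier_leray a b h z \<xi>))"
    by (simp add: m_def fourier_leray_def kernel_op_def mult.commute[of u])
  also have "\<dots> = of_real (2 * pi) * fourier (fourier_leray a b h z) (- u)"
    by (simp only: fourier_def integral_mult_right_zero)
  \<comment> \<open>The outer factor 1 / (4 pi^2) times 2 pi gives the 1 / (2 pi) of the inverse
    transform.\<close>
  also have "1 / (4 * of_real pi ^ 2) * \<dots> = inverse_partial_fourier (fourier_leray a b h) p"
    by (simp add: inverse_partial_fourier_def p z_def power2_eq_square)
  finally show "(leray_transform \<beta> f \<circ> hypersurface_point \<beta>) p
      = inverse_partial_fourier (fourier_leray (1 + \<beta>) (1 - \<beta>) (f \<circ> hypersurface_point \<beta>)) p"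
    by (simp add: a_def b_def h_def)
qed

lemma inverse_partial_fourier_leray_linear:
  assumes f: "test_function f" and g: "test_function g" and ab: "a > 0" "b > 0" "a + b = 2"
  shows "inverse_partial_fourier (fourier_leray a b (\<lambda>p. f p + k * g p))
    = (\<lambda>p. inverse_partial_fourier (fourier_leray a b f) p + k * inverse_partial_fourier (fourier_leray a b g) p)"
proof -
  have slice: "fourier (slice (\<lambda>p. f p + k * g p) \<zeta>) \<xi> = fourier (slice f \<zeta>) \<xi> + k * fourier (slice g \<zeta>) \<xi>" for \<zeta> \<xi>
  proof -
    have "integrable lborel (\<lambda>x. cis (- \<xi> * x) * slice f \<zeta> x)" "integrable lborel (\<lambda>x. cis (- \<xi> * x) * slice g \<zeta> x)"
      by (rule integrable_cis_mult[OF tameD(1)[OF tame_slice[OF f]]], simp)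
        (rule integrable_cis_mult[OF tameD(1)[OF tame_slice[OF g]]], simp)
    then show ?thesis
      unfolding fourier_def by (simp add: slice_def distrib_left mult.left_commute[of _ k])
  qed
  have op: "fourier_leray a b (\<lambda>p. f p + k * g p) z \<xi> = fourier_leray a b f z \<xi> + k * fourier_leray a b g z \<xi>" for z \<xi>
  proof (cases "\<xi> > 0")
    case True
    interpret coisometric_kernel "leray_kernel a b \<xi>" "szego_kernel a b \<xi>" "1 / sqrt (a * b)"
      by (rule coisometric_leray_kernel[OF ab True])
    note i = integrable_kernel_mult[OF T tame_fourier_slice[OF f]] integrable_kernel_mult[OF T tame_fourier_slice[OF g]]
    show ?thesis
      using True i by (simp add: fourier_leray_def kernel_op_def slice distrib_left mult.left_commute[of _ k])
  qed (simp add: fourier_leray_def)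
  show ?thesis
  proof
    fix p :: "real \<times> real \<times> real"
    let ?z = "(fst p, fst (snd p))" and ?u = "- snd (snd p)"
    have "integrable lborel (\<lambda>x. cis (- ?u * x) * fourier_leray a b f ?z x)"
      "integrable lborel (\<lambda>x. cis (- ?u * x) * fourier_leray a b g ?z x)"
      by (rule integrable_cis_mult[OF tameD(1)[OF tame_fourier_leray[OF f ab]]], simp)
        (rule integrable_cis_mult[OF tameD(1)[OF tame_fourier_leray[OF g ab]]], simp)
    then have "fourier (fourier_leray a b (\<lambda>p. f p + k * g p) ?z) ?u
        = fourier (fourier_leray a b f ?z) ?u + k * fourier (fourier_leray a b g ?z) ?u"
      unfolding fourier_def by (simp add: op distrib_left mult.left_commute[of _ k])
    then show "inverse_partial_fourier (fourier_leray a b (\<lambda>p. f p + k * g p)) p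
        = inverse_partial_fourier (fourier_leray a b f) p + k * inverse_partial_fourier (fourier_leray a b g) p"
      by (simp add: inverse_partial_fourier_def distrib_left mult.left_commute[of _ k])
  qed
qed

subsection \<open>The norm of the Leray operator\<close>

lemma test_function_sequence:
  "\<exists>h. (\<forall>n. test_function (h n)) \<and> (\<lambda>n. L2_of (h n)) \<longlonglongrightarrow> (x :: 'a::euclidean_space L2)"
proof -
  have "x \<in> closure {L2_of f |f. test_function f}"
    by (simp add: test_function_dense)
  then obtain s where s: "\<And>n. s n \<in> {L2_of f |f. test_function f}" "s \<longlonglongrightarrow> x"
    unfolding closure_sequential by blast
  then have "\<forall>n. \<exists>f. test_function f \<and> s n = L2_of f"
    by blast
  then obtain h where h: "\<And>n. test_function (h n)" "\<And>n. s n = L2_of (h n)"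
    by metis
  have "s = (\<lambda>n. L2_of (h n))"
    using h(2) by blast
  with h(1) s(2) show ?thesis
    by blast
qed

text \<open>The codomain is left general so that the same density argument gives both uniqueness of
  the operator and equality of real functionals.\<close>

lemma continuous_eq_on_test_functions:
  fixes T T' :: "'a::euclidean_space L2 \<Rightarrow> 'b::t2_space"
  assumes T: "continuous_on UNIV T" "continuous_on UNIV T'"
    and eq: "\<And>f. test_function f \<Longrightarrow> T (L2_of f) = T' (L2_of f)"
  shows "T = T'"
proof
  fix x :: "'a L2"
  obtain h where h: "\<And>n. test_function (h n)" "(\<lambda>n. L2_of (h n)) \<longlonglongrightarrow> x"
    using test_function_sequence[of x] by blast
  have "(\<lambda>n. T (L2_of (h n))) \<longlonglongrightarrow> T x" "(\<lambda>n. T' (L2_of (h n))) \<longlonglongrightarrow> T' x"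
    using T by (auto intro!: isCont_tendsto_compose[OF _ h(2)] simp: continuous_on_eq_continuous_at)
  then show "T x = T' x"
    using LIMSEQ_unique by (simp add: eq[OF h(1)])
qed

text \<open>\<Phi> acts on functions, not on classes. Linearity and the norm bound make it Lipschitz
  in the norm of the classes; the extension to the closure uses completeness of the target, and
  linearity passes to limits.\<close>

lemma bounded_extension:
  fixes \<Phi> :: "('a::euclidean_space \<Rightarrow> complex) \<Rightarrow> 'a L2"
  assumes lin: "\<And>f g k. test_function f \<Longrightarrow> test_function g \<Longrightarrow> \<Phi> (\<lambda>x. f x + k * g x) = \<Phi> f + scaleC_L2 k (\<Phi> g)"
    and B: "B \<ge> 0" "\<And>f. test_function f \<Longrightarrow> norm (\<Phi> f) \<le> B * norm (L2_of f)"
  obtains T where "\<And>f. test_function f \<Longrightarrow> T (L2_of f) = \<Phi> f" "bounded_linear T"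
    "\<And>k x. T (scaleC_L2 k x) = scaleC_L2 k (T x)" "\<And>x. norm (T x) \<le> B * norm x"
proof -
  define S where "S = {L2_of f |f :: 'a \<Rightarrow> complex. test_function f}"
  have minus: "scaleC_L2 (- 1) y = - y" for y :: "'a L2"
    by (simp add: uminus_L2_def)
  have scale1: "scaleC_L2 1 y = y" for y :: "'a L2"
    using minus[of "- y"] scaleR_L2_def[of 1 y] by simp
  have comb: "L2_of f + scaleC_L2 k (L2_of g) = L2_of (\<lambda>x. f x + k * g x)" "test_function (\<lambda>x. f x + k * g x)"
    if "test_function f" "test_function g" for f g :: "'a \<Rightarrow> complex" and k
    using that by (simp_all add: scaleC_L2_of add_L2_of test_function_square_integrable square_integrable_mult_left
        test_function_add test_function_mult_left)
  have diff: "norm (\<Phi> f - \<Phi> g) \<le> B * norm (L2_of f - L2_of g)" if "test_function f" "test_function g" for f g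
    using lin[OF that, of "- 1"] comb[OF that, of "- 1"] B(2)[of "\<lambda>x. f x + - 1 * g x"] by (simp only: minus) simp
  \<comment> \<open>A representative is chosen; by \<open>diff\<close>, two test functions in the
    same class have the same image, so the choice is immaterial.\<close>
  define T0 where "T0 x = \<Phi> (SOME f. test_function f \<and> x = L2_of f)" for x
  have T0: "T0 (L2_of f) = \<Phi> f" if f: "test_function f" for f
  proof -
    define g where "g = (SOME g. test_function g \<and> L2_of f = L2_of g)"
    have "test_function g \<and> L2_of f = L2_of g"
      unfolding g_def by (rule someI[of _ f]) (simp add: f)
    then have "norm (\<Phi> g - \<Phi> f) \<le> 0"
      using diff[of g f] f by simp
    then show ?thesis
      by (simp add: T0_def g_def)
  qed
  have "B-lipschitz_on S T0"
    using B(1) diff T0 by (auto simp: lipschitz_on_def S_def dist_norm)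
  then have "uniformly_continuous_on S T0"
    by (rule lipschitz_on_uniformly_continuous)
  then obtain T where T: "uniformly_continuous_on (closure S) T" "\<And>x. x \<in> S \<Longrightarrow> T0 x = T x"
    by (rule uniformly_continuous_on_extension_on_closure) blast
  have closure: "closure S = UNIV"
    unfolding S_def by (rule test_function_dense)
  have cont: "continuous_on UNIV T"
    using uniformly_continuous_imp_continuous[OF T(1)] by (simp only: closure)
  have lim: "(\<lambda>n. T (s n)) \<longlonglongrightarrow> T x" if "s \<longlonglongrightarrow> x" for s x
    using cont by (intro isCont_tendsto_compose[OF _ that]) (simp add: continuous_on_eq_continuous_at)
  have TS: "T (L2_of f) = \<Phi> f" if "test_function f" for f
  proof -
    have "L2_of f \<in> S"
      unfolding S_def using that by blast
    then show ?thesis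
      using T(2)[of "L2_of f"] T0[OF that] by simp
  qed
  have T_lin: "T (x + scaleC_L2 k y) = T x + scaleC_L2 k (T y)" for x y k
  proof -
    obtain f where f: "\<And>n. test_function (f n)" "(\<lambda>n. L2_of (f n)) \<longlonglongrightarrow> x"
      using test_function_sequence[of x] by blast
    obtain g where g: "\<And>n. test_function (g n)" "(\<lambda>n. L2_of (g n)) \<longlonglongrightarrow> y"
      using test_function_sequence[of y] by blast
    note sc = bounded_linear.tendsto[OF bounded_linear_scaleC_L2, of _ _ _ k]
    have "(\<lambda>n. T (L2_of (f n) + scaleC_L2 k (L2_of (g n)))) \<longlonglongrightarrow> T (x + scaleC_L2 k y)"
      by (intro lim tendsto_add f sc g)
    moreover have "(\<lambda>n. T (L2_of (f n)) + scaleC_L2 k (T (L2_of (g n)))) \<longlonglongrightarrow> T x + scaleC_L2 k (T y)"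
      by (intro tendsto_add lim f sc g)
    moreover have "T (L2_of (f n) + scaleC_L2 k (L2_of (g n))) = T (L2_of (f n)) + scaleC_L2 k (T (L2_of (g n)))" for n
      by (simp only: comb[OF f(1) g(1)] TS lin f(1) g(1))
    ultimately show ?thesis
      using LIMSEQ_unique by simp
  qed
  have norm_T: "norm (T x) \<le> B * norm x" for x
  proof -
    obtain f where f: "\<And>n. test_function (f n)" "(\<lambda>n. L2_of (f n)) \<longlonglongrightarrow> x"
      using test_function_sequence[of x] by blast
    have "norm (T (L2_of (f n))) \<le> B * norm (L2_of (f n))" for n
      by (simp only: TS f B)
    then show ?thesis
      using LIMSEQ_le[OF tendsto_norm[OF lim[OF f(2)]] tendsto_mult[OF tendsto_const tendsto_norm[OF f(2)]]] by blast
  qed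
  have T_0: "T 0 = 0"
    using norm_T[of 0] by simp
  have T_scale: "T (scaleC_L2 k x) = scaleC_L2 k (T x)" for k x
    using T_lin[of 0 k x] by (simp add: T_0)
  show ?thesis
  proof (rule that[OF TS _ T_scale norm_T])
    show "bounded_linear T"
    proof (rule bounded_linear_intro)
      show "T (x + y) = T x + T y" for x y
        using T_lin[of x 1 y] by (simp add: scale1)
      show "T (r *\<^sub>R x) = r *\<^sub>R T x" for r x
        by (simp add: scaleR_L2_def T_scale)
      show "norm (T x) \<le> norm x * B" for x
        using norm_T[of x] by (simp add: mult.commute)
    qed
  qed
qed

text \<open>The extremal pair has Fourier transforms \<open>P\<^sub>\<xi>(\<cdot>, 0)\<close> and \<open>T\<^sub>\<xi>\<^sup>* P\<^sub>\<xi>(\<cdot>, 0)\<close>, cut off to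
  \<open>1 \<le> \<xi> \<le> 2\<close>.\<close>

lemma leray_extremal_pair:
  assumes ab: "a > 0" "b > 0" "a + b = 2"
  obtains g G where "square_integrable g" "square_integrable G" "norm (L2_of g) > 0"
    "(norm (L2_of G))\<^sup>2 = 1 / sqrt (a * b) * (norm (L2_of g))\<^sup>2"
    "\<And>h. test_function h \<Longrightarrow> L2_of (inverse_partial_fourier (fourier_leray a b h)) \<bullet> L2_of g = L2_of h \<bullet> L2_of G"
proof -
  define c where "c = 1 / sqrt (a * b)"
  have c0: "c > 0" using ab by (simp add: c_def)
  \<comment> \<open>A column of the projection kernel, hence a vector fixed by the projection; on
    such vectors the adjoint attains its norm.\<close>
  define p where "p \<xi> z = szego_kernel a b \<xi> z (0, 0)" for \<xi> z
  define q where "q \<xi> = kernel_op (adjoint_kernel (leray_kernel a b \<xi>)) (p \<xi>)" for \<xi>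
  \<comment> \<open>A band bounded away from 0 and infinity gives bounds uniform in the
    frequency.\<close>
  define I where "I = {1..2::real}"
  define gh where "gh z \<xi> = indicator I \<xi> *\<^sub>R p \<xi> z" for z \<xi>
  define Gh where "Gh \<zeta> \<xi> = indicator I \<xi> *\<^sub>R q \<xi> \<zeta>" for \<zeta> \<xi>
  have I: "\<xi> > 0" if "\<xi> \<in> I" for \<xi> using that by (simp add: I_def)
  have [measurable]: "I \<in> sets borel" by (simp add: I_def)
  have coiso: "coisometric_kernel (leray_kernel a b \<xi>) (szego_kernel a b \<xi>) c" if "\<xi> > 0" for \<xi>
    unfolding c_def by (rule coisometric_leray_kernel[OF ab that])
  have meas: "case_prod gh \<in> borel_measurable (lborel \<Otimes>\<^sub>M lborel)" "case_prod Gh \<in> borel_measurable (lborel \<Otimes>\<^sub>M lborel)"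
    unfolding gh_def Gh_def q_def p_def kernel_op_def adjoint_kernel_def by measurable
  note [measurable] = meas
  have norm_p: "cmod (p \<xi> z) = 2 * \<xi> / pi * (exp (- \<xi> * (fst z - 0)\<^sup>2) * exp (- \<xi> * (snd z - 0)\<^sup>2))" if "\<xi> > 0" for \<xi> z
    using that by (simp add: p_def szego_kernel_def norm_mult norm_divide algebra_simps flip: exp_add)
  \<comment> \<open>A common majorant of all \<open>p \<xi>\<close> on the band: the prefactor is
    largest at \<xi> = 2, the Gaussian is widest at \<xi> = 1.\<close>
  define e where "e z = 4 / pi * (exp (- 1 * (fst z - 0)\<^sup>2) * exp (- 1 * (snd z - 0)\<^sup>2))" for z :: "real \<times> real"
  have [measurable]: "e \<in> borel_measurable borel"
    unfolding e_def by measurable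
  have e: "integrable lborel e"
  proof (rule integrableI_bounded)
    have "(\<integral>\<^sup>+z. ennreal (norm (e z)) \<partial>lborel) = ennreal (4 / pi * (sqrt (pi / 1) * sqrt (pi / 1)))"
      by (subst nn_integral_gaussian_pair[of 1 1 "4 / pi" 0 0, symmetric]) (simp_all add: e_def)
    then show "(\<integral>\<^sup>+z. ennreal (norm (e z)) \<partial>lborel) < \<infinity>" by simp
  qed measurable
  have e_le: "e z \<le> 4 / pi" for z
    unfolding e_def by (rule mult_left_le) (auto intro!: mult_le_one)
  have p_le: "cmod (p \<xi> z) \<le> e z" if "\<xi> \<in> I" for \<xi> z
  proof -
    have "exp (- \<xi> * t\<^sup>2) \<le> exp (- 1 * t\<^sup>2)" for t
      using that mult_right_mono[of 1 \<xi> "t\<^sup>2"] by (simp add: I_def)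
    then have pe: "exp (- \<xi> * (fst z - 0)\<^sup>2) * exp (- \<xi> * (snd z - 0)\<^sup>2) \<le> exp (- 1 * (fst z - 0)\<^sup>2) * exp (- 1 * (snd z - 0)\<^sup>2)"
      by (intro mult_mono) auto
    have px: "2 * \<xi> / pi \<le> 4 / pi"
      using that by (simp add: I_def divide_right_mono)
    show ?thesis
      unfolding norm_p[OF I[OF that]] e_def by (rule mult_mono[OF px pe]) auto
  qed
  have p_tame: "tame (p \<xi>)" if "\<xi> \<in> I" for \<xi>
  proof -
    interpret coisometric_kernel "leray_kernel a b \<xi>" "szego_kernel a b \<xi>" c
      by (rule coiso[OF I[OF that]])
    have "cmod (p \<xi> z) \<le> 4 / pi" for z
      using p_le[OF that, of z] e_le[of z] by simp
    then have "bounded (range (p \<xi>))"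
      by (auto simp: bounded_iff)
    moreover have "integrable lborel (p \<xi>)"
      unfolding p_def[abs_def] by (rule integrable_schur_kernel(2)[OF P])
    ultimately show ?thesis
      by (simp add: tame_def)
  qed
  \<comment> \<open>The supremum 4 / pi of \<open>p \<xi>\<close> times the kernel mass 2 / sqrt (a
    * b), which is 2 c.\<close>
  have q_le: "cmod (q \<xi> \<zeta>) \<le> 4 / pi * (2 * c)" if "\<xi> \<in> I" for \<xi> \<zeta>
  proof -
    interpret coisometric_kernel "leray_kernel a b \<xi>" "szego_kernel a b \<xi>" c
      by (rule coiso[OF I[OF that]])
    have "cmod (p \<xi> z) \<le> 4 / pi" for z
      using p_le[OF that, of z] e_le[of z] by simp
    then show ?thesis
      unfolding q_def using nn_integral_leray_kernel(2)[OF ab(1,2) I[OF that], of \<zeta>] c0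
      by (intro norm_kernel_op_le schur_kernel_adjoint T p_tame that) (auto simp: adjoint_kernel_def c_def)
  qed
  have tame_I: "tame (H z)" if H: "case_prod H \<in> borel_measurable (lborel \<Otimes>\<^sub>M lborel)"
    and M: "\<And>\<xi>. cmod (H z \<xi>) \<le> M * indicator I \<xi>" for H :: "real \<times> real \<Rightarrow> real \<Rightarrow> complex" and z M
  proof -
    have [measurable]: "H z \<in> borel_measurable borel"
      using measurable_Pair2[OF H, of z] by simp
    have "integrable lborel (H z)"
    proof (rule Bochner_Integration.integrable_bound)
      show "integrable lborel (\<lambda>\<xi>. M * indicator I \<xi>)"
        unfolding I_def by (intro integrable_mult_right integrable_real_indicator) auto
      show "AE \<xi> in lborel. norm (H z \<xi>) \<le> norm (M * indicator I \<xi>)"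
        using M by (intro AE_I2) (metis abs_ge_self order_trans real_norm_def)
    qed measurable
    moreover have "cmod (H z \<xi>) \<le> \<bar>M\<bar>" for \<xi>
      using M[of \<xi>] by (auto split: split_indicator_asm)
    ultimately show ?thesis
      by (auto simp: tame_def bounded_iff)
  qed
  have gh_tame: "tame (gh z)" for z
  proof (rule tame_I[OF meas(1)])
    show "cmod (gh z \<xi>) \<le> 4 / pi * indicator I \<xi>" for \<xi>
      using p_le[of \<xi> z] e_le[of z] by (auto simp: gh_def split: split_indicator)
  qed
  have Gh_tame: "tame (Gh \<zeta>)" for \<zeta>
  proof (rule tame_I[OF meas(2)])
    show "cmod (Gh \<zeta> \<xi>) \<le> 4 / pi * (2 * c) * indicator I \<xi>" for \<xi>
      using q_le[of \<xi> \<zeta>] by (auto simp: Gh_def split: split_indicator)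
  qed
  \<comment> \<open>The square norm of a reproducing kernel is its diagonal value, here 2 \<xi> /
    pi.\<close>
  define N where "N \<xi> = (\<integral>\<^sup>+z. ennreal ((cmod (p \<xi> z))\<^sup>2) \<partial>lborel)" for \<xi>
  have N: "N \<xi> = ennreal (2 * \<xi> / pi)" if "\<xi> > 0" for \<xi>
  proof -
    have "(cmod (p \<xi> z))\<^sup>2 = (2 * \<xi> / pi)\<^sup>2 * (exp (- (2 * \<xi>) * (fst z - 0)\<^sup>2) * exp (- (2 * \<xi>) * (snd z - 0)\<^sup>2))" for z
    proof -
      have "(exp r)\<^sup>2 = exp (2 * r)" for r :: real
        by (simp add: power2_eq_square flip: exp_add)
      then show ?thesis
        unfolding norm_p[OF that] power_mult_distrib by (simp add: mult.assoc)
    qed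
    then have "N \<xi> = ennreal ((2 * \<xi> / pi)\<^sup>2 * (sqrt (pi / (2 * \<xi>)) * sqrt (pi / (2 * \<xi>))))"
      unfolding N_def using nn_integral_gaussian_pair[of "2 * \<xi>" "2 * \<xi>" "(2 * \<xi> / pi)\<^sup>2" 0 0] that by (simp only:) simp
    also have "(2 * \<xi> / pi)\<^sup>2 * (sqrt (pi / (2 * \<xi>)) * sqrt (pi / (2 * \<xi>))) = 2 * \<xi> / pi"
      using that by (simp add: power2_eq_square field_simps)
    finally show ?thesis .
  qed
  \<comment> \<open>Both square norms are multiples of \<open>A\<close>, with ratio c; it remains to
    bound \<open>A\<close> between two positive numbers, obtained from the endpoints of the band,
    which has length 1.\<close>
  define A where "A = (\<integral>\<^sup>+\<xi>. indicator I \<xi> * ennreal (2 * \<xi> / pi) \<partial>lborel)"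
  have gh_A: "(\<integral>\<^sup>+z. \<integral>\<^sup>+\<xi>. ennreal ((cmod (gh z \<xi>))\<^sup>2) \<partial>lborel \<partial>lborel) = A"
  proof -
    have "(\<integral>\<^sup>+z. \<integral>\<^sup>+\<xi>. ennreal ((cmod (gh z \<xi>))\<^sup>2) \<partial>lborel \<partial>lborel)
        = (\<integral>\<^sup>+\<xi>. \<integral>\<^sup>+z. ennreal ((cmod (gh z \<xi>))\<^sup>2) \<partial>lborel \<partial>lborel)"
      by (rule lborel_pair.Fubini'[symmetric]) measurable
    also have "(\<lambda>\<xi>. \<integral>\<^sup>+z. ennreal ((cmod (gh z \<xi>))\<^sup>2) \<partial>lborel) = (\<lambda>\<xi>. indicator I \<xi> * ennreal (2 * \<xi> / pi))"
      using N[OF I] by (auto simp: gh_def N_def fun_eq_iff split: split_indicator)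
    finally show ?thesis by (simp only: A_def)
  qed
  have Gh_A: "(\<integral>\<^sup>+z. \<integral>\<^sup>+\<xi>. ennreal ((cmod (Gh z \<xi>))\<^sup>2) \<partial>lborel \<partial>lborel) = ennreal c * A"
  proof -
    have qn: "(\<integral>\<^sup>+z. ennreal ((cmod (q \<xi> z))\<^sup>2) \<partial>lborel) = ennreal c * ennreal (2 * \<xi> / pi)" if "\<xi> \<in> I" for \<xi>
    proof -
      interpret coisometric_kernel "leray_kernel a b \<xi>" "szego_kernel a b \<xi>" c
        by (rule coiso[OF I[OF that]])
      note pt = p_tame[OF that] and qt = tame_kernel_op[OF schur_kernel_adjoint[OF T] p_tame[OF that]]
      \<comment> \<open>Idempotence of the kernel, read in its first variable with the second one
        fixed at the origin.\<close>
      have "kernel_op (szego_kernel a b \<xi>) (p \<xi>) = p \<xi>"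
        by (simp add: kernel_op_def p_def PP fun_eq_iff)
      then have "(norm (L2_of (q \<xi>)))\<^sup>2 = c * (norm (L2_of (p \<xi>)))\<^sup>2"
        using norm_adjoint_square[OF pt] by (simp add: q_def)
      then show ?thesis
        using c0 N[OF I[OF that]] nn_integral_norm_square[OF tame_square_integrable[OF pt]]
          nn_integral_norm_square[OF tame_square_integrable[OF qt]]
        by (simp add: N_def ennreal_mult flip: q_def)
    qed
    have "(\<integral>\<^sup>+z. \<integral>\<^sup>+\<xi>. ennreal ((cmod (Gh z \<xi>))\<^sup>2) \<partial>lborel \<partial>lborel)
        = (\<integral>\<^sup>+\<xi>. \<integral>\<^sup>+z. ennreal ((cmod (Gh z \<xi>))\<^sup>2) \<partial>lborel \<partial>lborel)"
      by (rule lborel_pair.Fubini'[symmetric]) measurable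
    also have "(\<lambda>\<xi>. \<integral>\<^sup>+z. ennreal ((cmod (Gh z \<xi>))\<^sup>2) \<partial>lborel) = (\<lambda>\<xi>. ennreal c * (indicator I \<xi> * ennreal (2 * \<xi> / pi)))"
      using qn by (auto simp: Gh_def fun_eq_iff split: split_indicator)
    also have "(\<integral>\<^sup>+\<xi>. ennreal c * (indicator I \<xi> * ennreal (2 * \<xi> / pi)) \<partial>lborel) = ennreal c * A"
      unfolding A_def by (rule nn_integral_cmult) measurable
    finally show ?thesis .
  qed
  have A_le: "A \<le> ennreal (4 / pi)"
  proof -
    have "A \<le> (\<integral>\<^sup>+\<xi>. ennreal (4 / pi) * indicator I \<xi> \<partial>lborel)"
      unfolding A_def by (intro nn_integral_mono) (auto simp: I_def divide_right_mono split: split_indicator intro!: ennreal_leI)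
    then show ?thesis by (simp add: nn_integral_cmult I_def)
  qed
  have A_ge: "A \<ge> ennreal (2 / pi)"
  proof -
    have "(\<integral>\<^sup>+\<xi>. ennreal (2 / pi) * indicator I \<xi> \<partial>lborel) \<le> A"
      unfolding A_def by (intro nn_integral_mono) (auto simp: I_def divide_right_mono split: split_indicator intro!: ennreal_leI)
    then show ?thesis by (simp add: nn_integral_cmult I_def)
  qed
  have A_fin: "A < \<infinity>" "ennreal c * A < \<infinity>"
    using A_le by (auto simp: ennreal_mult_less_top less_top top_unique intro: le_less_trans)
  define g where "g = inverse_partial_fourier gh"
  define G where "G = inverse_partial_fourier Gh"
  have fin: "(\<integral>\<^sup>+z. \<integral>\<^sup>+\<xi>. ennreal ((cmod (gh z \<xi>))\<^sup>2) \<partial>lborel \<partial>lborel) < \<infinity>"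
    "(\<integral>\<^sup>+z. \<integral>\<^sup>+\<xi>. ennreal ((cmod (Gh z \<xi>))\<^sup>2) \<partial>lborel \<partial>lborel) < \<infinity>"
    using A_fin by (simp_all only: gh_A Gh_A)
  have si: "square_integrable g" "square_integrable G"
    unfolding g_def G_def
    by (rule square_integrable_inverse_partial_fourier[OF meas(1) gh_tame fin(1)]
        square_integrable_inverse_partial_fourier[OF meas(2) Gh_tame fin(2)])+
  have g_norm: "ennreal ((norm (L2_of g))\<^sup>2) = ennreal (1 / (2 * pi)) * A"
    using nn_integral_inverse_partial_fourier[OF meas(1) gh_tame] nn_integral_norm_square[OF si(1)] by (simp add: g_def gh_A)
  have G_norm: "ennreal ((norm (L2_of G))\<^sup>2) = ennreal (1 / (2 * pi)) * (ennreal c * A)"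
    using nn_integral_inverse_partial_fourier[OF meas(2) Gh_tame] nn_integral_norm_square[OF si(2)] by (simp add: G_def Gh_A)
  have pos: "norm (L2_of g) > 0"
  proof (rule ccontr)
    assume "\<not> norm (L2_of g) > 0"
    then have "ennreal (1 / (2 * pi)) * A = 0"
      using g_norm by simp
    then have "A = 0"
      using pi_gt_zero by (auto simp: ennreal_eq_0_iff not_le[symmetric])
    with A_ge show False
      using pi_gt_zero by (auto simp: ennreal_eq_0_iff not_le[symmetric])
  qed
  have "ennreal ((norm (L2_of G))\<^sup>2) = ennreal (c * (norm (L2_of g))\<^sup>2)"
    using c0 by (simp add: G_norm g_norm ennreal_mult mult.left_commute)
  then have norms: "(norm (L2_of G))\<^sup>2 = 1 / sqrt (a * b) * (norm (L2_of g))\<^sup>2"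
    using c0 by (simp add: c_def)
  show ?thesis
  proof (rule that[OF si pos norms])
    fix h :: "real \<times> real \<times> real \<Rightarrow> complex"
    assume h: "test_function h"
    have [measurable]: "h \<in> borel_measurable borel" "case_prod (fourier_leray a b h) \<in> borel_measurable (lborel \<Otimes>\<^sub>M lborel)"
      by (rule test_function_measurable[OF h] borel_measurable_fourier_leray[OF h])+
    note F = borel_measurable_fourier_leray[OF h] tame_fourier_leray[OF h ab] inverse_partial_fourier_leray(3)[OF h ab]
    obtain K where K: "K \<ge> 0" "\<And>z \<xi>. cmod (fourier_leray a b h z \<xi>) \<le> K / (1 + \<xi>\<^sup>2)"
      by (rule fourier_leray_bound[OF h ab]) blast
    obtain R C where R: "\<And>\<zeta> x. \<zeta> \<notin> cbox (- R, - R) (R, R) \<Longrightarrow> slice h \<zeta> x = 0"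
      and C: "C \<ge> 0" "\<And>\<zeta> \<xi>. cmod (fourier (slice h \<zeta>) \<xi>) \<le> C / (1 + \<xi>\<^sup>2)"
      by (rule test_function_slice[OF h]) blast
    have div_le: "M / (1 + \<xi>\<^sup>2) \<le> M" if "M \<ge> 0" for M \<xi> :: real
      using that divide_left_mono[of 1 "1 + \<xi>\<^sup>2" M] by (simp add: add_pos_nonneg)
    have iI: "integrable lborel (indicator I :: real \<Rightarrow> real)"
      unfolding I_def by (intro integrable_real_indicator) auto
    have i1: "integrable (lborel \<Otimes>\<^sub>M lborel) (\<lambda>(z, \<xi>). fourier_leray a b h z \<xi> \<bullet> gh z \<xi>)"
    proof (rule Bochner_Integration.integrable_bound[OF integrable_pair_mult[OF integrable_mult_right[OF e, of K] iI]])
      show "AE p in lborel \<Otimes>\<^sub>M lborel. norm (case p of (z, \<xi>) \<Rightarrow> fourier_leray a b h z \<xi> \<bullet> gh z \<xi>)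
          \<le> norm (case p of (z, \<xi>) \<Rightarrow> K * e z * indicator I \<xi>)"
      proof (rule AE_I2, clarify)
        fix z \<xi>
        have "\<bar>fourier_leray a b h z \<xi> \<bullet> gh z \<xi>\<bar> \<le> cmod (fourier_leray a b h z \<xi>) * cmod (gh z \<xi>)"
          by (rule Cauchy_Schwarz_ineq2)
        also have "\<dots> \<le> K * (e z * indicator I \<xi>)"
          using order_trans[OF K(2) div_le[OF K(1)]] K(1) p_le[of \<xi> z]
          by (intro mult_mono) (auto simp: gh_def split: split_indicator)
        finally show "norm (fourier_leray a b h z \<xi> \<bullet> gh z \<xi>) \<le> norm (K * e z * indicator I \<xi>)"
          by (simp add: mult.assoc)
      qed
    qed measurable
    have i2: "integrable (lborel \<Otimes>\<^sub>M lborel) (\<lambda>(\<zeta>, \<xi>). fourier (slice h \<zeta>) \<xi> \<bullet> Gh \<zeta> \<xi>)"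
    proof -
      have "emeasure lborel (cbox (- R, - R) (R, R)) < \<infinity>"
        by (rule emeasure_lborel_cbox_finite)
      then have iB: "integrable lborel (\<lambda>\<zeta>. C * (4 / pi * (2 * c)) * indicator (cbox (- R, - R) (R, R)) \<zeta>)"
        by (intro integrable_mult_right integrable_real_indicator) auto
      show ?thesis
      proof (rule Bochner_Integration.integrable_bound[OF integrable_pair_mult[OF iB iI]])
        show "AE p in lborel \<Otimes>\<^sub>M lborel. norm (case p of (\<zeta>, \<xi>) \<Rightarrow> fourier (slice h \<zeta>) \<xi> \<bullet> Gh \<zeta> \<xi>)
            \<le> norm (case p of (\<zeta>, \<xi>) \<Rightarrow> C * (4 / pi * (2 * c)) * indicator (cbox (- R, - R) (R, R)) \<zeta> * indicator I \<xi>)"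
        proof (rule AE_I2, clarify)
          fix \<zeta> :: "real \<times> real" and \<xi>
          have "cmod (fourier (slice h \<zeta>) \<xi>) \<le> C * indicator (cbox (- R, - R) (R, R)) \<zeta>"
            using order_trans[OF C(2) div_le[OF C(1)]] R[of \<zeta>]
            by (cases "\<zeta> \<in> cbox (- R, - R) (R, R)") (auto simp: fourier_def)
          moreover have "cmod (Gh \<zeta> \<xi>) \<le> 4 / pi * (2 * c) * indicator I \<xi>"
            using q_le[of \<xi> \<zeta>] by (auto simp: Gh_def split: split_indicator)
          ultimately have "cmod (fourier (slice h \<zeta>) \<xi>) * cmod (Gh \<zeta> \<xi>)
              \<le> C * indicator (cbox (- R, - R) (R, R)) \<zeta> * (4 / pi * (2 * c) * indicator I \<xi>)"
            using C(1) by (intro mult_mono) auto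
          then have "\<bar>fourier (slice h \<zeta>) \<xi> \<bullet> Gh \<zeta> \<xi>\<bar>
              \<le> C * (4 / pi * (2 * c)) * indicator (cbox (- R, - R) (R, R)) \<zeta> * indicator I \<xi>"
            using Cauchy_Schwarz_ineq2[of "fourier (slice h \<zeta>) \<xi>" "Gh \<zeta> \<xi>"] by (simp only: mult_ac)
          then show "norm (fourier (slice h \<zeta>) \<xi> \<bullet> Gh \<zeta> \<xi>)
              \<le> norm (C * (4 / pi * (2 * c)) * indicator (cbox (- R, - R) (R, R)) \<zeta> * indicator I \<xi>)"
            unfolding real_norm_def by (rule order_trans[OF _ abs_ge_self])
        qed
      qed measurable
    qed
    \<comment> \<open>Frequency by frequency this is the adjoint relation of the kernel operators;
      outside the band both sides vanish.\<close>
    have fiber: "(LINT z|lborel. fourier_leray a b h z \<xi> \<bullet> gh z \<xi>) = (LINT \<zeta>|lborel. fourier (slice h \<zeta>) \<xi> \<bullet> Gh \<zeta> \<xi>)" for \<xi>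
    proof (cases "\<xi> \<in> I")
      case True
      interpret coisometric_kernel "leray_kernel a b \<xi>" "szego_kernel a b \<xi>" c
        by (rule coiso[OF I[OF True]])
      note t = tame_fourier_slice[OF h, of \<xi>] p_tame[OF True]
      note t' = tame_kernel_op[OF T t(1)] tame_kernel_op[OF schur_kernel_adjoint[OF T] t(2)]
      show ?thesis
        using True I[OF True] kernel_op_adjoint[OF T t]
        by (simp add: inner_L2_of tame_square_integrable t t' fourier_leray_def gh_def Gh_def q_def)
    qed (simp add: gh_def Gh_def)
    have "L2_of (inverse_partial_fourier (fourier_leray a b h)) \<bullet> L2_of g
        = 1 / (2 * pi) * (LINT z|lborel. LINT \<xi>|lborel. fourier_leray a b h z \<xi> \<bullet> gh z \<xi>)"
      unfolding g_def by (rule inner_inverse_partial_fourier[OF F meas(1) gh_tame fin(1)])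
    also have "(LINT z|lborel. LINT \<xi>|lborel. fourier_leray a b h z \<xi> \<bullet> gh z \<xi>)
        = (LINT \<xi>|lborel. LINT z|lborel. fourier_leray a b h z \<xi> \<bullet> gh z \<xi>)"
      by (rule lborel_pair.Fubini_integral[OF i1, symmetric])
    also have "\<dots> = (LINT \<xi>|lborel. LINT \<zeta>|lborel. fourier (slice h \<zeta>) \<xi> \<bullet> Gh \<zeta> \<xi>)"
      by (simp only: fiber)
    also have "\<dots> = (LINT \<zeta>|lborel. LINT \<xi>|lborel. fourier (slice h \<zeta>) \<xi> \<bullet> Gh \<zeta> \<xi>)"
      by (rule lborel_pair.Fubini_integral[OF i2])
    also have "\<dots> = (LINT \<zeta>|lborel. LINT x|lborel. slice h \<zeta> x \<bullet> fourier (Gh \<zeta>) (- x))"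
      by (simp only: fourier_duality[OF tameD(1)[OF tame_slice[OF h]] tameD(1)[OF Gh_tame]])
    also have "1 / (2 * pi) * \<dots> = (LINT \<zeta>|lborel. LINT x|lborel. h (fst \<zeta>, snd \<zeta>, x) \<bullet> G (fst \<zeta>, snd \<zeta>, x))"
    proof -
      have "h (fst \<zeta>, snd \<zeta>, x) \<bullet> G (fst \<zeta>, snd \<zeta>, x) = 1 / (2 * pi) * (slice h \<zeta> x \<bullet> fourier (Gh \<zeta>) (- x))" for \<zeta> x
        by (simp add: G_def inverse_partial_fourier_def slice_def flip: scaleR_conv_of_real of_real_divide)
      then show ?thesis
        by (simp only: integral_mult_right_zero)
    qed
    also have "\<dots> = L2_of h \<bullet> L2_of G"
      using integral_triple[OF square_integrable_inner[OF test_function_square_integrable[OF h] si(2)]]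
      by (simp add: inner_L2_of test_function_square_integrable[OF h] si)
    finally show "L2_of (inverse_partial_fourier (fourier_leray a b h)) \<bullet> L2_of g = L2_of h \<bullet> L2_of G" .
  qed
qed

theorem theorem1p3:
  fixes \<beta> :: real
  assumes "0 \<le> \<beta>" and "\<beta> < 1"
  shows "(\<exists>!T. continuous_on UNIV T \<and> extends_leray_transform \<beta> T)
    \<and> bounded_linear (leray_operator \<beta>)
    \<and> (\<forall>c f. leray_operator \<beta> (scaleC_L2 c f) = scaleC_L2 c (leray_operator \<beta> f))
    \<and> onorm (leray_operator \<beta>) = 1 / root 4 (1 - \<beta>\<^sup>2)"
proof -
  define a where "a = 1 + \<beta>"
  define b where "b = 1 - \<beta>"
  have ab: "a > 0" "b > 0" "a + b = 2"
    using assms by (auto simp: a_def b_def)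
  \<comment> \<open>The square root of the constant c, that is the fourth root of 1 / (1 -
    \<beta>^2).\<close>
  define B where "B = sqrt (1 / sqrt (a * b))"
  have B: "B > 0" "B\<^sup>2 = 1 / sqrt (a * b)"
    using ab by (simp_all add: B_def)
  define \<Phi> where "\<Phi> h = L2_of (inverse_partial_fourier (fourier_leray a b h))" for h
  have lin: "\<Phi> (\<lambda>p. f p + k * g p) = \<Phi> f + scaleC_L2 k (\<Phi> g)" if f: "test_function f" and g: "test_function g" for f g k
  proof -
    note si = inverse_partial_fourier_leray(1)[OF f ab] inverse_partial_fourier_leray(1)[OF g ab]
    show ?thesis
      unfolding \<Phi>_def inverse_partial_fourier_leray_linear[OF f g ab] scaleC_L2_of[OF si(2)]
      by (rule add_L2_of[OF si(1) square_integrable_mult_left[OF si(2)], symmetric])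
  qed
  have bound: "norm (\<Phi> f) \<le> B * norm (L2_of f)" if "test_function f" for f
  proof (rule power2_le_imp_le)
    show "(norm (\<Phi> f))\<^sup>2 \<le> (B * norm (L2_of f))\<^sup>2"
      using inverse_partial_fourier_leray(2)[OF that ab] by (simp only: \<Phi>_def power_mult_distrib B)
  qed (use B in simp)
  obtain T where T: "\<And>f. test_function f \<Longrightarrow> T (L2_of f) = \<Phi> f" "bounded_linear T"
    "\<And>k x. T (scaleC_L2 k x) = scaleC_L2 k (T x)" "\<And>x. norm (T x) \<le> B * norm x"
    using bounded_extension[OF lin less_imp_le[OF B(1)] bound] by blast
  have cont: "continuous_on UNIV T"
    by (intro linear_continuous_on T)
  have leray: "leray_transform \<beta> f \<circ> hypersurface_point \<beta> = inverse_partial_fourier (fourier_leray a b (f \<circ> hypersurface_point \<beta>))"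
    if "test_function (f \<circ> hypersurface_point \<beta>)" for f
    unfolding a_def b_def by (rule leray_transform_hypersurface_point[OF assms that])
  have ext: "extends_leray_transform \<beta> T"
    unfolding extends_leray_transform_def
  proof (intro allI impI conjI)
    fix f assume f: "test_function (f \<circ> hypersurface_point \<beta>)"
    show "square_integrable (leray_transform \<beta> f \<circ> hypersurface_point \<beta>)"
      unfolding leray[OF f] by (rule inverse_partial_fourier_leray(1)[OF f ab])
    show "T (L2_of (f \<circ> hypersurface_point \<beta>)) = L2_of (leray_transform \<beta> f \<circ> hypersurface_point \<beta>)"
      unfolding leray[OF f] T(1)[OF f] \<Phi>_def ..
  qed
  have unique: "T' = T" if T': "continuous_on UNIV T'" "extends_leray_transform \<beta> T'" for T'
  proof (rule continuous_eq_on_test_functions[OF T'(1) cont])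
    fix h :: "real \<times> real \<times> real \<Rightarrow> complex" assume h: "test_function h"
    \<comment> \<open>Every test function on the coordinate space comes from a function on the
      ambient space that reads off the three coordinates, so the extension property determines the
      operator on all test classes.\<close>
    define f where "f = (\<lambda>(\<zeta>1, \<zeta>2). h (Re \<zeta>1, Im \<zeta>1, Re \<zeta>2))"
    have fh: "f \<circ> hypersurface_point \<beta> = h"
      by (auto simp: f_def hypersurface_point_def fun_eq_iff)
    show "T' (L2_of h) = T (L2_of h)"
      using T'(2) ext h unfolding extends_leray_transform_def fh[symmetric] by metis
  qed
  have ex1: "\<exists>!T. continuous_on UNIV T \<and> extends_leray_transform \<beta> T"
    using cont ext unique by blast
  have op: "leray_operator \<beta> = T"
    unfolding leray_operator_def by (rule the1_equality[OF ex1]) (simp add: cont ext)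
  have "onorm T \<le> B"
    by (rule onorm_bound) (use B T(4) in auto)
  moreover have "B \<le> onorm T"
  proof -
    obtain g G where gG: "square_integrable g" "square_integrable G" "norm (L2_of g) > 0"
      "(norm (L2_of G))\<^sup>2 = 1 / sqrt (a * b) * (norm (L2_of g))\<^sup>2"
      "\<And>h. test_function h \<Longrightarrow> L2_of (inverse_partial_fourier (fourier_leray a b h)) \<bullet> L2_of g = L2_of h \<bullet> L2_of G"
      using leray_extremal_pair[OF ab] by blast
    \<comment> \<open>The pairing identity is known for test functions only; both sides are
      continuous in x, so it extends to the whole space and may be evaluated at the class of
      \<open>G\<close> itself.\<close>
    have "(\<lambda>x. T x \<bullet> L2_of g) = (\<lambda>x. x \<bullet> L2_of G)"
      by (rule continuous_eq_on_test_functions)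
        (auto intro!: continuous_intros cont simp: T(1) \<Phi>_def gG(5))
    then have adj: "T (L2_of G) \<bullet> L2_of g = L2_of G \<bullet> L2_of G"
      by (rule fun_cong)
    have "(norm (L2_of G))\<^sup>2 = (B * norm (L2_of g))\<^sup>2"
      using gG(4) by (simp only: power_mult_distrib B)
    then have nG: "norm (L2_of G) = B * norm (L2_of g)"
      by (rule power2_eq_imp_eq) (simp_all add: less_imp_le[OF B(1)])
    \<comment> \<open>Cauchy-Schwarz bounds the square norm of \<open>G\<close> by the operator norm
      times the norms of \<open>G\<close> and \<open>g\<close>. Replacing one factor by B times the
      norm of \<open>g\<close> and cancelling leaves B below the operator norm.\<close>
    have "norm (L2_of G) * norm (L2_of G) = T (L2_of G) \<bullet> L2_of g"
      by (simp add: adj flip: power2_norm_eq_inner power2_eq_square)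
    also have "\<dots> \<le> norm (T (L2_of G)) * norm (L2_of g)"
      by (rule norm_cauchy_schwarz)
    also have "\<dots> \<le> onorm T * norm (L2_of G) * norm (L2_of g)"
      by (intro mult_right_mono onorm T) simp
    finally have "norm (L2_of G) * (B * norm (L2_of g)) \<le> norm (L2_of G) * (onorm T * norm (L2_of g))"
      unfolding nG by (simp add: mult_ac)
    moreover have "norm (L2_of G) > 0"
      using nG B gG(3) by simp
    ultimately show ?thesis
      using gG(3) by (simp add: mult_le_cancel_left_pos mult_le_cancel_right_pos)
  qed
  moreover have "B = 1 / root 4 (1 - \<beta>\<^sup>2)"
  proof -
    have "a * b = 1 - \<beta>\<^sup>2"
      by (simp add: a_def b_def power2_eq_square algebra_simps)
    moreover have "root 4 x = sqrt (sqrt x)" for x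
      using real_root_mult_exp[of 2 2 x] by (simp add: sqrt_def)
    ultimately show ?thesis
      by (simp add: B_def real_sqrt_divide)
  qed
  ultimately show ?thesis
    using ex1 T(2,3) by (simp add: op)
qed

end
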